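(* Let $\mathcal{H}$ be a complex separable Hilbert space. For every submultiplicative and symmetric weight $\nu$ on $\mathbb{R}^d$ satisfying the GRS-condition and every $\alpha=(\alpha_j)_{j=1}^d\in\mathbb{N}_0^d$, the class of $\mathcal{B}(\mathcal{H})$-valued matrices $[A_{k,l}]_{k,l\in\mathbb{Z}^d}$ satisfying $$\sum_{l\in\mathbb{Z}^d}\ \prod_{j=1}^d(1+|l_j|)^{\alpha_j}\ \sup_{k\in\mathbb{Z}^d}\|A_{k,k-l}\|\,\nu(l)<\infty$$ is (with respect to a suitable norm) a solid unital Banach *-algebra which is inverse-closed in $\mathcal{B}(\ell^2(\mathbb{Z}^d;\mathcal{H}))$ and thus symmetric.
   Context: A weight is a continuous function $\nu:\mathbb{R}^d\to(0,\infty)$. It is submultiplicative if $\nu(x+x')\le\nu(x)\nu(x')$ for all $x,x'$; symmetric if $\nu(-x)=\nu(x)$ for all $x$; it satisfies the GRS-condition if $\lim_{n\to\infty}\nu(nz)^{1/n}=1$ for all $z\in\mathbb{R}^d$. $\ell^2(\mathbb{Z}^d;\mathcal{H})$ is the Hilbert space of families $(f_k)_{k\in\mathbb{Z}^d}$ in $\mathcal{H}$ with $\sum_k\|f_k\|^2<\infty$. Matrices act by $A(f_l)_l=(\sum_lA_{k,l}f_l)_k$, which identifies the class with a subalgebra of $\mathcal{B}(\ell^2(\mathbb{Z}^d;\mathcal{H}))$; multiplication is $[AB]_{k,l}=\sum_nA_{k,n}B_{n,l}$ and involution is $[A^*]_{k,l}=(A_{l,k})^*$. A Banach *-algebra is a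 complex Banach algebra with isometric involution. A normed space $\mathcal{A}$ of $\mathcal{B}(\mathcal{H})$-valued matrices is solid if, whenever $A\in\mathcal{A}$ and $\|B_{k,l}\|\le\|A_{k,l}\|$ for all $k,l$, then $B\in\mathcal{A}$ and $\|B\|_{\mathcal{A}}\le\|A\|_{\mathcal{A}}$. $\mathcal{A}\subseteq\mathcal{B}$ (common identity) is inverse-closed in $\mathcal{B}$ if $A\in\mathcal{A}$ invertible in $\mathcal{B}$ implies $A^{-1}\in\mathcal{A}$. $\mathcal{A}$ is symmetric if the spectrum $\sigma_{\mathcal{A}}(A^*A)\subseteq[0,\infty)$ for all $A\in\mathcal{A}$. *)

theory Defs
  imports "HOL-Algebra.Module" "HOL-Analysis.Analysis"
begin

section \<open>Complex Hilbert spaces\<close>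

text \<open>Inner products are linear in the first argument. The class \<open>banach\<close> supplies the
  real normed structure and completeness.\<close>

class complex_hilbert = banach +
  fixes scaleC :: "complex \<Rightarrow> 'a \<Rightarrow> 'a"  (infixr \<open>*\<^sub>C\<close> 75)
    and cinner :: "'a \<Rightarrow> 'a \<Rightarrow> complex"
  assumes scaleC_add_right: "c *\<^sub>C (x + y) = c *\<^sub>C x + c *\<^sub>C y"
    and scaleC_add_left: "(b + c) *\<^sub>C x = b *\<^sub>C x + c *\<^sub>C x"
    and scaleC_scaleC: "b *\<^sub>C c *\<^sub>C x = (b * c) *\<^sub>C x"
    and scaleR_scaleC: "r *\<^sub>R x = complex_of_real r *\<^sub>C x"
    and cinner_commute: "cinner x y = cnj (cinner y x)"
    and cinner_add_left: "cinner (x + y) z = cinner x z + cinner y z"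
    and cinner_scaleC_left: "cinner (c *\<^sub>C x) y = c * cinner x y"
    and cinner_self: "cinner x x = complex_of_real ((norm x)\<^sup>2)"

lemma cinner_add_right:
  fixes x y z :: "'a::complex_hilbert"
  shows "cinner x (y + z) = cinner x y + cinner x z"
  by (metis cinner_add_left cinner_commute complex_cnj_add)

lemma cinner_scaleC_right:
  fixes x y :: "'a::complex_hilbert"
  shows "cinner x (c *\<^sub>C y) = cnj c * cinner x y"
  by (metis cinner_scaleC_left cinner_commute complex_cnj_mult)

lemma scaleC_one:
  fixes x :: "'a::complex_hilbert"
  shows "1 *\<^sub>C x = x"
  using scaleR_scaleC[of 1 x] by simp

lemma norm_scaleC:
  fixes x :: "'a::complex_hilbert"
  shows "norm (c *\<^sub>C x) = cmod c * norm x"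
proof -
  have "complex_of_real ((norm (c *\<^sub>C x))\<^sup>2) = c * cnj c * complex_of_real ((norm x)\<^sup>2)"
    by (simp only: cinner_self[symmetric] cinner_scaleC_left cinner_scaleC_right mult_ac)
  also have "\<dots> = complex_of_real ((cmod c * norm x)\<^sup>2)"
    by (simp only: complex_norm_square[symmetric] of_real_mult[symmetric] power_mult_distrib)
  finally have "(norm (c *\<^sub>C x))\<^sup>2 = (cmod c * norm x)\<^sup>2"
    by (simp only: of_real_eq_iff)
  then show ?thesis
    by (simp add: power2_eq_iff_nonneg)
qed

lemma polarisation_aux: "w \<le> (a + d) / 2"
  if "p = a - 2 * w + b" "b \<le> d" "0 \<le> p" for a b d p w :: real
  using that by simp

lemma norm_cinner_le:
  fixes x y :: "'a::complex_hilbert"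
  shows "cmod (cinner x y) \<le> ((norm x)\<^sup>2 + (norm y)\<^sup>2) / 2"
proof -
  let ?w = "cinner x y"
  define c where "c = - sgn ?w"
  have cn: "cmod c \<le> 1"
    by (simp add: c_def norm_sgn)
  have cw: "cnj c * ?w = - complex_of_real (cmod ?w)"
  proof (cases "?w = 0")
    case False
    have "cnj (sgn ?w) * ?w = complex_of_real (cmod ?w)"
      using False complex_norm_square[of ?w]
      by (simp add: sgn_eq field_simps power2_eq_square)
    then show ?thesis
      by (simp add: c_def)
  qed simp
  have "complex_of_real ((norm (x + c *\<^sub>C y))\<^sup>2)
      = cinner x x + cinner x (c *\<^sub>C y) + cinner (c *\<^sub>C y) x + cinner (c *\<^sub>C y) (c *\<^sub>C y)"
    by (simp only: cinner_self[symmetric] cinner_add_left cinner_add_right add_ac)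
  also have "\<dots> = cinner x x + cnj c * ?w + cnj (cnj c * ?w) + cinner (c *\<^sub>C y) (c *\<^sub>C y)"
    by (metis cinner_commute cinner_scaleC_right)
  also have "\<dots> = complex_of_real ((norm x)\<^sup>2 - 2 * cmod ?w + (norm (c *\<^sub>C y))\<^sup>2)"
    by (simp add: cw cinner_self)
  finally have "(norm (x + c *\<^sub>C y))\<^sup>2 = (norm x)\<^sup>2 - 2 * cmod ?w + (norm (c *\<^sub>C y))\<^sup>2"
    by (simp only: of_real_eq_iff)
  moreover have "(norm (c *\<^sub>C y))\<^sup>2 \<le> (norm y)\<^sup>2"
    using cn by (simp add: norm_scaleC power_mono mult_left_le_one_le)
  ultimately show ?thesis
    by (rule polarisation_aux[OF _ _ zero_le_power2])
qed


section \<open>The Hilbert space of square-summable families\<close>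

typedef (overloaded) ('i, 'h) ell2 =
    "{f :: 'i \<Rightarrow> 'h::complex_hilbert. (\<lambda>k. (norm (f k))\<^sup>2) summable_on UNIV}"
  morphisms ell2_nth Abs_ell2
  by (rule exI[of _ "\<lambda>_. 0"]) simp

setup_lifting type_definition_ell2

lemma ell2_bound:
  fixes f :: "'i \<Rightarrow> 'h::real_normed_vector"
  assumes "C \<ge> 0" and "\<And>F. finite F \<Longrightarrow> L2_set (\<lambda>k. norm (f k)) F \<le> C"
  shows "(\<lambda>k. (norm (f k))\<^sup>2) summable_on UNIV"
    and "sqrt (\<Sum>\<^sub>\<infinity>k. (norm (f k))\<^sup>2) \<le> C"
proof -
  have *: "(\<Sum>k\<in>F. (norm (f k))\<^sup>2) \<le> C\<^sup>2" if "finite F" for F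
    using assms(2)[OF that] assms(1) unfolding L2_set_def
    by (simp add: sqrt_le_D)
  show 1: "(\<lambda>k. (norm (f k))\<^sup>2) summable_on UNIV"
    by (rule nonneg_bdd_above_summable_on) (use * in \<open>auto intro!: bdd_aboveI\<close>)
  have "(\<Sum>\<^sub>\<infinity>k. (norm (f k))\<^sup>2) \<le> C\<^sup>2"
    by (rule infsum_le_finite_sums[OF 1]) (use * in auto)
  then show "sqrt (\<Sum>\<^sub>\<infinity>k. (norm (f k))\<^sup>2) \<le> C"
    using assms(1) by (simp add: real_le_lsqrt)
qed

lemma L2_set_le_infsum:
  assumes "(\<lambda>k. (norm (f k))\<^sup>2) summable_on UNIV" "finite F"
  shows "L2_set (\<lambda>k. norm (f k)) F \<le> sqrt (\<Sum>\<^sub>\<infinity>k. (norm (f k))\<^sup>2)"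
  unfolding L2_set_def
  using infsum_mono2[of "\<lambda>k. (norm (f k))\<^sup>2" F UNIV] assms by simp

lemma L2_set_norm_add:
  fixes f g :: "'i \<Rightarrow> 'h::real_normed_vector"
  shows "L2_set (\<lambda>k. norm (f k + g k)) F \<le> L2_set (\<lambda>k. norm (f k)) F + L2_set (\<lambda>k. norm (g k)) F"
  by (rule order_trans[OF L2_set_mono L2_set_triangle_ineq]) (auto simp: norm_triangle_ineq)

lemma ell2_add:
  fixes f g :: "'i \<Rightarrow> 'h::real_normed_vector"
  assumes "(\<lambda>k. (norm (f k))\<^sup>2) summable_on UNIV" "(\<lambda>k. (norm (g k))\<^sup>2) summable_on UNIV"
  shows "(\<lambda>k. (norm (f k + g k))\<^sup>2) summable_on UNIV"
    and "sqrt (\<Sum>\<^sub>\<infinity>k. (norm (f k + g k))\<^sup>2) \<le>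
      sqrt (\<Sum>\<^sub>\<infinity>k. (norm (f k))\<^sup>2) + sqrt (\<Sum>\<^sub>\<infinity>k. (norm (g k))\<^sup>2)"
proof -
  have nn: "0 \<le> sqrt (\<Sum>\<^sub>\<infinity>k. (norm (f k))\<^sup>2) + sqrt (\<Sum>\<^sub>\<infinity>k. (norm (g k))\<^sup>2)"
    by (simp add: infsum_nonneg)
  have b: "L2_set (\<lambda>k. norm (f k + g k)) F
      \<le> sqrt (\<Sum>\<^sub>\<infinity>k. (norm (f k))\<^sup>2) + sqrt (\<Sum>\<^sub>\<infinity>k. (norm (g k))\<^sup>2)" if "finite F" for F
    using L2_set_norm_add[of f g F] L2_set_le_infsum[OF assms(1) that]
      L2_set_le_infsum[OF assms(2) that] by linarith
  show "(\<lambda>k. (norm (f k + g k))\<^sup>2) summable_on UNIV"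
    by (rule ell2_bound(1)[OF nn b])
  show "sqrt (\<Sum>\<^sub>\<infinity>k. (norm (f k + g k))\<^sup>2) \<le>
      sqrt (\<Sum>\<^sub>\<infinity>k. (norm (f k))\<^sup>2) + sqrt (\<Sum>\<^sub>\<infinity>k. (norm (g k))\<^sup>2)"
    by (rule ell2_bound(2)[OF nn b])
qed

instantiation ell2 :: (type, complex_hilbert) real_vector
begin

lift_definition zero_ell2 :: "('a, 'b) ell2" is "\<lambda>_. 0" by simp
lift_definition plus_ell2 :: "('a, 'b) ell2 \<Rightarrow> ('a, 'b) ell2 \<Rightarrow> ('a, 'b) ell2"
  is "\<lambda>f g k. f k + g k" by (rule ell2_add(1))
lift_definition uminus_ell2 :: "('a, 'b) ell2 \<Rightarrow> ('a, 'b) ell2"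
  is "\<lambda>f k. - f k" by simp
lift_definition minus_ell2 :: "('a, 'b) ell2 \<Rightarrow> ('a, 'b) ell2 \<Rightarrow> ('a, 'b) ell2"
  is "\<lambda>f g k. f k - g k"
  subgoal for f g using ell2_add(1)[of f "\<lambda>k. - g k"] by simp
  done
lift_definition scaleR_ell2 :: "real \<Rightarrow> ('a, 'b) ell2 \<Rightarrow> ('a, 'b) ell2"
  is "\<lambda>r f k. r *\<^sub>R f k"
  by (auto simp: power_mult_distrib intro!: summable_on_cmult_right)
instance
proof
  fix x y z :: "('a, 'b) ell2" and a b :: real
  show "x + y + z = x + (y + z)" by transfer (simp add: add.assoc)
  show "x + y = y + x" by transfer (simp add: add.commute)
  show "0 + x = x" by transfer simp
  show "- x + x = 0" by transfer simp
  show "x - y = x + - y" by transfer simp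
  show "a *\<^sub>R (x + y) = a *\<^sub>R x + a *\<^sub>R y" by transfer (simp add: scaleR_add_right)
  show "(a + b) *\<^sub>R x = a *\<^sub>R x + b *\<^sub>R x" by transfer (simp add: scaleR_add_left)
  show "a *\<^sub>R b *\<^sub>R x = (a * b) *\<^sub>R x" by transfer simp
  show "1 *\<^sub>R x = x" by transfer simp
qed

end

instantiation ell2 :: (type, complex_hilbert) real_normed_vector
begin

lift_definition norm_ell2 :: "('a, 'b) ell2 \<Rightarrow> real"
  is "\<lambda>f. sqrt (\<Sum>\<^sub>\<infinity>k. (norm (f k))\<^sup>2)" .
definition dist_ell2 :: "('a, 'b) ell2 \<Rightarrow> ('a, 'b) ell2 \<Rightarrow> real"
  where "dist_ell2 f g = norm (f - g)"
definition sgn_ell2 :: "('a, 'b) ell2 \<Rightarrow> ('a, 'b) ell2"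
  where "sgn_ell2 f = f /\<^sub>R norm f"
definition uniformity_ell2 :: "(('a, 'b) ell2 \<times> ('a, 'b) ell2) filter"
  where "uniformity_ell2 = (INF e\<in>{0<..}. principal {(x, y). dist x y < e})"
definition open_ell2 :: "('a, 'b) ell2 set \<Rightarrow> bool"
  where "open_ell2 U = (\<forall>x\<in>U. eventually (\<lambda>(x', y). x' = x \<longrightarrow> y \<in> U) uniformity)"

instance
proof
  fix x y :: "('a, 'b) ell2" and a :: real
  show "dist x y = norm (x - y)" by (rule dist_ell2_def)
  show "sgn x = x /\<^sub>R norm x" by (rule sgn_ell2_def)
  show "uniformity = (INF e\<in>{0<..}. principal {(x, y::('a, 'b) ell2). dist x y < e})"
    by (rule uniformity_ell2_def)
  show "open U = (\<forall>x\<in>U. eventually (\<lambda>(x', y). x' = x \<longrightarrow> y \<in> U) uniformity)"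
    for U :: "('a, 'b) ell2 set"
    by (rule open_ell2_def)
  show "norm (x + y) \<le> norm x + norm y" by transfer (rule ell2_add(2))
  show "norm (a *\<^sub>R x) = \<bar>a\<bar> * norm x"
    by transfer (simp add: power_mult_distrib infsum_cmult_right' real_sqrt_mult)
  show "norm x = 0 \<longleftrightarrow> x = 0"
  proof (transfer, intro iffI)
    fix f :: "'a \<Rightarrow> 'b"
    assume s: "(\<lambda>k. (norm (f k))\<^sup>2) summable_on UNIV" and "sqrt (\<Sum>\<^sub>\<infinity>k. (norm (f k))\<^sup>2) = 0"
    then have "(norm (f k))\<^sup>2 = 0" for k
      using nonneg_infsum_le_0D[of "\<lambda>k. (norm (f k))\<^sup>2" UNIV k] by simp
    then show "f = (\<lambda>_. 0)" by auto
  qed simp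
qed

end

lemma norm_ell2_nth_le: "norm (ell2_nth f k) \<le> norm f"
proof -
  have "(\<lambda>k. (norm (ell2_nth f k))\<^sup>2) summable_on UNIV"
    using ell2_nth[of f] by simp
  from L2_set_le_infsum[OF this, of "{k}"] show ?thesis
    by (simp add: norm_ell2.rep_eq)
qed

instance ell2 :: (type, complex_hilbert) banach
proof
  fix X :: "nat \<Rightarrow> ('a, 'b) ell2"
  assume X: "Cauchy X"
  have "Cauchy (\<lambda>n. ell2_nth (X n) k)" for k
  proof (rule CauchyI)
    fix e :: real assume "e > 0"
    then obtain M where M: "\<And>m n. m \<ge> M \<Longrightarrow> n \<ge> M \<Longrightarrow> norm (X m - X n) < e"
      using CauchyD[OF X] by blast
    have "norm (ell2_nth (X m) k - ell2_nth (X n) k) < e" if "m \<ge> M" "n \<ge> M" for m n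
      using M[OF that] norm_ell2_nth_le[of "X m - X n" k] by (simp add: minus_ell2.rep_eq)
    then show "\<exists>M. \<forall>m\<ge>M. \<forall>n\<ge>M. norm (ell2_nth (X m) k - ell2_nth (X n) k) < e"
      by blast
  qed
  then have "\<exists>g. (\<lambda>n. ell2_nth (X n) k) \<longlonglongrightarrow> g" for k
    by (metis Cauchy_convergent convergent_def)
  then obtain g where g: "\<And>k. (\<lambda>n. ell2_nth (X n) k) \<longlonglongrightarrow> g k"
    by metis
  have tail: "\<exists>M. \<forall>m\<ge>M. \<forall>F. finite F \<longrightarrow> L2_set (\<lambda>k. norm (ell2_nth (X m) k - g k)) F \<le> e"
    if "e > 0" for e
  proof -
    obtain M where M: "\<And>m n. m \<ge> M \<Longrightarrow> n \<ge> M \<Longrightarrow> norm (X m - X n) < e"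
      using CauchyD[OF X \<open>e > 0\<close>] by blast
    have "L2_set (\<lambda>k. norm (ell2_nth (X m) k - g k)) F \<le> e" if "m \<ge> M" "finite F" for m F
    proof (rule tendsto_upperbound)
      show "(\<lambda>n. L2_set (\<lambda>k. norm (ell2_nth (X m) k - ell2_nth (X n) k)) F)
          \<longlonglongrightarrow> L2_set (\<lambda>k. norm (ell2_nth (X m) k - g k)) F"
        unfolding L2_set_def by (intro tendsto_intros g)
      have "L2_set (\<lambda>k. norm (ell2_nth (X m) k - ell2_nth (X n) k)) F \<le> e" if "n \<ge> M" for n
      proof -
        have "(\<lambda>k. (norm (ell2_nth (X m - X n) k))\<^sup>2) summable_on UNIV"
          using ell2_nth[of "X m - X n"] by simp
        from L2_set_le_infsum[OF this \<open>finite F\<close>] M[OF \<open>m \<ge> M\<close> that]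
        show ?thesis by (simp add: norm_ell2.rep_eq minus_ell2.rep_eq)
      qed
      then show "\<forall>\<^sub>F n in sequentially.
          L2_set (\<lambda>k. norm (ell2_nth (X m) k - ell2_nth (X n) k)) F \<le> e"
        by (auto simp: eventually_sequentially)
    qed simp
    then show ?thesis by blast
  qed
  obtain M where M: "\<And>F. finite F \<Longrightarrow> L2_set (\<lambda>k. norm (ell2_nth (X M) k - g k)) F \<le> 1"
    using tail[of 1] by auto
  have "(\<lambda>k. (norm (ell2_nth (X M) k - g k))\<^sup>2) summable_on UNIV"
    by (rule ell2_bound(1)[of 1]) (use M in auto)
  then have "(\<lambda>k. (norm (g k - ell2_nth (X M) k))\<^sup>2) summable_on UNIV"
    by (simp add: norm_minus_commute)
  moreover have "(\<lambda>k. (norm (ell2_nth (X M) k))\<^sup>2) summable_on UNIV"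
    using ell2_nth[of "X M"] by simp
  ultimately have "(\<lambda>k. (norm (g k - ell2_nth (X M) k + ell2_nth (X M) k))\<^sup>2) summable_on UNIV"
    by (rule ell2_add(1))
  then have G: "ell2_nth (Abs_ell2 g) = g"
    by (simp add: Abs_ell2_inverse)
  have "X \<longlonglongrightarrow> Abs_ell2 g"
  proof (rule LIMSEQ_I)
    fix e :: real assume "e > 0"
    then obtain M where
      M: "\<And>m F. m \<ge> M \<Longrightarrow> finite F \<Longrightarrow> L2_set (\<lambda>k. norm (ell2_nth (X m) k - g k)) F \<le> e / 2"
      using tail[of "e / 2"] by auto
    have *: "norm (X m - Abs_ell2 g) \<le> e / 2" if "m \<ge> M" for m
      unfolding norm_ell2.rep_eq minus_ell2.rep_eq G
      by (rule ell2_bound(2)) (use M that \<open>e > 0\<close> in auto)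
    have "norm (X m - Abs_ell2 g) < e" if "m \<ge> M" for m
      using *[OF that] \<open>e > 0\<close> by simp
    then show "\<exists>M. \<forall>m\<ge>M. norm (X m - Abs_ell2 g) < e" by blast
  qed
  then show "convergent X" by (auto simp: convergent_def)
qed

lemma summable_on_cinner:
  fixes f g :: "'i \<Rightarrow> 'h::complex_hilbert"
  assumes "(\<lambda>k. (norm (f k))\<^sup>2) summable_on UNIV" "(\<lambda>k. (norm (g k))\<^sup>2) summable_on UNIV"
  shows "(\<lambda>k. cinner (f k) (g k)) summable_on UNIV"
proof -
  have "(\<lambda>k. (1/2) * ((norm (f k))\<^sup>2 + (norm (g k))\<^sup>2)) summable_on UNIV"
    by (intro summable_on_cmult_right summable_on_add assms)
  then have "(\<lambda>k. norm (((norm (f k))\<^sup>2 + (norm (g k))\<^sup>2) / 2)) summable_on UNIV"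
    by simp
  then have "(\<lambda>k. norm (cinner (f k) (g k))) summable_on UNIV"
  proof (rule Infinite_Sum.abs_summable_on_comparison_test)
    show "norm (cinner (f k) (g k)) \<le> norm (((norm (f k))\<^sup>2 + (norm (g k))\<^sup>2) / 2)" for k
      using norm_cinner_le[of "f k" "g k"] by simp
  qed
  then show ?thesis
    by (rule Infinite_Sum.abs_summable_summable)
qed

instantiation ell2 :: (type, complex_hilbert) complex_hilbert
begin

lift_definition scaleC_ell2 :: "complex \<Rightarrow> ('a, 'b) ell2 \<Rightarrow> ('a, 'b) ell2"
  is "\<lambda>c f k. c *\<^sub>C f k"
  by (auto simp: norm_scaleC power_mult_distrib intro!: summable_on_cmult_right)
lift_definition cinner_ell2 :: "('a, 'b) ell2 \<Rightarrow> ('a, 'b) ell2 \<Rightarrow> complex"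
  is "\<lambda>f g. \<Sum>\<^sub>\<infinity>k. cinner (f k) (g k)" .

instance
proof
  fix x y z :: "('a, 'b) ell2" and b c :: complex and r :: real
  show "c *\<^sub>C (x + y) = c *\<^sub>C x + c *\<^sub>C y" by transfer (simp add: scaleC_add_right)
  show "(b + c) *\<^sub>C x = b *\<^sub>C x + c *\<^sub>C x" by transfer (simp add: scaleC_add_left)
  show "b *\<^sub>C c *\<^sub>C x = (b * c) *\<^sub>C x" by transfer (simp add: scaleC_scaleC)
  show "r *\<^sub>R x = complex_of_real r *\<^sub>C x" by transfer (simp add: scaleR_scaleC)
  show "cinner x y = cnj (cinner y x)"
    by transfer (simp only: infsum_cnj[symmetric] cinner_commute[symmetric])
  show "cinner (x + y) z = cinner x z + cinner y z"
    by transfer (simp add: cinner_add_left infsum_add summable_on_cinner)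
  show "cinner (c *\<^sub>C x) y = c * cinner x y"
    by transfer (simp add: cinner_scaleC_left infsum_cmult_right')
  show "cinner x x = complex_of_real ((norm x)\<^sup>2)"
  proof transfer
    fix f :: "'a \<Rightarrow> 'b"
    assume "(\<lambda>k. (norm (f k))\<^sup>2) summable_on UNIV"
    then have "((\<lambda>k. complex_of_real ((norm (f k))\<^sup>2)) has_sum
        complex_of_real (\<Sum>\<^sub>\<infinity>k. (norm (f k))\<^sup>2)) UNIV"
      by (intro has_sum_of_real) simp
    then have "(\<Sum>\<^sub>\<infinity>k. complex_of_real ((norm (f k))\<^sup>2)) = complex_of_real (\<Sum>\<^sub>\<infinity>k. (norm (f k))\<^sup>2)"
      by (rule infsumI)
    then show "(\<Sum>\<^sub>\<infinity>k. cinner (f k) (f k)) =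
        complex_of_real ((sqrt (\<Sum>\<^sub>\<infinity>k. (norm (f k))\<^sup>2))\<^sup>2)"
      by (simp add: cinner_self infsum_nonneg)
  qed
qed

end


section \<open>Complex star-algebras\<close>

text \<open>Complex algebras are rings in the sense of \<open>HOL-Algebra\<close> (hence with identity) that are
  modules over the field of complex numbers; invertible elements are \<open>Units\<close>.\<close>

definition complex_field :: "complex ring" where
  "complex_field = \<lparr>carrier = UNIV, monoid.mult = (*), one = 1, ring.zero = 0, add = (+)\<rparr>"

record 'a star_algebra = "(complex, 'a) module" +
  involution :: "'a \<Rightarrow> 'a"

locale star_algebra = Ring.ring \<A> + Module.module complex_field \<A>
  for \<A> :: "('a, 'm) star_algebra_scheme" (structure) +
  assumes smult_mult_left:
      "\<lbrakk>x \<in> carrier \<A>; y \<in> carrier \<A>\<rbrakk> \<Longrightarrow> (c \<odot> x) \<otimes> y = c \<odot> (x \<otimes> y)"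
    and smult_mult_right:
      "\<lbrakk>x \<in> carrier \<A>; y \<in> carrier \<A>\<rbrakk> \<Longrightarrow> x \<otimes> (c \<odot> y) = c \<odot> (x \<otimes> y)"
    and involution_closed: "x \<in> carrier \<A> \<Longrightarrow> involution \<A> x \<in> carrier \<A>"
    and involution_involution: "x \<in> carrier \<A> \<Longrightarrow> involution \<A> (involution \<A> x) = x"
    and involution_add: "\<lbrakk>x \<in> carrier \<A>; y \<in> carrier \<A>\<rbrakk> \<Longrightarrow>
      involution \<A> (x \<oplus> y) = involution \<A> x \<oplus> involution \<A> y"
    and involution_smult: "x \<in> carrier \<A> \<Longrightarrow> involution \<A> (c \<odot> x) = cnj c \<odot> involution \<A> x"
    and involution_mult: "\<lbrakk>x \<in> carrier \<A>; y \<in> carrier \<A>\<rbrakk> \<Longrightarrow>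
      involution \<A> (x \<otimes> y) = involution \<A> y \<otimes> involution \<A> x"

locale banach_star_algebra = star_algebra \<A>
  for \<A> :: "('a, 'm) star_algebra_scheme" (structure) +
  fixes N :: "'a \<Rightarrow> real"
  assumes N_nonneg: "x \<in> carrier \<A> \<Longrightarrow> 0 \<le> N x"
    and N_eq_0_iff: "x \<in> carrier \<A> \<Longrightarrow> N x = 0 \<longleftrightarrow> x = \<zero>"
    and N_add: "\<lbrakk>x \<in> carrier \<A>; y \<in> carrier \<A>\<rbrakk> \<Longrightarrow> N (x \<oplus> y) \<le> N x + N y"
    and N_smult: "x \<in> carrier \<A> \<Longrightarrow> N (c \<odot> x) = cmod c * N x"
    and N_mult: "\<lbrakk>x \<in> carrier \<A>; y \<in> carrier \<A>\<rbrakk> \<Longrightarrow> N (x \<otimes> y) \<le> N x * N y"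
    and N_involution: "x \<in> carrier \<A> \<Longrightarrow> N (involution \<A> x) = N x"
    and N_complete: "\<lbrakk>range X \<subseteq> carrier \<A>;
        \<forall>e>0. \<exists>M::nat. \<forall>m\<ge>M. \<forall>n\<ge>M. N (X m \<ominus> X n) < e\<rbrakk> \<Longrightarrow>
      \<exists>x\<in>carrier \<A>. (\<lambda>n. N (X n \<ominus> x)) \<longlonglongrightarrow> 0"

definition algebra_spectrum :: "('a, 'm) star_algebra_scheme \<Rightarrow> 'a \<Rightarrow> complex set" where
  "algebra_spectrum \<A> x = {c. (c \<odot>\<^bsub>\<A>\<^esub> \<one>\<^bsub>\<A>\<^esub>) \<ominus>\<^bsub>\<A>\<^esub> x \<notin> Units \<A>}"

definition symmetric_algebra :: "('a, 'm) star_algebra_scheme \<Rightarrow> bool" where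
  "symmetric_algebra \<A> \<longleftrightarrow>
    (\<forall>x\<in>carrier \<A>. algebra_spectrum \<A> (involution \<A> x \<otimes>\<^bsub>\<A>\<^esub> x) \<subseteq> \<real>\<^sub>\<ge>\<^sub>0)"

definition inverse_closed :: "'a set \<Rightarrow> ('a, 'm) star_algebra_scheme \<Rightarrow> bool" where
  "inverse_closed S \<B> \<longleftrightarrow> S \<subseteq> carrier \<B> \<and> \<one>\<^bsub>\<B>\<^esub> \<in> S \<and>
    (\<forall>x\<in>S. x \<in> Units \<B> \<longrightarrow> inv\<^bsub>\<B>\<^esub> x \<in> S)"

text \<open>\<open>ring_hom\<close> comprises preservation of the identity.\<close>

definition star_embedding ::
    "('a \<Rightarrow> 'b) \<Rightarrow> ('a, 'm) star_algebra_scheme \<Rightarrow> ('b, 'n) star_algebra_scheme \<Rightarrow> bool" where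
  "star_embedding \<phi> \<A> \<B> \<longleftrightarrow> \<phi> \<in> ring_hom \<A> \<B> \<and> inj_on \<phi> (carrier \<A>) \<and>
    (\<forall>x\<in>carrier \<A>. (\<forall>c. \<phi> (c \<odot>\<^bsub>\<A>\<^esub> x) = c \<odot>\<^bsub>\<B>\<^esub> \<phi> x) \<and>
      \<phi> (involution \<A> x) = involution \<B> (\<phi> x))"


section \<open>Bounded operators on a complex Hilbert space\<close>

text \<open>The type \<open>'h \<Rightarrow>\<^sub>L 'h\<close> consists of the real-linear bounded operators, with the
  operator norm. The algebra of bounded operators is its complex-linear part.\<close>

definition bounded_operators :: "('h::complex_hilbert \<Rightarrow>\<^sub>L 'h) set" where
  "bounded_operators = {T. \<forall>c x. blinfun_apply T (c *\<^sub>C x) = c *\<^sub>C blinfun_apply T x}"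

definition scaleC_op :: "complex \<Rightarrow> ('h::complex_hilbert \<Rightarrow>\<^sub>L 'h) \<Rightarrow> ('h \<Rightarrow>\<^sub>L 'h)" where
  "scaleC_op c T = Blinfun (\<lambda>x. c *\<^sub>C blinfun_apply T x)"

lemma bounded_linear_scaleC: "bounded_linear (\<lambda>x::'h::complex_hilbert. c *\<^sub>C x)"
proof (rule bounded_linear_intro)
  fix x y :: 'h and r :: real
  show "c *\<^sub>C (x + y) = c *\<^sub>C x + c *\<^sub>C y" by (rule scaleC_add_right)
  show "c *\<^sub>C (r *\<^sub>R x) = r *\<^sub>R (c *\<^sub>C x)" by (simp add: scaleR_scaleC scaleC_scaleC mult.commute)
  show "norm (c *\<^sub>C x) \<le> norm x * cmod c" by (simp add: norm_scaleC)
qed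

lemma scaleC_op_apply: "blinfun_apply (scaleC_op c T) x = c *\<^sub>C blinfun_apply T x"
  unfolding scaleC_op_def
  by (simp add: bounded_linear_Blinfun_apply
      bounded_linear_compose[OF bounded_linear_scaleC blinfun.bounded_linear_right])

text \<open>The adjoint exists by the Riesz representation theorem and is unique.\<close>

definition cadjoint :: "('h::complex_hilbert \<Rightarrow>\<^sub>L 'h) \<Rightarrow> ('h \<Rightarrow>\<^sub>L 'h)" where
  "cadjoint T = (THE S. S \<in> bounded_operators \<and>
    (\<forall>x y. cinner (blinfun_apply T x) y = cinner x (blinfun_apply S y)))"

definition operator_algebra :: "('h::complex_hilbert \<Rightarrow>\<^sub>L 'h) star_algebra" where
  "operator_algebra = \<lparr>carrier = bounded_operators, monoid.mult = (o\<^sub>L), one = id_blinfun,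
    ring.zero = 0, add = (+), module.smult = scaleC_op, involution = cadjoint\<rparr>"


section \<open>Weights\<close>

definition weight :: "(real^'d \<Rightarrow> real) \<Rightarrow> bool" where
  "weight \<nu> \<longleftrightarrow> continuous_on UNIV \<nu> \<and> (\<forall>x. 0 < \<nu> x)"

definition submultiplicative :: "(real^'d \<Rightarrow> real) \<Rightarrow> bool" where
  "submultiplicative \<nu> \<longleftrightarrow> (\<forall>x y. \<nu> (x + y) \<le> \<nu> x * \<nu> y)"

definition symmetric_weight :: "(real^'d \<Rightarrow> real) \<Rightarrow> bool" where
  "symmetric_weight \<nu> \<longleftrightarrow> (\<forall>x. \<nu> (- x) = \<nu> x)"

definition GRS_condition :: "(real^'d \<Rightarrow> real) \<Rightarrow> bool" where
  "GRS_condition \<nu> \<longleftrightarrow> (\<forall>z. (\<lambda>n. \<nu> (real n *\<^sub>R z) powr (1 / real n)) \<longlonglongrightarrow> 1)"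


section \<open>Operator-valued matrices\<close>

type_synonym ('d, 'h) op_matrix = "int^'d \<Rightarrow> int^'d \<Rightarrow> 'h \<Rightarrow>\<^sub>L 'h"

text \<open>The series and the suprema are formed in \<open>ennreal\<close>, so that neither is
  silently replaced by a default value when it is infinite.\<close>

definition matrix_class ::
    "nat^'d \<Rightarrow> (real^'d \<Rightarrow> real) \<Rightarrow> ('d::finite, 'h::complex_hilbert) op_matrix set" where
  "matrix_class \<alpha> \<nu> = {A. (\<forall>k l. A k l \<in> bounded_operators) \<and>
    (\<Sum>\<^sub>\<infinity>l. ennreal (\<Prod>j\<in>UNIV. (1 + real_of_int \<bar>l $ j\<bar>) ^ (\<alpha> $ j)) *
      (SUP k. ennreal (norm (A k (k - l)))) * ennreal (\<nu> (\<chi> j. real_of_int (l $ j)))) < \<infinity>}"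

definition matrix_algebra ::
    "nat^'d \<Rightarrow> (real^'d \<Rightarrow> real) \<Rightarrow> ('d::finite, 'h::complex_hilbert) op_matrix star_algebra" where
  "matrix_algebra \<alpha> \<nu> = \<lparr>carrier = matrix_class \<alpha> \<nu>,
    monoid.mult = (\<lambda>A B k l. \<Sum>\<^sub>\<infinity>n. A k n o\<^sub>L B n l),
    one = (\<lambda>k l. if k = l then id_blinfun else 0),
    ring.zero = (\<lambda>k l. 0),
    add = (\<lambda>A B k l. A k l + B k l),
    module.smult = (\<lambda>c A k l. scaleC_op c (A k l)),
    involution = (\<lambda>A k l. cadjoint (A l k))\<rparr>"

definition solid ::
    "('d::finite, 'h::complex_hilbert) op_matrix set \<Rightarrow> (('d, 'h) op_matrix \<Rightarrow> real) \<Rightarrow> bool" where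
  "solid S N \<longleftrightarrow> (\<forall>A\<in>S. \<forall>B. (\<forall>k l. B k l \<in> bounded_operators) \<longrightarrow>
    (\<forall>k l. norm (B k l) \<le> norm (A k l)) \<longrightarrow> B \<in> S \<and> N B \<le> N A)"

definition acts_as ::
    "('d::finite, 'h::complex_hilbert) op_matrix \<Rightarrow> ((int^'d, 'h) ell2 \<Rightarrow>\<^sub>L (int^'d, 'h) ell2) \<Rightarrow> bool"
  where
  "acts_as A T \<longleftrightarrow> (\<forall>f k. ((\<lambda>l. blinfun_apply (A k l) (ell2_nth f l)) has_sum
    ell2_nth (blinfun_apply T f) k) UNIV)"

text \<open>Meaningful only for matrices that act boundedly on the space of square-summable
  families; the action then determines the operator uniquely.\<close>

definition matrix_operator ::
    "('d::finite, 'h::complex_hilbert) op_matrix \<Rightarrow> ((int^'d, 'h) ell2 \<Rightarrow>\<^sub>L (int^'d, 'h) ell2)" where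
  "matrix_operator A = (THE T. acts_as A T)"

lemma matrix_operator_eq: "matrix_operator A = T" if "acts_as A T"
  unfolding matrix_operator_def
proof (rule the_equality)
  show "acts_as A T" by (rule that)
next
  fix T' assume "acts_as A T'"
  with \<open>acts_as A T\<close> have "ell2_nth (blinfun_apply T' f) = ell2_nth (blinfun_apply T f)" for f
    by (intro ext) (meson acts_as_def has_sum_unique)
  then show "T' = T"
    by (intro blinfun_eqI) (simp add: ell2_nth_inject)
qed

end

theory Submission
  imports Defs "HOL-Real_Asymp.Real_Asymp"
begin

text \<open>Write \<open>v\<close> for the weight \<open>\<Prod>\<^sub>j (1 + |l\<^sub>j|)\<^bsup>\<alpha>\<^sub>j\<^esup> \<nu>(l)\<close>, which is again submultiplicative,
  symmetric and subexponential on the lattice, and \<open>\<parallel>A\<parallel>\<^sub>v = \<Sum>\<^sub>l v(l) sup\<^sub>k \<parallel>A\<^sub>k\<^sub>,\<^sub>k\<^sub>-\<^sub>l\<parallel>\<close> for the norm of the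
  class. Let \<open>C\<close> have finite norm and operator norm less than 1. Split \<open>C\<close> into a banded part \<open>B\<close> of
  width \<open>m\<close> and a remainder whose diagonals \<open>E\<^sub>l\<close> satisfy
  \<open>c = \<parallel>B\<parallel> + \<Sum>\<^sub>l v(l) \<parallel>E\<^sub>l\<parallel> < 1\<close>, with operator norms. In the expansion of \<open>C\<^sup>n\<close> a factor \<open>B\<close> widens
  the band by \<open>m\<close> and a factor \<open>E\<^sub>l\<close> translates it by \<open>l\<close>, and on matrices supported in a band the norm
  of the class is controlled by the operator norm. Hence \<open>\<parallel>C\<^sup>n\<parallel>\<^sub>v \<le> const * V(n m) * c\<^sup>n\<close>, where \<open>V(s)\<close>
  is the total weight of the ball of radius \<open>s\<close>. By the GRS-condition this is summable, so the Neumann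
  series of \<open>1 - C\<close> stays in the class. If \<open>Re \<langle>Y f, f\<rangle> \<ge> \<delta> \<parallel>f\<parallel>\<^sup>2\<close>, then \<open>1 - t Y\<close> is a strict contraction
  for small \<open>t\<close>, so that \<open>Y\<close> is invertible in the class. For invertible \<open>T\<close> this applies to \<open>T\<^sup>* T\<close>,
  which gives inverse-closedness; for \<open>c \<notin> [0, \<infinity>)\<close> it applies to a multiple of \<open>c - T\<^sup>* T\<close>, which
  gives symmetry.\<close>


section \<open>Sums over countable index sets and matrix entries of operators\<close>

lemma nn_integral_count_space_swap:
  fixes f :: "'a \<Rightarrow> 'b \<Rightarrow> ennreal"
  shows "(\<integral>\<^sup>+x. \<integral>\<^sup>+y. f x y \<partial>count_space UNIV \<partial>count_space UNIV)
    = (\<integral>\<^sup>+y. \<integral>\<^sup>+x. f x y \<partial>count_space UNIV \<partial>count_space UNIV)"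
  using nn_integral_fst_count_space[of "case_prod f"] nn_integral_snd_count_space[of "case_prod f"]
  by simp

lemma sum_le_nn_integral_count_space:
  fixes f :: "'a \<Rightarrow> ennreal"
  assumes "finite F"
  shows "sum f F \<le> (\<integral>\<^sup>+x. f x \<partial>count_space UNIV)"
proof -
  have "sum f F = (\<integral>\<^sup>+x. f x * indicator F x \<partial>count_space UNIV)"
    using assms by (subst nn_integral_indicator_finite) auto
  also have "\<dots> \<le> (\<integral>\<^sup>+x. f x \<partial>count_space UNIV)"
    by (intro nn_integral_mono) (auto split: split_indicator)
  finally show ?thesis .
qed

lemma le_nn_integral_count_space:
  fixes f :: "'a \<Rightarrow> ennreal"
  shows "f x \<le> (\<integral>\<^sup>+x. f x \<partial>count_space UNIV)"
  using sum_le_nn_integral_count_space[of "{x}" f] by simp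

text \<open>Translates the series in \<open>matrix_class\<close> into an integral, for which Tonelli
  and Fatou are at hand. Countability provides the increasing finite sets \<open>F n\<close>, so
  that monotone convergence writes the integral as a supremum of finite sums.\<close>

lemma infsum_eq_nn_integral_count_space:
  fixes f :: "'a::countable \<Rightarrow> ennreal"
  shows "infsum f UNIV = (\<integral>\<^sup>+x. f x \<partial>count_space UNIV)"
proof (rule antisym)
  show "infsum f UNIV \<le> (\<integral>\<^sup>+x. f x \<partial>count_space UNIV)"
    by (rule infsum_le_finite_sums[OF nonneg_summable_on_complete])
      (auto intro: sum_le_nn_integral_count_space)
next
  define F where "F n = {x::'a. to_nat x < n}" for n
  have F: "finite (F n)" for n
    unfolding F_def by (rule finite_imageD[of to_nat]) (auto intro: finite_subset[of _ "{..<n}"])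
  have f: "f x = (SUP n. f x * indicator (F n) x)" for x
  proof (rule antisym)
    have "f x = f x * indicator (F (Suc (to_nat x))) x"
      by (simp add: F_def)
    also have "\<dots> \<le> (SUP n. f x * indicator (F n) x)"
      by (rule SUP_upper) simp
    finally show "f x \<le> (SUP n. f x * indicator (F n) x)" .
  qed (auto intro!: SUP_least split: split_indicator)
  have "(\<integral>\<^sup>+x. f x \<partial>count_space UNIV) = (\<integral>\<^sup>+x. (SUP n. f x * indicator (F n) x) \<partial>count_space UNIV)"
    by (simp flip: f)
  also have "\<dots> = (SUP n. \<integral>\<^sup>+x. f x * indicator (F n) x \<partial>count_space UNIV)"
    by (rule nn_integral_monotone_convergence_SUP)
      (auto simp: incseq_def le_fun_def F_def split: split_indicator)
  also have "\<dots> = (SUP n. sum f (F n))"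
    by (subst nn_integral_indicator_finite) (auto simp: F)
  also have "\<dots> \<le> infsum f UNIV"
    unfolding nonneg_infsum_complete[of UNIV f, simplified]
    by (rule SUP_mono) (use F in auto)
  finally show "(\<integral>\<^sup>+x. f x \<partial>count_space UNIV) \<le> infsum f UNIV" .
qed

lemma summable_on_iff_nn_integral_count_space:
  fixes f :: "'a \<Rightarrow> real"
  assumes "\<And>x. 0 \<le> f x"
  shows "f summable_on UNIV \<longleftrightarrow> (\<integral>\<^sup>+x. ennreal (f x) \<partial>count_space UNIV) < \<infinity>" (is "_ \<longleftrightarrow> ?I < \<infinity>")
proof
  assume "f summable_on UNIV"
  then have "(\<lambda>x. norm (f x)) summable_on UNIV"
    using assms by simp
  then have "integrable (count_space UNIV) f"
    by (metis abs_summable_equivalent abs_summable_on_def)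
  then show "?I < \<infinity>"
    using assms by (simp add: integrable_iff_bounded)
next
  assume "?I < \<infinity>"
  then have "integrable (count_space UNIV) f"
    using assms by (simp add: integrable_iff_bounded)
  then have "(\<lambda>x. norm (f x)) summable_on UNIV"
    by (metis abs_summable_equivalent abs_summable_on_def)
  then show "f summable_on UNIV"
    using assms by simp
qed

lemma nn_integral_count_space_eq_infsum:
  fixes f :: "'a \<Rightarrow> real"
  assumes "\<And>x. 0 \<le> f x" "f summable_on UNIV"
  shows "(\<integral>\<^sup>+x. ennreal (f x) \<partial>count_space UNIV) = ennreal (infsum f UNIV)"
proof -
  have "(\<lambda>x. norm (f x)) summable_on UNIV"
    using assms by simp
  then have "Infinite_Set_Sum.abs_summable_on f UNIV"
    unfolding abs_summable_equivalent .
  then show ?thesis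
    using assms by (simp add: nn_integral_conv_infsetsum infsetsum_infsum)
qed

text \<open>The triangle inequality for finite sums passes to the limit. Since the right-hand side
  may be infinite, absolute convergence never has to be checked.\<close>

lemma norm_has_sum_le_nn_integral:
  fixes f :: "'a \<Rightarrow> 'b::real_normed_vector"
  assumes "(f has_sum s) UNIV"
  shows "ennreal (norm s) \<le> (\<integral>\<^sup>+x. ennreal (norm (f x)) \<partial>count_space UNIV)"
proof (rule tendsto_upperbound)
  show "((\<lambda>F. ennreal (norm (sum f F))) \<longlongrightarrow> ennreal (norm s)) (finite_subsets_at_top UNIV)"
    using assms unfolding has_sum_def by (intro tendsto_intros)
  have "ennreal (norm (sum f F)) \<le> (\<integral>\<^sup>+x. ennreal (norm (f x)) \<partial>count_space UNIV)" if "finite F" for F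
  proof -
    have "ennreal (norm (sum f F)) \<le> (\<Sum>x\<in>F. ennreal (norm (f x)))"
      by (simp add: sum_nonneg sum_ennreal norm_sum ennreal_leI)
    also have "\<dots> \<le> (\<integral>\<^sup>+x. ennreal (norm (f x)) \<partial>count_space UNIV)"
      by (rule sum_le_nn_integral_count_space[OF that])
    finally show ?thesis .
  qed
  then show "\<forall>\<^sub>F F in finite_subsets_at_top UNIV. ennreal (norm (sum f F))
      \<le> (\<integral>\<^sup>+x. ennreal (norm (f x)) \<partial>count_space UNIV)"
    by (simp add: eventually_finite_subsets_at_top_weakI)
qed simp

section \<open>Coordinate vectors and block matrices of operators\<close>

lift_definition ell2_single :: "'i \<Rightarrow> 'h::complex_hilbert \<Rightarrow> ('i, 'h) ell2" is
  "\<lambda>i x k. if k = i then x else 0"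
proof -
  fix i :: 'i and x :: 'h
  have "(\<lambda>k. (norm (if k = i then x else 0))\<^sup>2) summable_on {i}"
    by simp
  then show "(\<lambda>k. (norm (if k = i then x else 0))\<^sup>2) summable_on UNIV"
    by (rule summable_on_cong_neutral[THEN iffD1, rotated -1]) auto
qed

lemma infsum_delta:
  fixes f :: "'i \<Rightarrow> 'b::{topological_comm_monoid_add,t2_space}"
  assumes "\<And>k. k \<noteq> i \<Longrightarrow> f k = 0"
  shows "infsum f UNIV = f i"
  using infsum_cong_neutral[of UNIV "{i}" f f] assms by auto

lemma norm_ell2_single: "norm (ell2_single i x) = norm x"
  by transfer (subst infsum_delta, auto)

lemma ell2_eqI: "(\<And>k. ell2_nth f k = ell2_nth g k) \<Longrightarrow> f = g"
  by (metis ell2_nth_inject ext)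

lemma norm_summable_ell2: "(\<lambda>k. (norm (ell2_nth f k))\<^sup>2) summable_on UNIV"
  using ell2_nth[of f] by simp

lemmas ell2_nth_simps = plus_ell2.rep_eq minus_ell2.rep_eq uminus_ell2.rep_eq zero_ell2.rep_eq
  scaleR_ell2.rep_eq scaleC_ell2.rep_eq ell2_single.rep_eq

lift_definition ell2_coord :: "'i \<Rightarrow> ('i, 'h::complex_hilbert) ell2 \<Rightarrow>\<^sub>L 'h" is
  "\<lambda>k f. ell2_nth f k"
  by (rule bounded_linear_intro[of _ 1]) (auto simp: ell2_nth_simps norm_ell2_nth_le)

lift_definition ell2_emb :: "'i \<Rightarrow> 'h::complex_hilbert \<Rightarrow>\<^sub>L ('i, 'h) ell2" is ell2_single
  by (rule bounded_linear_intro[of _ 1])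
    (auto intro!: ell2_eqI simp: ell2_nth_simps norm_ell2_single)

lemma norm_ell2_coord_le: "norm (ell2_coord k) \<le> 1"
  by (rule norm_blinfun_bound) (auto simp: ell2_coord.rep_eq norm_ell2_nth_le)

lemma norm_ell2_emb_le: "norm (ell2_emb k) \<le> 1"
  by (rule norm_blinfun_bound) (auto simp: ell2_emb.rep_eq norm_ell2_single)

lemma ell2_nth_sum: "ell2_nth (sum f F) k = (\<Sum>i\<in>F. ell2_nth (f i) k)"
  by (induction F rule: infinite_finite_induct) (auto simp: ell2_nth_simps)

text \<open>What a partial sum over \<open>F\<close> misses is \<open>f\<close> with the coordinates
  in \<open>F\<close> deleted; its squared norm is a tail of the convergent series of squared
  norms.\<close>

lemma has_sum_ell2_single: "((\<lambda>l. ell2_single l (ell2_nth f l)) has_sum f) UNIV"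
  unfolding has_sum_def
proof (rule tendstoI)
  fix e :: real assume e: "e > 0"
  let ?g = "\<lambda>k. (norm (ell2_nth f k))\<^sup>2"
  have s: "?g summable_on UNIV"
    by (rule norm_summable_ell2)
  then have "(sum ?g \<longlongrightarrow> infsum ?g UNIV) (finite_subsets_at_top UNIV)"
    by (metis has_sum_def has_sum_infsum)
  then have ev: "\<forall>\<^sub>F F in finite_subsets_at_top UNIV. dist (sum ?g F) (infsum ?g UNIV) < e\<^sup>2"
    using e by (intro tendstoD) auto
  have *: "dist (\<Sum>l\<in>F. ell2_single l (ell2_nth f l)) f < e"
    if F: "finite F" and *: "dist (sum ?g F) (infsum ?g UNIV) < e\<^sup>2" for F
  proof -
    let ?h = "f - (\<Sum>l\<in>F. ell2_single l (ell2_nth f l))"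
    have h: "ell2_nth ?h k = (if k \<in> F then 0 else ell2_nth f k)" for k
      using F by (auto simp: ell2_nth_simps ell2_nth_sum)
    have "(norm ?h)\<^sup>2 = (\<Sum>\<^sub>\<infinity>k. (norm (ell2_nth ?h k))\<^sup>2)"
      by (simp add: norm_ell2.rep_eq infsum_nonneg)
    also have "\<dots> = infsum ?g (UNIV - F)"
      unfolding h by (rule infsum_cong_neutral) auto
    also have "\<dots> = infsum ?g UNIV - sum ?g F"
      using s F by (subst infsum_Diff) auto
    also have "\<dots> < e\<^sup>2"
      using * by (simp add: dist_real_def)
    finally have "norm ?h < e"
      using e by (simp add: power_less_imp_less_base)
    then show ?thesis
      by (simp add: dist_norm norm_minus_commute)
  qed
  have "\<forall>\<^sub>F F in finite_subsets_at_top UNIV. finite (F :: 'a set)"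
    by (rule eventually_finite_subsets_at_top_weakI)
  with ev show "\<forall>\<^sub>F F in finite_subsets_at_top UNIV.
      dist (\<Sum>l\<in>F. ell2_single l (ell2_nth f l)) f < e"
    by eventually_elim (rule *)
qed

text \<open>As a composition with the bounded maps \<open>ell2_coord k\<close> and
  \<open>ell2_emb l\<close>, each entry is a bounded linear function of \<open>T\<close>, so
  convergent series of operators may be evaluated entrywise.\<close>

definition opmat :: "(('i, 'h::complex_hilbert) ell2 \<Rightarrow>\<^sub>L ('i, 'h) ell2) \<Rightarrow> 'i \<Rightarrow> 'i \<Rightarrow> 'h \<Rightarrow>\<^sub>L 'h" where
  "opmat T k l = ell2_coord k o\<^sub>L T o\<^sub>L ell2_emb l"

lemma opmat_apply: "blinfun_apply (opmat T k l) x = ell2_nth (blinfun_apply T (ell2_single l x)) k"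
  by (simp add: opmat_def ell2_coord.rep_eq ell2_emb.rep_eq)

lemma bounded_linear_opmat: "bounded_linear (\<lambda>T. opmat T k l)"
  unfolding opmat_def
  by (intro bounded_linear_compose[OF bounded_bilinear.bounded_linear_left[OF bounded_bilinear_blinfun_compose]
        bounded_bilinear.bounded_linear_right[OF bounded_bilinear_blinfun_compose]])

lemma norm_opmat_le:
  fixes T :: "('a, 'b::complex_hilbert) ell2 \<Rightarrow>\<^sub>L ('a, 'b) ell2"
  shows "norm (opmat T k l) \<le> norm T"
proof -
  have "norm (opmat T k l) \<le> norm (ell2_coord k o\<^sub>L T) * norm (ell2_emb l :: 'b \<Rightarrow>\<^sub>L ('a,'b) ell2)"
    unfolding opmat_def by (rule norm_blinfun_compose)
  also have "\<dots> \<le> norm (ell2_coord k o\<^sub>L T) * 1"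
    by (intro mult_left_mono norm_ell2_emb_le) simp
  also have "\<dots> \<le> norm (ell2_coord k :: ('a,'b) ell2 \<Rightarrow>\<^sub>L 'b) * norm T"
    by (simp add: norm_blinfun_compose)
  also have "\<dots> \<le> 1 * norm T"
    by (intro mult_right_mono norm_ell2_coord_le) simp
  finally show ?thesis by simp
qed

lemma has_sum_opmat:
  "((\<lambda>l. blinfun_apply (opmat T k l) (ell2_nth f l)) has_sum ell2_nth (blinfun_apply T f) k) UNIV"
proof -
  have "((\<lambda>l. blinfun_apply (ell2_coord k o\<^sub>L T) (ell2_single l (ell2_nth f l)))
      has_sum blinfun_apply (ell2_coord k o\<^sub>L T) f) UNIV"
    by (rule has_sum_bounded_linear[OF blinfun.bounded_linear_right has_sum_ell2_single])
  then show ?thesis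
    by (simp add: opmat_apply ell2_coord.rep_eq)
qed

text \<open>By \<open>has_sum_opmat\<close> the entries determine every coordinate of every image.
  Matrices and operators can therefore be identified, and identities between matrices proved for
  operators.\<close>

lemma opmat_inject: "opmat S = opmat T \<longleftrightarrow> S = T"
proof
  assume *: "opmat S = opmat T"
  have "ell2_nth (blinfun_apply S f) k = ell2_nth (blinfun_apply T f) k" for f k
    using has_sum_opmat[of S k f] has_sum_opmat[of T k f] * by (simp add: has_sum_unique)
  then show "S = T"
    by (intro blinfun_eqI ell2_eqI)
qed simp

text \<open>This is \<open>has_sum_opmat\<close> applied to the image under \<open>T\<close> of a
  coordinate vector. For arbitrary bounded operators the product series converges in general only
  pointwise, hence the argument \<open>x\<close>.\<close>

lemma has_sum_opmat_compose:
  "((\<lambda>n. blinfun_apply (opmat S k n o\<^sub>L opmat T n l) x) has_sum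
    blinfun_apply (opmat (S o\<^sub>L T) k l) x) UNIV"
  using has_sum_opmat[of S k "blinfun_apply T (ell2_single l x)"]
  by (simp add: opmat_apply)

text \<open>If the integral is a finite number \<open>c\<close>, estimating the pointwise series
  term by term bounds the entry at \<open>x\<close> by \<open>c * norm x\<close>; if it is infinite,
  there is nothing to show.\<close>

lemma norm_opmat_compose_le:
  "ennreal (norm (opmat (S o\<^sub>L T) k l))
    \<le> (\<integral>\<^sup>+n. ennreal (norm (opmat S k n)) * ennreal (norm (opmat T n l)) \<partial>count_space UNIV)"
    (is "_ \<le> ?I")
proof (cases "?I = \<infinity>")
  case False
  then obtain c where c: "c \<ge> 0" "?I = ennreal c"
    by (cases ?I) auto
  have "norm (blinfun_apply (opmat (S o\<^sub>L T) k l) x) \<le> c * norm x" for x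
  proof -
    have "ennreal (norm (blinfun_apply (opmat (S o\<^sub>L T) k l) x))
        \<le> (\<integral>\<^sup>+n. ennreal (norm (blinfun_apply (opmat S k n o\<^sub>L opmat T n l) x)) \<partial>count_space UNIV)"
      by (rule norm_has_sum_le_nn_integral[OF has_sum_opmat_compose])
    also have "\<dots> \<le> (\<integral>\<^sup>+n. ennreal (norm (opmat S k n)) * ennreal (norm (opmat T n l)) * ennreal (norm x)
        \<partial>count_space UNIV)"
    proof (rule nn_integral_mono)
      fix n
      have "norm (blinfun_apply (opmat S k n o\<^sub>L opmat T n l) x)
          \<le> norm (opmat S k n o\<^sub>L opmat T n l) * norm x"
        by (rule norm_blinfun)
      also have "\<dots> \<le> norm (opmat S k n) * norm (opmat T n l) * norm x"
        by (intro mult_right_mono norm_blinfun_compose) simp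
      finally show "ennreal (norm (blinfun_apply (opmat S k n o\<^sub>L opmat T n l) x))
          \<le> ennreal (norm (opmat S k n)) * ennreal (norm (opmat T n l)) * ennreal (norm x)"
        by (simp add: ennreal_mult[symmetric] ennreal_leI)
    qed
    also have "\<dots> = ennreal (c * norm x)"
      using c by (simp add: nn_integral_multc ennreal_mult)
    finally show ?thesis
      using c by (simp add: ennreal_le_iff)
  qed
  then have "norm (opmat (S o\<^sub>L T) k l) \<le> c"
    using c by (intro norm_blinfun_bound) auto
  then show ?thesis
    using c by (simp add: ennreal_leI)
qed simp


section \<open>Adjoints\<close>

lemma scaleC_diff_right: "c *\<^sub>C (x - y) = c *\<^sub>C x - c *\<^sub>C y"
  and scaleC_zero_right: "c *\<^sub>C 0 = 0"
  for x :: "'h::complex_hilbert"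
  using linear_diff[OF bounded_linear.linear[OF bounded_linear_scaleC]]
    linear_0[OF bounded_linear.linear[OF bounded_linear_scaleC]] by auto

lemma cinner_simps:
  fixes x y z :: "'h::complex_hilbert"
  shows cinner_zero_left: "cinner 0 y = 0" and cinner_zero_right: "cinner x 0 = 0"
    and cinner_minus_left: "cinner (- x) y = - cinner x y"
    and cinner_minus_right: "cinner x (- y) = - cinner x y"
    and cinner_diff_left: "cinner (x - z) y = cinner x y - cinner z y"
    and cinner_diff_right: "cinner x (y - z) = cinner x y - cinner x z"
    and cinner_scaleR_left: "cinner (r *\<^sub>R x) y = of_real r * cinner x y"
    and cinner_scaleR_right: "cinner x (r *\<^sub>R y) = of_real r * cinner x y"
proof -
  show *: "cinner (r *\<^sub>R x) y = of_real r * cinner x y"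
    "cinner x (r *\<^sub>R y) = of_real r * cinner x y" for r x and y :: 'h
    by (simp_all add: scaleR_scaleC cinner_scaleC_left cinner_scaleC_right)
  show m: "cinner (- x) y = - cinner x y" "cinner x (- y) = - cinner x y" for x y :: 'h
    using *(1)[of "-1" x y] *(2)[of x "-1" y] by simp_all
  show "cinner 0 y = 0" "cinner x 0 = 0"
    using *(1)[of 0 0 y] *(2)[of x 0 0] by simp_all
  show "cinner (x - z) y = cinner x y - cinner z y" "cinner x (y - z) = cinner x y - cinner x z"
    using cinner_add_left[of x "-z" y] cinner_add_right[of x y "-z"] by (simp_all add: m)
qed

lemma norm_add_squared:
  fixes x y :: "'h::complex_hilbert"
  shows "(norm (x + y))\<^sup>2 = (norm x)\<^sup>2 + 2 * Re (cinner x y) + (norm y)\<^sup>2"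
proof -
  have "complex_of_real ((norm (x + y))\<^sup>2) = cinner x x + cinner x y + cinner y x + cinner y y"
    by (simp only: cinner_self[symmetric] cinner_add_left cinner_add_right add_ac)
  then have "(norm (x + y))\<^sup>2 = Re (cinner x x + cinner x y + cinner y x + cinner y y)"
    by (metis Re_complex_of_real)
  moreover have "Re (cinner y x) = Re (cinner x y)"
    by (subst cinner_commute) simp
  ultimately show ?thesis
    by (simp add: cinner_self)
qed

lemma norm_diff_squared:
  fixes x y :: "'h::complex_hilbert"
  shows "(norm (x - y))\<^sup>2 = (norm x)\<^sup>2 - 2 * Re (cinner x y) + (norm y)\<^sup>2"
  using norm_add_squared[of x "-y"] by (simp add: cinner_minus_right)

text \<open>Cauchy-Schwarz: for normalised vectors the bound in \<open>norm_cinner_le\<close>, half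
  the sum of the squares, equals 1.\<close>

lemma cmod_cinner_le:
  fixes x y :: "'h::complex_hilbert"
  shows "cmod (cinner x y) \<le> norm x * norm y"
proof (cases "x = 0 \<or> y = 0")
  case False
  have "cmod (cinner (x /\<^sub>R norm x) (y /\<^sub>R norm y)) \<le> 1"
    using norm_cinner_le[of "x /\<^sub>R norm x" "y /\<^sub>R norm y"] False by simp
  then show ?thesis
    using False by (simp add: cinner_scaleR_left cinner_scaleR_right norm_mult norm_divide norm_inverse field_simps)
qed (auto simp: cinner_simps)

lemma cinner_extensionality:
  fixes y z :: "'h::complex_hilbert"
  assumes "\<And>x. cinner x y = cinner x z"
  shows "y = z"
  using assms[of "y - z"] cinner_self[of "y - z"] by (simp add: cinner_diff_right)

text \<open>The representing vector is the minimiser of \<open>\<parallel>x\<parallel>\<^sup>2 - 2 Re (\<phi> x)\<close>; minimising sequences are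
  Cauchy by the parallelogram law.\<close>

theorem riesz_representation:
  fixes \<phi> :: "'h::complex_hilbert \<Rightarrow> complex"
  assumes "bounded_linear \<phi>" and hom: "\<And>c x. \<phi> (c *\<^sub>C x) = c * \<phi> x"
  shows "\<exists>y. \<forall>x. \<phi> x = cinner x y"
proof -
  interpret bounded_linear \<phi> by fact
  obtain K where K: "\<And>x. cmod (\<phi> x) \<le> norm x * K"
    using bounded by blast
  define J where "J x = (norm x)\<^sup>2 - 2 * Re (\<phi> x)" for x
  have "- K\<^sup>2 \<le> J x" for x
  proof -
    have "Re (\<phi> x) \<le> norm x * K"
      using K[of x] complex_Re_le_cmod[of "\<phi> x"] by linarith
    moreover have "0 \<le> (norm x - K)\<^sup>2"
      by simp
    ultimately show ?thesis
      unfolding J_def by (simp add: power2_diff)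
  qed
  then have bdd: "bdd_below (range J)"
    by (intro bdd_belowI[of _ "- K\<^sup>2"]) auto
  define m where "m = Inf (range J)"
  have mJ: "m \<le> J x" for x
    unfolding m_def by (rule cInf_lower[OF _ bdd]) simp
  have "\<exists>x. J x < m + 1 / real (Suc n)" for n
    using cInf_lessD[of "range J" "m + 1 / real (Suc n)"] unfolding m_def by auto
  then obtain z where z: "\<And>n. J (z n) < m + 1 / real (Suc n)"
    by metis
  have par: "(norm (a - b))\<^sup>2 = 2 * J a + 2 * J b - 4 * J ((1/2) *\<^sub>R (a + b))" for a b
    unfolding J_def norm_diff_squared norm_scaleR power_mult_distrib norm_add_squared
    by (simp add: scaleR add algebra_simps power2_eq_square)
  have dz: "(norm (z p - z q))\<^sup>2 \<le> 4 / real (Suc n)" if "p \<ge> n" "q \<ge> n" for n p q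
  proof -
    have "1 / real (Suc p) \<le> 1 / real (Suc n)" "1 / real (Suc q) \<le> 1 / real (Suc n)"
      using that by (auto intro!: divide_left_mono)
    then show ?thesis
      using par[of "z p" "z q"] z[of p] z[of q] mJ[of "(1/2) *\<^sub>R (z p + z q)"] by simp
  qed
  have "Cauchy z"
  proof (rule CauchyI)
    fix e :: real assume e: "e > 0"
    then obtain n where n: "4 / e\<^sup>2 < real (Suc n)"
      by (meson less_SucI of_nat_less_iff reals_Archimedean2 order_less_trans lessI)
    have "norm (z p - z q) < e" if "p \<ge> n" "q \<ge> n" for p q
    proof -
      have "(norm (z p - z q))\<^sup>2 \<le> 4 / real (Suc n)"
        by (rule dz[OF that])
      also have "\<dots> < e\<^sup>2"
        using n e by (simp add: field_simps)
      finally show ?thesis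
        using e by (simp add: power_less_imp_less_base)
    qed
    then show "\<exists>M. \<forall>m\<ge>M. \<forall>n\<ge>M. norm (z m - z n) < e"
      by blast
  qed
  then obtain y where y: "z \<longlonglongrightarrow> y"
    using Cauchy_convergent convergent_def by blast
  have "(\<lambda>n. J (z n)) \<longlonglongrightarrow> J y"
    unfolding J_def by (intro tendsto_intros y tendsto)
  moreover have "(\<lambda>n. m + 1 / real (Suc n)) \<longlonglongrightarrow> m + 0"
    by (intro tendsto_intros LIMSEQ_Suc[OF lim_1_over_n])
  ultimately have "J y \<le> m + 0"
    by (rule LIMSEQ_le) (use z in \<open>auto intro: less_imp_le\<close>)
  then have Jy: "J y \<le> J x" for x
    using mJ[of x] by simp
  \<comment> \<open>First-order condition at the minimiser: along \<open>y + t *\<^sub>R x\<close>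
    the increase of \<open>J\<close> is a quadratic in \<open>t\<close> with linear coefficient
    \<open>2 * d\<close>, which stays nonnegative only if \<open>d\<close> is 0.\<close>
  have re: "Re (\<phi> x) = Re (cinner x y)" for x
  proof -
    define d where "d = Re (cinner x y) - Re (\<phi> x)"
    have *: "0 \<le> t\<^sup>2 * (norm x)\<^sup>2 + 2 * t * d" for t
    proof -
      have "J (y + t *\<^sub>R x) = J y + t\<^sup>2 * (norm x)\<^sup>2 + 2 * t * d"
        using cinner_commute[of y x]
        unfolding J_def norm_add_squared d_def
        by (simp add: scaleR add cinner_scaleR_right power_mult_distrib algebra_simps)
      then show ?thesis
        using Jy[of "y + t *\<^sub>R x"] by simp
    qed
    have "d = 0"
    proof (rule ccontr)
      assume "d \<noteq> 0"
      \<comment> \<open>At \<open>t = - d / s\<close> the quadratic is at most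
        \<open>- (d\<^sup>2 / s)\<close>, because \<open>s\<close> exceeds the leading coefficient
        \<open>(norm x)\<^sup>2\<close>; the summand 1 keeps \<open>s\<close> positive when
        \<open>x\<close> is 0.\<close>
      define s where "s = 1 + (norm x)\<^sup>2"
      have s: "s > 0" "(norm x)\<^sup>2 < s"
        unfolding s_def by (auto simp: add_pos_nonneg)
      have "0 \<le> (d / s)\<^sup>2 * (norm x)\<^sup>2 - 2 * d\<^sup>2 / s"
        using *[of "- d / s"] by (simp add: power2_eq_square)
      also have "(d / s)\<^sup>2 * (norm x)\<^sup>2 \<le> (d / s)\<^sup>2 * s"
        using s by (intro mult_left_mono) auto
      also have "(d / s)\<^sup>2 * s - 2 * d\<^sup>2 / s = - (d\<^sup>2 / s)"
        using s by (simp add: power2_eq_square field_simps)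
      finally show False
        using s \<open>d \<noteq> 0\<close> by (simp add: divide_le_0_iff)
    qed
    then show ?thesis
      by (simp add: d_def)
  qed
  have "\<phi> x = cinner x y" for x
  proof (rule complex_eqI)
    \<comment> \<open>The imaginary part at \<open>x\<close> is the real part at
      \<open>- \<i>\<close> times \<open>x\<close>.\<close>
    show "Im (\<phi> x) = Im (cinner x y)"
      using re[of "(- \<i>) *\<^sub>C x"] by (simp add: hom cinner_scaleC_left)
  qed (rule re)
  then show ?thesis by blast
qed

lemma bounded_operatorsD: "T \<in> bounded_operators \<Longrightarrow> blinfun_apply T (c *\<^sub>C x) = c *\<^sub>C blinfun_apply T x"
  by (simp add: bounded_operators_def)

text \<open>The value at \<open>y\<close> represents the functional that maps \<open>x\<close> to
  \<open>cinner (T x) y\<close>. Uniqueness of the representing vector makes it linear in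
  \<open>y\<close>, and Cauchy-Schwarz for \<open>cinner (T (s x)) x\<close>, which is
  \<open>(norm (s x))\<^sup>2\<close>, bounds it by \<open>norm T\<close>.\<close>

lemma adjoint_exists:
  fixes T :: "'h::complex_hilbert \<Rightarrow>\<^sub>L 'h"
  assumes T: "T \<in> bounded_operators"
  shows "\<exists>S. S \<in> bounded_operators \<and>
    (\<forall>x y. cinner (blinfun_apply T x) y = cinner x (blinfun_apply S y))"
proof -
  have "\<exists>z. \<forall>x. cinner (blinfun_apply T x) y = cinner x z" for y
  proof (rule riesz_representation)
    show "bounded_linear (\<lambda>x. cinner (blinfun_apply T x) y)"
    proof (rule bounded_linear_intro)
      show "cmod (cinner (blinfun_apply T x) y) \<le> norm x * (norm T * norm y)" for x
      proof -
        have "cmod (cinner (blinfun_apply T x) y) \<le> norm (blinfun_apply T x) * norm y"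
          by (rule cmod_cinner_le)
        also have "\<dots> \<le> norm T * norm x * norm y"
          by (intro mult_right_mono norm_blinfun) simp
        finally show ?thesis by (simp add: mult_ac)
      qed
    qed (simp_all add: blinfun.add_right blinfun.scaleR_right cinner_add_left cinner_scaleR_left scaleR_conv_of_real)
  qed (simp add: bounded_operatorsD[OF T] cinner_scaleC_left)
  then obtain s where s: "\<And>x y. cinner (blinfun_apply T x) y = cinner x (s y)"
    by metis
  have add: "s (x + y) = s x + s y" for x y
    by (rule cinner_extensionality) (simp add: s[symmetric] cinner_add_right)
  have sc: "s (c *\<^sub>C x) = c *\<^sub>C s x" for c x
    by (rule cinner_extensionality) (simp add: s[symmetric] cinner_scaleC_right)
  have bl: "bounded_linear s"
  proof (rule bounded_linear_intro)
    show "norm (s x) \<le> norm x * norm T" for x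
    proof (cases "s x = 0")
      case False
      have "(norm (s x))\<^sup>2 = cmod (cinner (s x) (s x))"
        by (simp add: cinner_self norm_power)
      also have "\<dots> \<le> norm (blinfun_apply T (s x)) * norm x"
        unfolding s[symmetric] by (rule cmod_cinner_le)
      also have "\<dots> \<le> norm T * norm (s x) * norm x"
        by (intro mult_right_mono norm_blinfun) simp
      finally have "norm (s x) * norm (s x) \<le> (norm x * norm T) * norm (s x)"
        by (simp add: power2_eq_square mult_ac)
      then show ?thesis
        using False by simp
    qed simp
  qed (simp_all add: add sc scaleR_scaleC)
  show ?thesis
    by (rule exI[of _ "Blinfun s"])
      (simp add: bounded_operators_def bounded_linear_Blinfun_apply[OF bl] sc s)
qed

lemma adjoint_unique:
  assumes "\<And>x y. cinner x (blinfun_apply S y) = cinner x (blinfun_apply S' y)"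
  shows "S = S'"
  by (intro blinfun_eqI cinner_extensionality assms)

lemma cadjoint_eqI:
  assumes "S \<in> bounded_operators"
    and "\<And>x y. cinner (blinfun_apply T x) y = cinner x (blinfun_apply S y)"
  shows "cadjoint T = S"
  unfolding cadjoint_def
proof (rule the_equality)
  fix S' assume "S' \<in> bounded_operators \<and>
    (\<forall>x y. cinner (blinfun_apply T x) y = cinner x (blinfun_apply S' y))"
  then show "S' = S"
    using assms by (intro adjoint_unique) metis
qed (use assms in auto)

lemma
  assumes "T \<in> bounded_operators"
  shows cadjoint_bounded_operators: "cadjoint T \<in> bounded_operators"
    and cinner_cadjoint: "cinner (blinfun_apply T x) y = cinner x (blinfun_apply (cadjoint T) y)"
    and cinner_cadjoint_left: "cinner (blinfun_apply (cadjoint T) x) y = cinner x (blinfun_apply T y)"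
proof -
  obtain S where S: "S \<in> bounded_operators"
    "\<And>x y. cinner (blinfun_apply T x) y = cinner x (blinfun_apply S y)"
    using adjoint_exists[OF assms] by blast
  then have "cadjoint T = S"
    by (rule cadjoint_eqI)
  with S show "cadjoint T \<in> bounded_operators"
    and *: "\<And>x y. cinner (blinfun_apply T x) y = cinner x (blinfun_apply (cadjoint T) y)"
    by simp_all
  show "cinner (blinfun_apply (cadjoint T) x) y = cinner x (blinfun_apply T y)"
    by (metis * cinner_commute)
qed

lemma cadjoint_cadjoint: "T \<in> bounded_operators \<Longrightarrow> cadjoint (cadjoint T) = T"
  by (rule cadjoint_eqI) (simp_all add: cinner_cadjoint_left)

lemma norm_cadjoint_le:
  assumes T: "T \<in> bounded_operators"
  shows "norm (cadjoint T) \<le> norm T"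
proof (rule norm_blinfun_bound)
  fix x
  let ?y = "blinfun_apply (cadjoint T) x"
  show "norm ?y \<le> norm T * norm x"
  proof (cases "?y = 0")
    case False
    have "(norm ?y)\<^sup>2 = cmod (cinner (blinfun_apply T ?y) x)"
      by (simp add: cinner_cadjoint[OF T] cinner_self norm_power)
    also have "\<dots> \<le> norm (blinfun_apply T ?y) * norm x"
      by (rule cmod_cinner_le)
    also have "\<dots> \<le> norm T * norm ?y * norm x"
      by (intro mult_right_mono norm_blinfun) simp
    finally have "norm ?y * norm ?y \<le> (norm T * norm x) * norm ?y"
      by (simp add: power2_eq_square mult_ac)
    then show ?thesis
      using False by simp
  qed simp
qed simp

lemma norm_cadjoint:
  assumes "T \<in> bounded_operators"
  shows "norm (cadjoint T) = norm T"
  using norm_cadjoint_le[OF assms] norm_cadjoint_le[OF cadjoint_bounded_operators[OF assms]]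
  by (simp add: cadjoint_cadjoint[OF assms])

lemma bounded_operators_closed:
  shows bounded_operators_compose: "\<lbrakk>S \<in> bounded_operators; T \<in> bounded_operators\<rbrakk> \<Longrightarrow> S o\<^sub>L T \<in> bounded_operators"
    and bounded_operators_add: "\<lbrakk>S \<in> bounded_operators; T \<in> bounded_operators\<rbrakk> \<Longrightarrow> S + T \<in> bounded_operators"
    and bounded_operators_diff: "\<lbrakk>S \<in> bounded_operators; T \<in> bounded_operators\<rbrakk> \<Longrightarrow> S - T \<in> bounded_operators"
    and bounded_operators_id: "id_blinfun \<in> bounded_operators"
    and bounded_operators_scaleC: "S \<in> bounded_operators \<Longrightarrow> scaleC_op c S \<in> bounded_operators"
    and bounded_operators_scaleR: "S \<in> bounded_operators \<Longrightarrow> r *\<^sub>R S \<in> bounded_operators"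
  by (auto simp: bounded_operators_def blinfun.bilinear_simps scaleC_add_right scaleC_diff_right
      scaleC_op_apply scaleC_scaleC scaleR_scaleC mult.commute)

lemma norm_scaleC_op: "norm (scaleC_op c T) = cmod c * norm T"
proof (rule antisym)
  have le: "norm (scaleC_op c T) \<le> cmod c * norm T" for c and T :: "'a \<Rightarrow>\<^sub>L 'a"
  proof (rule norm_blinfun_bound)
    fix x
    have "norm (blinfun_apply (scaleC_op c T) x) = cmod c * norm (blinfun_apply T x)"
      by (simp add: scaleC_op_apply norm_scaleC)
    also have "\<dots> \<le> cmod c * (norm T * norm x)"
      by (intro mult_left_mono norm_blinfun) simp
    finally show "norm (blinfun_apply (scaleC_op c T) x) \<le> cmod c * norm T * norm x"
      by (simp add: mult_ac)
  qed simp
  show "norm (scaleC_op c T) \<le> cmod c * norm T"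
    by (rule le)
  show "cmod c * norm T \<le> norm (scaleC_op c T)"
  proof (cases "c = 0")
    case False
    have "scaleC_op (inverse c) (scaleC_op c T) = T"
      using False by (intro blinfun_eqI) (simp add: scaleC_op_apply scaleC_scaleC scaleC_one)
    then have "norm T \<le> inverse (cmod c) * norm (scaleC_op c T)"
      using le[of "inverse c" "scaleC_op c T"] by (simp add: norm_inverse)
    then show ?thesis
      using False by (simp add: field_simps)
  qed simp
qed

lemma cadjoint_add:
  assumes "S \<in> bounded_operators" "T \<in> bounded_operators"
  shows "cadjoint (S + T) = cadjoint S + cadjoint T"
  using assms by (intro cadjoint_eqI bounded_operators_add cadjoint_bounded_operators)
    (simp_all add: blinfun.bilinear_simps cinner_add_left cinner_add_right cinner_cadjoint)

lemma cadjoint_scaleC: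
  assumes "T \<in> bounded_operators"
  shows "cadjoint (scaleC_op c T) = scaleC_op (cnj c) (cadjoint T)"
  using assms by (intro cadjoint_eqI bounded_operators_scaleC cadjoint_bounded_operators)
    (simp_all add: scaleC_op_apply cinner_scaleC_left cinner_scaleC_right cinner_cadjoint)

lemma cadjoint_compose:
  assumes "S \<in> bounded_operators" "T \<in> bounded_operators"
  shows "cadjoint (S o\<^sub>L T) = cadjoint T o\<^sub>L cadjoint S"
  using assms by (intro cadjoint_eqI bounded_operators_compose cadjoint_bounded_operators)
    (simp_all add: cinner_cadjoint)

lemma opmat_bounded_operators: "T \<in> bounded_operators \<Longrightarrow> opmat T k l \<in> bounded_operators"
proof -
  have "ell2_single l (c *\<^sub>C x) = c *\<^sub>C ell2_single l x" for c and x :: 'b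
    by (rule ell2_eqI) (simp add: ell2_nth_simps scaleC_zero_right)
  then show "T \<in> bounded_operators \<Longrightarrow> opmat T k l \<in> bounded_operators"
    by (simp add: bounded_operators_def opmat_apply ell2_nth_simps)
qed

lemma cinner_ell2_single_left: "cinner (ell2_single k x) f = cinner x (ell2_nth f k)"
  by (simp add: cinner_ell2.rep_eq ell2_single.rep_eq)
    (subst infsum_delta[of k], auto simp: cinner_zero_left)

lemma cinner_ell2_single_right: "cinner f (ell2_single k x) = cinner (ell2_nth f k) x"
  by (metis cinner_ell2_single_left cinner_commute)

lemma opmat_cadjoint:
  assumes T: "T \<in> bounded_operators"
  shows "opmat (cadjoint T) k l = cadjoint (opmat T l k)"
proof (rule cadjoint_eqI[symmetric])
  show "opmat (cadjoint T) k l \<in> bounded_operators"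
    by (intro opmat_bounded_operators cadjoint_bounded_operators T)
  show "cinner (blinfun_apply (opmat T l k) x) y = cinner x (blinfun_apply (opmat (cadjoint T) k l) y)" for x y
    unfolding opmat_apply cinner_ell2_single_left[symmetric] cinner_ell2_single_right[symmetric]
    by (rule cinner_cadjoint[OF T])
qed


section \<open>The weighted norm and diagonal decompositions\<close>

definition diag_sup :: "('i::ab_group_add \<Rightarrow> 'i \<Rightarrow> 'a::real_normed_vector) \<Rightarrow> 'i \<Rightarrow> ennreal" where
  "diag_sup A l = (SUP k. ennreal (norm (A k (k - l))))"

text \<open>With values in \<open>ennreal\<close> the norm is defined for every matrix, so the
  estimates below hold without finiteness hypotheses.\<close>

definition wsum :: "('i::ab_group_add \<Rightarrow> real) \<Rightarrow> ('i \<Rightarrow> 'i \<Rightarrow> 'a::real_normed_vector) \<Rightarrow> ennreal" where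
  "wsum v A = (\<integral>\<^sup>+l. ennreal (v l) * diag_sup A l \<partial>count_space UNIV)"

lemma norm_le_diag_sup: "ennreal (norm (A k l)) \<le> diag_sup A (k - l)"
  unfolding diag_sup_def by (rule SUP_upper2[of k]) auto

lemma diag_sup_least: "(\<And>k. ennreal (norm (A k (k - l))) \<le> c) \<Longrightarrow> diag_sup A l \<le> c"
  unfolding diag_sup_def by (rule SUP_least)

lemma nn_integral_count_space_translate:
  fixes f :: "'i::ab_group_add \<Rightarrow> ennreal"
  shows "(\<integral>\<^sup>+n. f (n - k) \<partial>count_space UNIV) = (\<integral>\<^sup>+n. f n \<partial>count_space UNIV)"
    and "(\<integral>\<^sup>+n. f (k - n) \<partial>count_space UNIV) = (\<integral>\<^sup>+n. f n \<partial>count_space UNIV)"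
proof -
  have "bij_betw (\<lambda>n. n - k) UNIV UNIV"
    by (rule bij_betw_byWitness[of _ "\<lambda>n. n + k"]) auto
  then show "(\<integral>\<^sup>+n. f (n - k) \<partial>count_space UNIV) = (\<integral>\<^sup>+n. f n \<partial>count_space UNIV)"
    by (rule nn_integral_bij_count_space)
  have "bij_betw (\<lambda>n. k - n) UNIV UNIV"
    by (rule bij_betw_byWitness[of _ "\<lambda>n. k - n"]) auto
  then show "(\<integral>\<^sup>+n. f (k - n) \<partial>count_space UNIV) = (\<integral>\<^sup>+n. f n \<partial>count_space UNIV)"
    by (rule nn_integral_bij_count_space)
qed

text \<open>Infinite subadditivity of the norm, by exchanging the sums over \<open>i\<close> and
  over the diagonals. It asks only for entrywise domination, so it applies to series whose
  convergence in the weighted norm is not yet known.\<close>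

lemma wsum_mono_infinite:
  fixes A :: "'j \<Rightarrow> 'i::ab_group_add \<Rightarrow> 'i \<Rightarrow> 'a::real_normed_vector"
    and B :: "'i \<Rightarrow> 'i \<Rightarrow> 'b::real_normed_vector"
  assumes "\<And>k l. ennreal (norm (B k l)) \<le> (\<integral>\<^sup>+i. ennreal (norm (A i k l)) \<partial>count_space UNIV)"
  shows "wsum v B \<le> (\<integral>\<^sup>+i. wsum v (A i) \<partial>count_space UNIV)"
proof -
  have "diag_sup B l \<le> (\<integral>\<^sup>+i. diag_sup (A i) l \<partial>count_space UNIV)" for l
  proof (rule diag_sup_least)
    fix k
    have "ennreal (norm (B k (k - l))) \<le> (\<integral>\<^sup>+i. ennreal (norm (A i k (k - l))) \<partial>count_space UNIV)"
      by (rule assms)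
    also have "\<dots> \<le> (\<integral>\<^sup>+i. diag_sup (A i) l \<partial>count_space UNIV)"
      using norm_le_diag_sup[of "A _" k "k - l"] by (intro nn_integral_mono) simp
    finally show "ennreal (norm (B k (k - l))) \<le> (\<integral>\<^sup>+i. diag_sup (A i) l \<partial>count_space UNIV)" .
  qed
  then have "wsum v B \<le> (\<integral>\<^sup>+l. ennreal (v l) * (\<integral>\<^sup>+i. diag_sup (A i) l \<partial>count_space UNIV) \<partial>count_space UNIV)"
    unfolding wsum_def by (intro nn_integral_mono mult_left_mono) auto
  also have "\<dots> = (\<integral>\<^sup>+l. \<integral>\<^sup>+i. ennreal (v l) * diag_sup (A i) l \<partial>count_space UNIV \<partial>count_space UNIV)"
    by (simp add: nn_integral_cmult)
  also have "\<dots> = (\<integral>\<^sup>+i. wsum v (A i) \<partial>count_space UNIV)"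
    unfolding wsum_def by (rule nn_integral_count_space_swap)
  finally show ?thesis .
qed

lemma wsum_add_le:
  assumes "\<And>k l. norm (C k l) \<le> norm (A k l) + norm (B k l)"
  shows "wsum v C \<le> wsum v A + wsum v B"
proof -
  have "diag_sup C l \<le> diag_sup A l + diag_sup B l" for l
  proof (rule diag_sup_least)
    fix k
    have "ennreal (norm (C k (k - l))) \<le> ennreal (norm (A k (k - l))) + ennreal (norm (B k (k - l)))"
      using assms by (simp flip: ennreal_plus add: ennreal_leI)
    also have "\<dots> \<le> diag_sup A l + diag_sup B l"
      using norm_le_diag_sup[of A k "k - l"] norm_le_diag_sup[of B k "k - l"]
      by (intro add_mono) auto
    finally show "ennreal (norm (C k (k - l))) \<le> diag_sup A l + diag_sup B l" .
  qed
  then have "wsum v C \<le> (\<integral>\<^sup>+l. ennreal (v l) * (diag_sup A l + diag_sup B l) \<partial>count_space UNIV)"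
    unfolding wsum_def by (intro nn_integral_mono mult_left_mono) auto
  also have "\<dots> = wsum v A + wsum v B"
    unfolding wsum_def by (simp add: distrib_left nn_integral_add)
  finally show ?thesis .
qed

lemma wsum_mono:
  assumes "\<And>k l. norm (B k l) \<le> norm (A k l)"
  shows "wsum v B \<le> wsum v A"
  unfolding wsum_def diag_sup_def
  by (intro nn_integral_mono mult_left_mono SUP_mono) (auto intro: ennreal_leI assms)

lemma wsum_cmult:
  assumes "c \<ge> 0" "\<And>k l. norm (B k l) = c * norm (A k l)"
  shows "wsum v B = ennreal c * wsum v A"
proof -
  have "diag_sup B l = ennreal c * diag_sup A l" for l
    unfolding diag_sup_def assms(2) using assms(1) by (simp add: ennreal_mult SUP_mult_left_ennreal)
  then show ?thesis
    unfolding wsum_def by (simp add: nn_integral_cmult[symmetric] mult.left_commute)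
qed

text \<open>The axioms yield the properties of the norm: by \<open>v_ge_1\<close> it dominates the
  entries and diagonals, by \<open>v_add\<close> it is submultiplicative, and by
  \<open>v_minus\<close> the involution is isometric.\<close>

locale lattice_weight =
  fixes v :: "'i::ab_group_add \<Rightarrow> real"
  assumes v_ge_1: "1 \<le> v l" and v_add: "v (k + l) \<le> v k * v l" and v_minus: "v (- l) = v l"
begin

lemma v_nonneg: "0 \<le> v l"
  using v_ge_1[of l] by simp

lemma diag_sup_le: "diag_sup A l \<le> ennreal (v l) * diag_sup A l"
  using v_ge_1[of l] mult_right_mono[of 1 "ennreal (v l)" "diag_sup A l"] by simp

lemma diag_sup_le_wsum: "diag_sup A l \<le> wsum v A"
  unfolding wsum_def
  using diag_sup_le[of A l] le_nn_integral_count_space[of "\<lambda>l. ennreal (v l) * diag_sup A l" l]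
  by (rule order_trans)

lemma norm_le_wsum: "ennreal (norm (A k l)) \<le> wsum v A"
  using norm_le_diag_sup diag_sup_le_wsum by (rule order_trans)

text \<open>Transposition carries the diagonal \<open>l\<close> to the diagonal \<open>- l\<close>,
  where the weight is the same.\<close>

lemma wsum_transpose:
  assumes "\<And>k l. norm (B k l) = norm (A l k)"
  shows "wsum v B = wsum v A"
proof -
  have "diag_sup B l = diag_sup A (- l)" for l
  proof -
    have "diag_sup B l = (SUP k. ennreal (norm (A (k - l) k)))"
      unfolding diag_sup_def assms ..
    also have "\<dots> = (SUP k\<in>(\<lambda>k. k - l) ` UNIV. ennreal (norm (A k (k + l))))"
      by (simp only: image_image diff_add_cancel)
    also have "(\<lambda>k. k - l) ` UNIV = UNIV"
      by (auto intro!: image_eqI[of _ _ "_ + l"])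
    finally show ?thesis
      by (simp add: diag_sup_def)
  qed
  then have "wsum v B = (\<integral>\<^sup>+l. ennreal (v (0 - l)) * diag_sup A (0 - l) \<partial>count_space UNIV)"
    unfolding wsum_def by (simp add: v_minus)
  also have "\<dots> = wsum v A"
    unfolding wsum_def
    by (rule nn_integral_count_space_translate(2)[of "\<lambda>l. ennreal (v l) * diag_sup A l"])
  finally show ?thesis .
qed

text \<open>The diagonal suprema of a product are dominated by the convolution of those of the
  factors, and a submultiplicative weight makes the weighted norm of a convolution at most the
  product of the norms. Taking any \<open>C\<close> dominated by the product of the entry norms
  keeps convergence of the product out of the argument.\<close>

lemma wsum_mult_le:
  fixes A :: "'i \<Rightarrow> 'i \<Rightarrow> 'a::real_normed_vector" and B :: "'i \<Rightarrow> 'i \<Rightarrow> 'b::real_normed_vector"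
    and C :: "'i \<Rightarrow> 'i \<Rightarrow> 'c::real_normed_vector"
  assumes "\<And>k l. ennreal (norm (C k l))
    \<le> (\<integral>\<^sup>+n. ennreal (norm (A k n)) * ennreal (norm (B n l)) \<partial>count_space UNIV)"
  shows "wsum v C \<le> wsum v A * wsum v B"
proof -
  have "diag_sup C l \<le> (\<integral>\<^sup>+p. diag_sup A p * diag_sup B (l - p) \<partial>count_space UNIV)" for l
  proof (rule diag_sup_least)
    fix k
    have "ennreal (norm (C k (k - l)))
        \<le> (\<integral>\<^sup>+n. ennreal (norm (A k n)) * ennreal (norm (B n (k - l))) \<partial>count_space UNIV)"
      by (rule assms)
    also have "\<dots> \<le> (\<integral>\<^sup>+n. diag_sup A (k - n) * diag_sup B (l - (k - n)) \<partial>count_space UNIV)"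
      using norm_le_diag_sup[of B _ "k - l"]
      by (intro nn_integral_mono mult_mono norm_le_diag_sup) (auto simp: algebra_simps)
    also have "\<dots> = (\<integral>\<^sup>+p. diag_sup A p * diag_sup B (l - p) \<partial>count_space UNIV)"
      by (rule nn_integral_count_space_translate(2)[of "\<lambda>p. diag_sup A p * diag_sup B (l - p)"])
    finally show "ennreal (norm (C k (k - l)))
        \<le> (\<integral>\<^sup>+p. diag_sup A p * diag_sup B (l - p) \<partial>count_space UNIV)" .
  qed
  then have "wsum v C \<le> (\<integral>\<^sup>+l. ennreal (v l) *
      (\<integral>\<^sup>+p. diag_sup A p * diag_sup B (l - p) \<partial>count_space UNIV) \<partial>count_space UNIV)"
    unfolding wsum_def by (intro nn_integral_mono mult_left_mono) auto
  also have "\<dots> = (\<integral>\<^sup>+l. \<integral>\<^sup>+p. ennreal (v l) * (diag_sup A p * diag_sup B (l - p))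
      \<partial>count_space UNIV \<partial>count_space UNIV)"
    by (simp add: nn_integral_cmult)
  also have "\<dots> \<le> (\<integral>\<^sup>+l. \<integral>\<^sup>+p. (ennreal (v p) * diag_sup A p) * (ennreal (v (l - p)) * diag_sup B (l - p))
      \<partial>count_space UNIV \<partial>count_space UNIV)"
  proof (intro nn_integral_mono)
    fix l p
    have "ennreal (v l) \<le> ennreal (v p) * ennreal (v (l - p))"
      using v_add[of p "l - p"] by (simp flip: ennreal_mult add: v_nonneg ennreal_leI)
    then have "ennreal (v l) * (diag_sup A p * diag_sup B (l - p))
        \<le> (ennreal (v p) * ennreal (v (l - p))) * (diag_sup A p * diag_sup B (l - p))"
      by (rule mult_right_mono) simp
    then show "ennreal (v l) * (diag_sup A p * diag_sup B (l - p))
        \<le> (ennreal (v p) * diag_sup A p) * (ennreal (v (l - p)) * diag_sup B (l - p))"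
      by (simp add: mult_ac)
  qed
  also have "\<dots> = (\<integral>\<^sup>+p. \<integral>\<^sup>+l. (ennreal (v p) * diag_sup A p) * (ennreal (v (l - p)) * diag_sup B (l - p))
      \<partial>count_space UNIV \<partial>count_space UNIV)"
    by (rule nn_integral_count_space_swap)
  also have "\<dots> = (\<integral>\<^sup>+p. (ennreal (v p) * diag_sup A p) * wsum v B \<partial>count_space UNIV)"
    unfolding wsum_def
    by (subst nn_integral_cmult, simp)
      (simp only: nn_integral_count_space_translate(1)[of "\<lambda>l. ennreal (v l) * diag_sup B l"])
  also have "\<dots> = wsum v A * wsum v B"
    by (simp add: nn_integral_multc flip: wsum_def)
  finally show ?thesis .
qed

end

section \<open>Diagonal operators and the decomposition into diagonals\<close>

definition ell2_diag :: "'i::ab_group_add \<Rightarrow> ('i \<Rightarrow> 'h::complex_hilbert \<Rightarrow>\<^sub>L 'h) \<Rightarrow>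
    ('i, 'h) ell2 \<Rightarrow>\<^sub>L ('i, 'h) ell2" where
  "ell2_diag l a = Blinfun (\<lambda>f. Abs_ell2 (\<lambda>k. blinfun_apply (a k) (ell2_nth f (k - l))))"

text \<open>The bound \<open>d\<close> gives sense to the definition, where \<open>Abs_ell2\<close>
  and \<open>Blinfun\<close> would otherwise be applied outside their domains. Translation by
  \<open>l\<close> permutes the coordinates and so preserves the norm of \<open>f\<close>.\<close>

lemma
  fixes a :: "'i::ab_group_add \<Rightarrow> 'h::complex_hilbert \<Rightarrow>\<^sub>L 'h"
  assumes d: "\<And>k. norm (a k) \<le> d"
  shows ell2_nth_ell2_diag:
      "ell2_nth (blinfun_apply (ell2_diag l a) f) k = blinfun_apply (a k) (ell2_nth f (k - l))"
    and norm_ell2_diag_le: "norm (ell2_diag l a) \<le> d"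
proof -
  have d0: "0 \<le> d"
    using d[of 0] norm_ge_zero[of "a 0"] by linarith
  have bij: "bij_betw (\<lambda>k. k - l) UNIV UNIV"
    by (rule bij_betw_byWitness[of _ "\<lambda>n. n + l"]) auto
  have s: "(\<lambda>k. (norm (ell2_nth f (k - l)))\<^sup>2) summable_on UNIV" for f :: "('i, 'h) ell2"
    using summable_on_reindex_bij_betw[OF bij, of "\<lambda>k. (norm (ell2_nth f k))\<^sup>2"] norm_summable_ell2[of f]
    by simp
  have le: "(norm (blinfun_apply (a k) (ell2_nth f (k - l))))\<^sup>2 \<le> d\<^sup>2 * (norm (ell2_nth f (k - l)))\<^sup>2"
    for f :: "('i, 'h) ell2" and k
  proof -
    have "norm (blinfun_apply (a k) (ell2_nth f (k - l))) \<le> norm (a k) * norm (ell2_nth f (k - l))"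
      by (rule norm_blinfun)
    also have "\<dots> \<le> d * norm (ell2_nth f (k - l))"
      by (intro mult_right_mono d) simp
    finally show ?thesis
      using power_mono[of _ "d * norm (ell2_nth f (k - l))" 2] by (simp add: power_mult_distrib)
  qed
  have t: "(\<lambda>k. (norm (blinfun_apply (a k) (ell2_nth f (k - l))))\<^sup>2) summable_on UNIV" for f :: "('i, 'h) ell2"
    by (rule summable_on_comparison_test[OF summable_on_cmult_right[OF s]]) (use le in auto)
  define G where "G f = Abs_ell2 (\<lambda>k. blinfun_apply (a k) (ell2_nth f (k - l)))" for f :: "('i, 'h) ell2"
  have n: "ell2_nth (G f) k
      = blinfun_apply (a k) (ell2_nth f (k - l))" for f k
    using t[of f]
    by (simp add: G_def Abs_ell2_inverse)
  have b: "norm (G f) \<le> d * norm f"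
    for f :: "('i, 'h) ell2"
  proof -
    have "(\<Sum>\<^sub>\<infinity>k. (norm (blinfun_apply (a k) (ell2_nth f (k - l))))\<^sup>2)
        \<le> (\<Sum>\<^sub>\<infinity>k. d\<^sup>2 * (norm (ell2_nth f (k - l)))\<^sup>2)"
      by (rule infsum_mono[OF t summable_on_cmult_right[OF s] le])
    also have "\<dots> = d\<^sup>2 * (\<Sum>\<^sub>\<infinity>k. (norm (ell2_nth f k))\<^sup>2)"
      using infsum_reindex_bij_betw[OF bij, of "\<lambda>k. (norm (ell2_nth f k))\<^sup>2"]
      by (simp add: infsum_cmult_right')
    finally have "sqrt (\<Sum>\<^sub>\<infinity>k. (norm (blinfun_apply (a k) (ell2_nth f (k - l))))\<^sup>2)
        \<le> sqrt (d\<^sup>2 * (\<Sum>\<^sub>\<infinity>k. (norm (ell2_nth f k))\<^sup>2))"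
      by (rule real_sqrt_le_mono)
    then show ?thesis
      using d0 by (simp add: norm_ell2.rep_eq n real_sqrt_mult)
  qed
  have "bounded_linear (\<lambda>f. G f)"
  proof (rule bounded_linear_intro)
    show "norm (G f) \<le> norm f * d" for f :: "('i, 'h) ell2"
      using b[of f] by (simp add: mult.commute)
  qed (rule ell2_eqI, simp only: n ell2_nth_simps blinfun.bilinear_simps)+
  then have e: "blinfun_apply (ell2_diag l a) f = G f" for f
    unfolding ell2_diag_def G_def[symmetric] by (simp add: bounded_linear_Blinfun_apply)
  then show "ell2_nth (blinfun_apply (ell2_diag l a) f) k = blinfun_apply (a k) (ell2_nth f (k - l))"
    by (simp add: n)
  show "norm (ell2_diag l a) \<le> d"
    by (rule norm_blinfun_bound[OF d0]) (use b e in auto)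
qed

lemma opmat_ell2_diag:
  assumes "\<And>k. norm (a k) \<le> d"
  shows "opmat (ell2_diag l a) k j = (if j = k - l then a k else 0)"
  by (intro blinfun_eqI)
    (auto simp: opmat_apply ell2_nth_ell2_diag[OF assms] ell2_single.rep_eq)

text \<open>Every coordinate of an image is a sum of entries applied to coordinates, and
  multiplication by \<open>c\<close> is continuous. This turns the condition on the entries in
  \<open>matrix_class\<close> into one on the operator.\<close>

lemma bounded_operators_iff_opmat: "T \<in> bounded_operators \<longleftrightarrow> (\<forall>k l. opmat T k l \<in> bounded_operators)"
proof
  assume *: "\<forall>k l. opmat T k l \<in> bounded_operators"
  have "blinfun_apply T (c *\<^sub>C f) = c *\<^sub>C blinfun_apply T f" for c f
  proof (rule ell2_eqI)
    fix k
    have "((\<lambda>l. c *\<^sub>C blinfun_apply (opmat T k l) (ell2_nth f l)) has_sum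
        c *\<^sub>C ell2_nth (blinfun_apply T f) k) UNIV"
      by (rule has_sum_bounded_linear[OF bounded_linear_scaleC has_sum_opmat])
    moreover have "((\<lambda>l. c *\<^sub>C blinfun_apply (opmat T k l) (ell2_nth f l)) has_sum
        ell2_nth (blinfun_apply T (c *\<^sub>C f)) k) UNIV"
      using has_sum_opmat[of T k "c *\<^sub>C f"] * by (simp add: ell2_nth_simps bounded_operatorsD)
    ultimately show "ell2_nth (blinfun_apply T (c *\<^sub>C f)) k = ell2_nth (c *\<^sub>C blinfun_apply T f) k"
      by (simp add: ell2_nth_simps has_sum_unique)
  qed
  then show "T \<in> bounded_operators"
    by (simp add: bounded_operators_def)
qed (simp add: opmat_bounded_operators)

context lattice_weight
begin

text \<open>The \<open>l\<close>-th diagonal has operator norm at most \<open>diag_sup A l\<close>,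
  so the series of the diagonals converges absolutely. Each entry lies on exactly one diagonal, so
  the sum has the matrix \<open>A\<close>: every matrix of finite norm comes from a bounded
  operator.\<close>

lemma
  fixes A :: "'i \<Rightarrow> 'i \<Rightarrow> 'h::complex_hilbert \<Rightarrow>\<^sub>L 'h"
  assumes A: "wsum v A < \<infinity>"
  defines "T l \<equiv> ell2_diag l (\<lambda>k. A k (k - l))"
  shows summable_norm_ell2_diag: "(\<lambda>l. v l * norm (T l)) summable_on UNIV"
    and opmat_diag: "opmat (T l) k j = (if j = k - l then A k j else 0)"
    and summable_ell2_diag: "T summable_on UNIV"
    and opmat_infsum_ell2_diag: "opmat (infsum T UNIV) = A"
proof -
  define d where "d l = enn2real (diag_sup A l)" for l
  have d: "ennreal (d l) = diag_sup A l" for l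
    using diag_sup_le_wsum[of A l] A unfolding d_def by (intro ennreal_enn2real) (simp add: order_le_less_trans)
  have d0: "d l \<ge> 0" for l
    by (simp add: d_def)
  have nA: "norm (A k (k - l)) \<le> d l" for k l
    using norm_le_diag_sup[of A k "k - l"] d0[of l] by (simp add: ennreal_le_iff flip: d)
  have "(\<lambda>l. v l * d l) summable_on UNIV"
    using A v_nonneg by (subst summable_on_iff_nn_integral_count_space)
      (auto simp: d0 ennreal_mult wsum_def d)
  then show sv: "(\<lambda>l. v l * norm (T l)) summable_on UNIV"
    by (rule summable_on_comparison_test)
      (auto simp: T_def v_nonneg intro!: mult_left_mono norm_ell2_diag_le nA)
  show o: "opmat (T l) k j = (if j = k - l then A k j else 0)" for l k j
    unfolding T_def by (subst opmat_ell2_diag[of _ "d l"]) (auto simp: nA)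
  have "(\<lambda>l. norm (T l)) summable_on UNIV"
  proof (rule summable_on_comparison_test[OF sv])
    show "norm (T l) \<le> v l * norm (T l)" for l
      using mult_right_mono[OF v_ge_1[of l], of "norm (T l)"] by simp
  qed simp
  then show s: "T summable_on UNIV"
    by (rule Infinite_Sum.abs_summable_summable)
  show "opmat (infsum T UNIV) = A"
  proof (intro ext)
    fix k j
    have "((\<lambda>l. opmat (T l) k j) has_sum opmat (infsum T UNIV) k j) UNIV"
      by (rule has_sum_bounded_linear[OF bounded_linear_opmat]) (simp add: s)
    then have "opmat (infsum T UNIV) k j = infsum (\<lambda>l. opmat (T l) k j) UNIV"
      by (simp add: infsumI)
    also have "\<dots> = opmat (T (k - j)) k j"
      by (rule infsum_delta) (auto simp: o)
    finally show "opmat (infsum T UNIV) k j = A k j"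
      by (simp add: o)
  qed
qed

lemma obtain_operator:
  fixes A :: "'i \<Rightarrow> 'i \<Rightarrow> 'h::complex_hilbert \<Rightarrow>\<^sub>L 'h"
  assumes "wsum v A < \<infinity>"
  obtains T where "opmat T = A"
  using opmat_infsum_ell2_diag[OF assms] by blast

end


section \<open>Neumann series\<close>

text \<open>The class is kept on the operator side, where associativity of the product and the rules
  for adjoints are already known; \<open>opmat\<close> transports them to matrices.\<close>

definition (in lattice_weight) weighted_operators ::
    "(('i, 'h::complex_hilbert) ell2 \<Rightarrow>\<^sub>L ('i, 'h) ell2) set" where
  "weighted_operators = {T \<in> bounded_operators. wsum v (opmat T) < \<infinity>}"

lemmas opmat_linear = linear_add[OF bounded_linear.linear[OF bounded_linear_opmat]]
  linear_diff[OF bounded_linear.linear[OF bounded_linear_opmat]]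
  linear_scale[OF bounded_linear.linear[OF bounded_linear_opmat]]
  linear_0[OF bounded_linear.linear[OF bounded_linear_opmat]]
  linear_sum[OF bounded_linear.linear[OF bounded_linear_opmat]]

lemma opmat_id: "opmat id_blinfun k l = (if k = l then id_blinfun else 0)"
  by (intro blinfun_eqI) (simp add: opmat_apply ell2_single.rep_eq)

lemma opmat_scaleC: "opmat (scaleC_op c T) k l = scaleC_op c (opmat T k l)"
  by (intro blinfun_eqI) (simp add: opmat_apply scaleC_op_apply ell2_nth_simps)

context lattice_weight
begin

lemma wsum_identity: "wsum v (\<lambda>k l. if k = l then id_blinfun :: 'h::real_normed_vector \<Rightarrow>\<^sub>L 'h else 0) < \<infinity>"
proof -
  let ?I = "\<lambda>(k::'i) l. if k = l then id_blinfun :: 'h \<Rightarrow>\<^sub>L 'h else 0"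
  have d: "diag_sup ?I l \<le> (if l = 0 then 1 else 0)" for l
    by (rule diag_sup_least) (auto simp: norm_blinfun_id_le)
  have "wsum v ?I = (\<Sum>l\<in>{0}. ennreal (v l) * diag_sup ?I l)"
    unfolding wsum_def
  proof (rule nn_integral_count_space')
    show "ennreal (v l) * diag_sup ?I l = 0" if "l \<notin> {0}" for l
      using d[of l] that by simp
  qed auto
  also have "\<dots> < \<infinity>"
    using order_le_less_trans[OF d[of 0], of \<infinity>] by (simp add: ennreal_mult_less_top)
  finally show ?thesis .
qed

lemma
  shows weighted_operators_id: "id_blinfun \<in> weighted_operators"
    and weighted_operators_add: "\<lbrakk>S \<in> weighted_operators; T \<in> weighted_operators\<rbrakk> \<Longrightarrow> S + T \<in> weighted_operators"
    and weighted_operators_diff: "\<lbrakk>S \<in> weighted_operators; T \<in> weighted_operators\<rbrakk> \<Longrightarrow> S - T \<in> weighted_operators"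
    and weighted_operators_scaleC: "T \<in> weighted_operators \<Longrightarrow> scaleC_op c T \<in> weighted_operators"
    and weighted_operators_scaleR: "T \<in> weighted_operators \<Longrightarrow> r *\<^sub>R T \<in> weighted_operators"
    and weighted_operators_compose: "\<lbrakk>S \<in> weighted_operators; T \<in> weighted_operators\<rbrakk> \<Longrightarrow> S o\<^sub>L T \<in> weighted_operators"
    and weighted_operators_cadjoint: "T \<in> weighted_operators \<Longrightarrow> cadjoint T \<in> weighted_operators"
proof -
  show "id_blinfun \<in> weighted_operators"
    using wsum_identity by (simp add: weighted_operators_def bounded_operators_id opmat_id[abs_def])
  show "S + T \<in> weighted_operators" if "S \<in> weighted_operators" "T \<in> weighted_operators"
    using that wsum_add_le[of "opmat (S + T)" "opmat S" "opmat T" v]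
    by (auto simp: weighted_operators_def bounded_operators_add opmat_linear norm_triangle_ineq
        intro: order_le_less_trans)
  show "S - T \<in> weighted_operators" if "S \<in> weighted_operators" "T \<in> weighted_operators"
    using that wsum_add_le[of "opmat (S - T)" "opmat S" "opmat T" v]
    by (auto simp: weighted_operators_def bounded_operators_diff opmat_linear norm_triangle_ineq4
        intro: order_le_less_trans)
  show "scaleC_op c T \<in> weighted_operators" if "T \<in> weighted_operators"
    using that wsum_cmult[of "cmod c" "opmat (scaleC_op c T)" "opmat T" v]
    by (auto simp: weighted_operators_def bounded_operators_scaleC opmat_scaleC norm_scaleC_op
        ennreal_mult_less_top)
  show "r *\<^sub>R T \<in> weighted_operators" if "T \<in> weighted_operators"
    using that wsum_cmult[of "\<bar>r\<bar>" "opmat (r *\<^sub>R T)" "opmat T" v]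
    by (auto simp: weighted_operators_def bounded_operators_scaleR opmat_linear
        ennreal_mult_less_top)
  show "S o\<^sub>L T \<in> weighted_operators" if "S \<in> weighted_operators" "T \<in> weighted_operators"
    using that wsum_mult_le[of "opmat (S o\<^sub>L T)" "opmat S" "opmat T", OF norm_opmat_compose_le]
    by (auto simp: weighted_operators_def bounded_operators_compose
        ennreal_mult_less_top intro: order_le_less_trans)
  show "cadjoint T \<in> weighted_operators" if "T \<in> weighted_operators"
    using that wsum_transpose[of "opmat (cadjoint T)" "opmat T"]
    by (auto simp: weighted_operators_def cadjoint_bounded_operators opmat_cadjoint
        norm_cadjoint opmat_bounded_operators)
qed

end

text \<open>\<open>L\<close> is a length with finite balls, and \<open>growth\<close> states in
  summed form that the total weight of the balls grows more slowly than any exponential in the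
  radius. The Neumann series argument uses the index group through these properties.\<close>

locale subexponential_weight = lattice_weight v for v :: "'i::ab_group_add \<Rightarrow> real" +
  fixes L :: "'i \<Rightarrow> nat"
  assumes L_zero: "L 0 = 0" and L_add: "L (k + l) \<le> L k + L l"
    and finite_L_ball: "finite {l. L l \<le> s}"
    and growth: "0 \<le> c \<Longrightarrow> c < 1 \<Longrightarrow> summable (\<lambda>n. (\<Sum>l | L l \<le> n * m. v l) * c ^ n)"
begin

definition ball_weight :: "nat \<Rightarrow> real" where
  "ball_weight s = (\<Sum>l | L l \<le> s. v l)"

text \<open>Keeping the centre \<open>t\<close> apart from the width \<open>s\<close> lets a
  translation of the band by \<open>l\<close> cost a factor \<open>v l\<close> instead of a larger
  ball.\<close>

definition banded :: "(('i, 'h::complex_hilbert) ell2 \<Rightarrow>\<^sub>L ('i, 'h) ell2) \<Rightarrow> nat \<Rightarrow> 'i \<Rightarrow> bool" where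
  "banded T s t \<longleftrightarrow> (\<forall>k l. opmat T k l \<noteq> 0 \<longrightarrow> L (k - l - t) \<le> s)"

lemma ball_weight_nonneg: "0 \<le> ball_weight s"
  unfolding ball_weight_def by (intro sum_nonneg v_nonneg)

lemma ball_weight_mono: "s \<le> s' \<Longrightarrow> ball_weight s \<le> ball_weight s'"
  unfolding ball_weight_def by (intro sum_mono2 finite_L_ball v_nonneg) auto

text \<open>On each diagonal the supremum is at most \<open>norm T\<close>, and the diagonal
  \<open>t + u\<close> has weight at most \<open>v t * v u\<close>. At the price of
  \<open>ball_weight s\<close> the operator norm thus controls the weighted norm.\<close>

lemma wsum_banded:
  assumes "banded T s t"
  shows "wsum v (opmat T) \<le> ennreal (v t * ball_weight s * norm T)"
proof -
  have "wsum v (opmat T) = (\<integral>\<^sup>+u. ennreal (v (u - (- t))) * diag_sup (opmat T) (u - (- t)) \<partial>count_space UNIV)"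
    unfolding wsum_def
    by (rule nn_integral_count_space_translate(1)[of "\<lambda>u. ennreal (v u) * diag_sup (opmat T) u" "-t", symmetric])
  also have "\<dots> \<le> (\<integral>\<^sup>+u. ennreal (v t * v u * norm T) * indicator {u. L u \<le> s} u \<partial>count_space UNIV)"
  proof (rule nn_integral_mono)
    fix u
    show "ennreal (v (u - (- t))) * diag_sup (opmat T) (u - (- t))
        \<le> ennreal (v t * v u * norm T) * indicator {u. L u \<le> s} u"
    proof (cases "L u \<le> s")
      case True
      have "diag_sup (opmat T) (u - (- t)) \<le> ennreal (norm T)"
        by (intro diag_sup_least ennreal_leI norm_opmat_le)
      then have "ennreal (v (u - (- t))) * diag_sup (opmat T) (u - (- t)) \<le> ennreal (v t * v u) * ennreal (norm T)"
        using v_add[of t u] by (intro mult_mono ennreal_leI) (auto simp: add.commute)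
      then show ?thesis
        using True v_nonneg by (simp add: ennreal_mult)
    next
      case False
      have "norm (opmat T k (k - (u - (- t)))) = 0" for k
        using assms False unfolding banded_def by force
      then have "diag_sup (opmat T) (u - (- t)) \<le> 0"
        by (intro diag_sup_least) simp
      then show ?thesis by simp
    qed
  qed
  also have "\<dots> = (\<Sum>u | L u \<le> s. ennreal (v t * v u * norm T))"
    by (subst nn_integral_indicator_finite) (auto simp: finite_L_ball)
  also have "\<dots> = ennreal (v t * ball_weight s * norm T)"
    by (simp add: sum_ennreal v_nonneg ball_weight_def sum_distrib_left sum_distrib_right)
  finally show ?thesis .
qed

text \<open>Instead of expanding the power into words in \<open>B\<close> and the
  \<open>E l\<close>, the induction peels off the factor next to \<open>Y\<close>, for all banded
  \<open>Y\<close> at once: \<open>B\<close> raises the width by \<open>m\<close>, and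
  \<open>E l\<close> moves the centre by \<open>l\<close> and contributes
  \<open>v l\<close>.\<close>

lemma wsum_power_le:
  fixes C B :: "('i, 'h::complex_hilbert) ell2 \<Rightarrow>\<^sub>L ('i, 'h) ell2"
  assumes B: "\<And>Y s t. banded Y s t \<Longrightarrow> banded (B o\<^sub>L Y) (s + m) t"
    and E: "\<And>l Y s t. banded Y s t \<Longrightarrow> banded (E l o\<^sub>L Y) s (t + l)"
    and C: "(E has_sum (C - B)) UNIV"
    and c: "0 \<le> c" "ennreal (norm B) + (\<integral>\<^sup>+l. ennreal (v l * norm (E l)) \<partial>count_space UNIV) \<le> ennreal c"
    and Y: "banded Y s t"
  shows "wsum v (opmat (((o\<^sub>L) C ^^ n) Y)) \<le> ennreal (v t * ball_weight (s + n * m) * c ^ n * norm Y)"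
  using Y
proof (induction n arbitrary: Y s t)
  case 0
  then show ?case
    using wsum_banded by simp
next
  case (Suc n)
  define h :: "(('i, 'h) ell2 \<Rightarrow>\<^sub>L ('i, 'h) ell2) \<Rightarrow> _" where "h = ((o\<^sub>L) C ^^ n)"
  \<comment> \<open>Continuity of \<open>h\<close> lets it be applied term by term to the series of
    the \<open>E l\<close>.\<close>
  have h: "bounded_linear h"
    unfolding h_def
    by (induction n) (auto simp: id_def bounded_linear_ident
        intro!: bounded_linear_compose[OF bounded_bilinear.bounded_linear_right[OF bounded_bilinear_blinfun_compose]])
  \<comment> \<open>The common factor of both contributions. The terms with \<open>E l\<close>
    produce only the radius \<open>s + n * m\<close>, which monotonicity of
    \<open>ball_weight\<close> enlarges to \<open>s + Suc n * m\<close>.\<close>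
  let ?K = "v t * ball_weight (s + Suc n * m) * c ^ n * norm Y"
  have K: "0 \<le> ?K"
    using v_nonneg ball_weight_nonneg c by simp
  have hB: "wsum v (opmat (h (B o\<^sub>L Y))) \<le> ennreal ?K * ennreal (norm B)"
  proof -
    have "wsum v (opmat (h (B o\<^sub>L Y))) \<le> ennreal (v t * ball_weight (s + m + n * m) * c ^ n * norm (B o\<^sub>L Y))"
      unfolding h_def by (intro Suc.IH B Suc.prems)
    also have "\<dots> \<le> ennreal (v t * ball_weight (s + m + n * m) * c ^ n * (norm B * norm Y))"
      using v_nonneg ball_weight_nonneg c by (intro ennreal_leI mult_left_mono norm_blinfun_compose) simp
    also have "\<dots> = ennreal ?K * ennreal (norm B)"
      using K by (simp flip: ennreal_mult add: mult_ac add_ac)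
    finally show ?thesis .
  qed
  have hE: "wsum v (opmat (h (E l o\<^sub>L Y))) \<le> ennreal ?K * ennreal (v l * norm (E l))" for l
  proof -
    have "wsum v (opmat (h (E l o\<^sub>L Y))) \<le> ennreal (v (t + l) * ball_weight (s + n * m) * c ^ n * norm (E l o\<^sub>L Y))"
      unfolding h_def by (intro Suc.IH E Suc.prems)
    also have "\<dots> \<le> ennreal ((v t * v l) * ball_weight (s + Suc n * m) * c ^ n * (norm (E l) * norm Y))"
      using v_nonneg ball_weight_nonneg c
      by (intro ennreal_leI mult_mono norm_blinfun_compose v_add ball_weight_mono) auto
    also have "\<dots> = ennreal ?K * ennreal (v l * norm (E l))"
      using K v_nonneg by (simp flip: ennreal_mult add: mult_ac)
    finally show ?thesis .
  qed
  have "((\<lambda>l. opmat (h (E l o\<^sub>L Y)) k j) has_sum opmat (h ((C - B) o\<^sub>L Y)) k j) UNIV" for k j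
    by (intro has_sum_bounded_linear[OF bounded_linear_opmat] has_sum_bounded_linear[OF h]
        has_sum_bounded_linear[OF bounded_bilinear.bounded_linear_left[OF bounded_bilinear_blinfun_compose]] C)
  then have "wsum v (opmat (h ((C - B) o\<^sub>L Y))) \<le> (\<integral>\<^sup>+l. wsum v (opmat (h (E l o\<^sub>L Y))) \<partial>count_space UNIV)"
    by (intro wsum_mono_infinite norm_has_sum_le_nn_integral)
  also have "\<dots> \<le> (\<integral>\<^sup>+l. ennreal ?K * ennreal (v l * norm (E l)) \<partial>count_space UNIV)"
    by (intro nn_integral_mono hE)
  also have "\<dots> = ennreal ?K * (\<integral>\<^sup>+l. ennreal (v l * norm (E l)) \<partial>count_space UNIV)"
    by (rule nn_integral_cmult) simp
  finally have hCB: "wsum v (opmat (h ((C - B) o\<^sub>L Y)))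
      \<le> ennreal ?K * (\<integral>\<^sup>+l. ennreal (v l * norm (E l)) \<partial>count_space UNIV)" .
  have "((o\<^sub>L) C ^^ Suc n) Y = h (C o\<^sub>L Y)"
    by (simp add: h_def funpow_swap1)
  also have "\<dots> = h (B o\<^sub>L Y) + h ((C - B) o\<^sub>L Y)"
    by (simp add: linear_add[OF bounded_linear.linear[OF h], symmetric]
        bounded_bilinear.add_left[OF bounded_bilinear_blinfun_compose, symmetric])
  finally have "wsum v (opmat (((o\<^sub>L) C ^^ Suc n) Y))
      \<le> wsum v (opmat (h (B o\<^sub>L Y))) + wsum v (opmat (h ((C - B) o\<^sub>L Y)))"
    by (intro wsum_add_le) (simp add: opmat_linear norm_triangle_ineq)
  also have "\<dots> \<le> ennreal ?K * (ennreal (norm B) + (\<integral>\<^sup>+l. ennreal (v l * norm (E l)) \<partial>count_space UNIV))"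
    unfolding distrib_left by (intro add_mono hB hCB)
  also have "\<dots> \<le> ennreal ?K * ennreal c"
    by (intro mult_left_mono c) simp
  also have "\<dots> = ennreal (v t * ball_weight (s + Suc n * m) * c ^ Suc n * norm Y)"
    using K c by (simp flip: ennreal_mult add: mult_ac)
  finally show ?case .
qed

end

text \<open>The powers appear as iterates of left composition, the form treated by
  \<open>wsum_power_le\<close>, and the sum as \<open>has_sum\<close>, the form from which entrywise
  bounds are drawn.\<close>

lemma neumann_series:
  fixes C :: "'a::banach \<Rightarrow>\<^sub>L 'a"
  assumes "norm C < 1"
  obtains Q where "((\<lambda>n. ((o\<^sub>L) C ^^ n) id_blinfun) has_sum Q) UNIV"
    "(id_blinfun - C) o\<^sub>L Q = id_blinfun" "Q o\<^sub>L (id_blinfun - C) = id_blinfun"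
proof -
  define X where "X n = ((o\<^sub>L) C ^^ n) id_blinfun" for n
  have XS: "X (Suc n) = C o\<^sub>L X n" for n
    by (simp add: X_def)
  have XC: "X (Suc n) = X n o\<^sub>L C" for n
    by (induction n) (auto simp: XS X_def intro!: blinfun_eqI, metis blinfun_apply_blinfun_compose)
  have "norm (X n) \<le> norm C ^ n" for n
  proof (induction n)
    case (Suc n)
    have "norm (X (Suc n)) \<le> norm C * norm (X n)"
      unfolding XS by (rule norm_blinfun_compose)
    also have "\<dots> \<le> norm C * norm C ^ n"
      by (intro mult_left_mono Suc) simp
    finally show ?case by simp
  qed (simp add: X_def norm_blinfun_id_le)
  then have s: "summable (\<lambda>n. norm (X n))"
    using assms by (intro summable_comparison_test[OF _ summable_geometric[of "norm C"]]) auto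
  then have Q: "X sums suminf X"
    by (simp add: summable_norm_cancel summable_sums)
  define Q where "Q = suminf X"
  have "(\<lambda>n. X (Suc n)) sums (Q - X 0)"
    using Q by (simp add: Q_def sums_Suc_iff)
  moreover have "(\<lambda>n. C o\<^sub>L X n) sums (C o\<^sub>L Q)" "(\<lambda>n. X n o\<^sub>L C) sums (Q o\<^sub>L C)"
    using Q unfolding Q_def
    by (auto intro!: bounded_linear.sums[OF bounded_bilinear.bounded_linear_right[OF bounded_bilinear_blinfun_compose]]
      bounded_linear.sums[OF bounded_bilinear.bounded_linear_left[OF bounded_bilinear_blinfun_compose]])
  ultimately have e: "C o\<^sub>L Q = Q - id_blinfun" "Q o\<^sub>L C = Q - id_blinfun"
    unfolding XS[symmetric] XC[symmetric] by (auto simp: sums_unique2 X_def)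
  have "(id_blinfun - C) o\<^sub>L Q = id_blinfun" "Q o\<^sub>L (id_blinfun - C) = id_blinfun"
    using e by (simp_all add: bounded_bilinear.diff_left[OF bounded_bilinear_blinfun_compose]
        bounded_bilinear.diff_right[OF bounded_bilinear_blinfun_compose])
      (auto intro!: blinfun_eqI simp: blinfun.bilinear_simps)
  moreover have "(X has_sum Q) UNIV"
    unfolding Q_def by (rule norm_summable_imp_has_sum[OF s Q])
  ultimately show ?thesis
    using that unfolding X_def by blast
qed

text \<open>The Neumann sum is found among the real-linear operators; it inherits complex linearity
  from the operator that it inverts.\<close>

lemma bounded_operators_inverse:
  assumes "S \<in> bounded_operators" "S o\<^sub>L Q = id_blinfun" "Q o\<^sub>L S = id_blinfun"
  shows "Q \<in> bounded_operators"
proof -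
  have S: "blinfun_apply S (blinfun_apply Q x) = x" "blinfun_apply Q (blinfun_apply S x) = x" for x
    using assms(2,3) by (metis blinfun_apply_blinfun_compose blinfun_apply_id_blinfun)+
  have "blinfun_apply Q (c *\<^sub>C x) = c *\<^sub>C blinfun_apply Q x" for c x
    by (metis S bounded_operatorsD[OF assms(1)])
  then show ?thesis
    by (simp add: bounded_operators_def)
qed

section \<open>Inverting \<open>id_blinfun - C\<close> in the weighted class\<close>

context subexponential_weight
begin

text \<open>The weighted norm of \<open>C\<close> may be large, so submultiplicativity alone gives
  no convergence in the class; \<open>wsum_power_le\<close> with some \<open>c\<close> below 1,
  together with \<open>growth\<close>, takes its place.\<close>

lemma weighted_operators_neumann:
  fixes C :: "('i, 'h::complex_hilbert) ell2 \<Rightarrow>\<^sub>L ('i, 'h) ell2"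
  assumes C: "C \<in> weighted_operators" and nC: "norm C < 1"
  obtains Q where "Q \<in> weighted_operators"
    "(id_blinfun - C) o\<^sub>L Q = id_blinfun" "Q o\<^sub>L (id_blinfun - C) = id_blinfun"
proof -
  have w: "wsum v (opmat C) < \<infinity>"
    using C by (simp add: weighted_operators_def)
  define T where "T l = ell2_diag l (\<lambda>k. opmat C k (k - l))" for l
  note T = summable_norm_ell2_diag[OF w, folded T_def] opmat_diag[OF w, folded T_def]
    summable_ell2_diag[OF w, folded T_def] opmat_infsum_ell2_diag[OF w, folded T_def]
  have CT: "(T has_sum C) UNIV"
    using has_sum_infsum[OF T(3)] T(4) by (simp add: opmat_inject)
  \<comment> \<open>The remainder \<open>S\<close> enters twice, in
    \<open>norm B \<le> norm C + S\<close> and as the weighted sum of the \<open>E l\<close>; a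
    third of the gap leaves \<open>c = norm C + 2 * S\<close> below 1.\<close>
  let ?e = "(1 - norm C) / 3"
  obtain F where F: "finite F" "dist (\<Sum>l\<in>F. v l * norm (T l)) (\<Sum>\<^sub>\<infinity>l. v l * norm (T l)) \<le> ?e"
    using infsum_finite_approximation[OF T(1), of ?e] nC by auto
  define E where "E l = (if l \<in> F then 0 else T l)" for l
  define B where "B = (\<Sum>l\<in>F. T l)"
  \<comment> \<open>The sum of the lengths is a convenient upper bound for each of them, also when
    \<open>F\<close> is empty.\<close>
  define m where "m = (\<Sum>l\<in>F. L l)"
  define S where "S = (\<Sum>\<^sub>\<infinity>l. v l * norm (E l))"
  have CB: "(E has_sum (C - B)) UNIV"
  proof -
    have "(T has_sum (C - B)) (UNIV - F)"
      unfolding B_def by (rule has_sum_Diff[OF CT]) (simp_all add: F)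
    then show ?thesis
      by (rule has_sum_cong_neutral[THEN iffD1, rotated -1]) (auto simp: E_def)
  qed
  have sE: "(\<lambda>l. v l * norm (E l)) summable_on UNIV"
    by (rule summable_on_comparison_test[OF T(1)]) (auto simp: E_def v_nonneg)
  have S: "S \<le> ?e" "0 \<le> S"
  proof -
    have "S = (\<Sum>\<^sub>\<infinity>l\<in>UNIV - F. v l * norm (T l))"
      unfolding S_def by (rule infsum_cong_neutral) (auto simp: E_def)
    also have "\<dots> = (\<Sum>\<^sub>\<infinity>l. v l * norm (T l)) - (\<Sum>l\<in>F. v l * norm (T l))"
      using F T(1) by (subst infsum_Diff) auto
    also have "\<dots> \<le> ?e"
      using F(2) unfolding dist_real_def by linarith
    finally show "S \<le> ?e" .
    show "0 \<le> S"
      unfolding S_def by (intro infsum_nonneg mult_nonneg_nonneg v_nonneg) simp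
  qed
  have "norm (C - B) \<le> S"
    unfolding S_def
  proof (rule norm_infsum_le[OF CB has_sum_infsum[OF sE]])
    show "norm (E l) \<le> v l * norm (E l)" for l
      using mult_right_mono[OF v_ge_1[of l], of "norm (E l)"] by simp
  qed
  then have nB: "norm B \<le> norm C + S"
    using norm_triangle_ineq2[of B C] by (simp add: norm_minus_commute)
  define c where "c = norm C + 2 * S"
  have c: "0 \<le> c" "c < 1"
    using S nC by (auto simp: c_def)
  \<comment> \<open>Row \<open>k\<close> of \<open>T l\<close> can be nonzero only in column
    \<open>k - l\<close>, so composing with \<open>T l\<close> shifts the rows of \<open>Y\<close>
    by \<open>l\<close>.\<close>
  have bT: "banded (T l o\<^sub>L Y) s (t + l)" if "banded Y s t" for Y s t l
    unfolding banded_def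
  proof (intro allI impI)
    fix k j assume nz: "opmat (T l o\<^sub>L Y) k j \<noteq> 0"
    have "opmat Y (k - l) j \<noteq> 0"
    proof
      assume "opmat Y (k - l) j = 0"
      then have "norm (opmat (T l) k n) * norm (opmat Y n j) = 0" for n
        by (simp add: T(2))
      then have "ennreal (norm (opmat (T l) k n)) * ennreal (norm (opmat Y n j)) = 0" for n
        by (simp flip: ennreal_mult)
      then show False
        using norm_opmat_compose_le[of "T l" Y k j] nz by (simp del: mult_eq_0_iff)
    qed
    then have "L (k - l - j - t) \<le> s"
      using that by (simp add: banded_def)
    then show "L (k - j - (t + l)) \<le> s"
      by (simp add: algebra_simps)
  qed
  \<comment> \<open>Seen from the old centre \<open>t\<close>, a band of width \<open>s\<close>
    around \<open>t + l\<close> lies within the width \<open>s + L l\<close>.\<close>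
  have bB: "banded (B o\<^sub>L Y) (s + m) t" if "banded Y s t" for Y s t
    unfolding banded_def
  proof (intro allI impI)
    fix k j assume "opmat (B o\<^sub>L Y) k j \<noteq> 0"
    then have "(\<Sum>l\<in>F. opmat (T l o\<^sub>L Y) k j) \<noteq> 0"
      unfolding B_def
      by (simp add: opmat_linear bounded_bilinear.sum_left[OF bounded_bilinear_blinfun_compose])
    then obtain l where l: "l \<in> F" "opmat (T l o\<^sub>L Y) k j \<noteq> 0"
      by (rule sum.not_neutral_contains_not_neutral)
    then have "L (k - j - (t + l)) \<le> s"
      using bT[OF that] by (simp add: banded_def)
    moreover have "L l \<le> m"
      unfolding m_def using F l by (intro member_le_sum) auto
    ultimately show "L (k - j - t) \<le> s + m"
      using L_add[of "k - j - (t + l)" l] by (simp add: algebra_simps)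
  qed
  have bE: "banded (E l o\<^sub>L Y) s (t + l)" if "banded Y s t" for Y s t l
    using bT[OF that] by (simp add: E_def) (simp add: banded_def opmat_linear)
  have bid: "banded id_blinfun 0 0"
    by (auto simp: banded_def opmat_id L_zero)
  have "ennreal (norm B) + (\<integral>\<^sup>+l. ennreal (v l * norm (E l)) \<partial>count_space UNIV) \<le> ennreal c"
    using nB S sE v_nonneg
    by (simp add: nn_integral_count_space_eq_infsum c_def ennreal_leI flip: S_def ennreal_plus)
  note le = wsum_power_le[OF bB bE CB c(1) this bid]
  obtain Q where Q: "((\<lambda>n. ((o\<^sub>L) C ^^ n) id_blinfun) has_sum Q) UNIV"
    "(id_blinfun - C) o\<^sub>L Q = id_blinfun" "Q o\<^sub>L (id_blinfun - C) = id_blinfun"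
    by (rule neumann_series[OF nC])
  have "wsum v (opmat Q) \<le> (\<integral>\<^sup>+n. wsum v (opmat (((o\<^sub>L) C ^^ n) id_blinfun)) \<partial>count_space UNIV)"
    by (intro wsum_mono_infinite norm_has_sum_le_nn_integral has_sum_bounded_linear[OF bounded_linear_opmat] Q)
  also have "\<dots> \<le> (\<integral>\<^sup>+n. ennreal (v 0 * (ball_weight (n * m) * c ^ n)) \<partial>count_space UNIV)"
  proof (rule nn_integral_mono)
    fix n
    have "wsum v (opmat (((o\<^sub>L) C ^^ n) id_blinfun))
        \<le> ennreal (v 0 * ball_weight (n * m) * c ^ n * norm (id_blinfun :: ('i, 'h) ell2 \<Rightarrow>\<^sub>L ('i, 'h) ell2))"
      using le[of n] by simp
    also have "\<dots> \<le> ennreal (v 0 * ball_weight (n * m) * c ^ n * 1)"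
      using c v_nonneg ball_weight_nonneg by (intro ennreal_leI mult_left_mono norm_blinfun_id_le) simp
    finally show "wsum v (opmat (((o\<^sub>L) C ^^ n) id_blinfun)) \<le> ennreal (v 0 * (ball_weight (n * m) * c ^ n))"
      by (simp add: mult_ac)
  qed
  also have "\<dots> < \<infinity>"
  proof (subst summable_on_iff_nn_integral_count_space[symmetric])
    show nn: "0 \<le> v 0 * (ball_weight (n * m) * c ^ n)" for n
      using c v_nonneg ball_weight_nonneg by simp
    show "(\<lambda>n. v 0 * (ball_weight (n * m) * c ^ n)) summable_on UNIV"
      using growth[OF c, of m] nn
      by (intro summable_nonneg_imp_summable_on summable_mult) (simp_all add: ball_weight_def)
  qed
  finally have "Q \<in> weighted_operators"
    using bounded_operators_inverse[OF _ Q(2,3)] C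
    by (simp add: weighted_operators_def bounded_operators_diff bounded_operators_id)
  then show ?thesis
    using that Q by blast
qed

end


section \<open>Coercive operators and the weighted algebra\<close>

lemma scaleC_op_linear:
  shows scaleC_op_add_right: "scaleC_op c (S + T) = scaleC_op c S + scaleC_op c T"
    and scaleC_op_add_left: "scaleC_op (b + c) T = scaleC_op b T + scaleC_op c T"
    and scaleC_op_scaleC_op: "scaleC_op b (scaleC_op c T) = scaleC_op (b * c) T"
    and scaleC_op_one: "scaleC_op 1 T = T"
    and scaleC_op_compose_left: "scaleC_op c S o\<^sub>L T = scaleC_op c (S o\<^sub>L T)"
    and scaleC_op_compose_right: "S \<in> bounded_operators \<Longrightarrow> S o\<^sub>L scaleC_op c T = scaleC_op c (S o\<^sub>L T)"
  by (auto intro!: blinfun_eqI simp: blinfun.bilinear_simps scaleC_op_apply scaleC_add_right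
      scaleC_add_left scaleC_scaleC scaleC_one bounded_operatorsD)

lemma blinfun_compose_algebra:
  shows blinfun_compose_add_left: "(S + T) o\<^sub>L U = (S o\<^sub>L U) + (T o\<^sub>L U)"
    and blinfun_compose_add_right: "U o\<^sub>L (S + T) = (U o\<^sub>L S) + (U o\<^sub>L T)"
    and blinfun_compose_scaleR_left: "(r *\<^sub>R S) o\<^sub>L T = r *\<^sub>R (S o\<^sub>L T)"
    and blinfun_compose_scaleR_right: "S o\<^sub>L (r *\<^sub>R T) = r *\<^sub>R (S o\<^sub>L T)"
    and blinfun_compose_assoc: "(S o\<^sub>L T) o\<^sub>L U = S o\<^sub>L (T o\<^sub>L U)"
    and blinfun_compose_id_left: "id_blinfun o\<^sub>L S = S"
    and blinfun_compose_id_right: "S o\<^sub>L id_blinfun = S"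
  by (auto intro!: blinfun_eqI simp: blinfun.bilinear_simps)

section \<open>Coercive operators, inverses and resolvents\<close>

context subexponential_weight
begin

lemma weighted_operators_coercive:
  fixes Y :: "('i, 'h::complex_hilbert) ell2 \<Rightarrow>\<^sub>L ('i, 'h) ell2"
  assumes Y: "Y \<in> weighted_operators" and d: "0 < d"
    and coercive: "\<And>f. d * (norm f)\<^sup>2 \<le> Re (cinner (blinfun_apply Y f) f)"
  obtains Q where "Q \<in> weighted_operators" "Y o\<^sub>L Q = id_blinfun" "Q o\<^sub>L Y = id_blinfun"
proof -
  \<comment> \<open>For \<open>t = d / K\<close>, expanding the square bounds
    \<open>(norm (C f))\<^sup>2\<close> by
    \<open>1 - 2 * t * d + t\<^sup>2 * (norm Y)\<^sup>2\<close> times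
    \<open>(norm f)\<^sup>2\<close>, and \<open>t * (norm Y)\<^sup>2 \<le> d\<close> reduces the
    factor to \<open>1 - t * d\<close>. The summand \<open>d\<^sup>2\<close> makes \<open>K\<close>
    positive and \<open>t * d\<close> at most 1.\<close>
  define K where "K = (norm Y)\<^sup>2 + d\<^sup>2"
  have K: "K > 0"
    unfolding K_def using d by (simp add: add_nonneg_pos)
  define t where "t = d / K"
  have t: "t > 0" "t * (norm Y)\<^sup>2 \<le> d" "t * d \<le> 1"
    using d K by (auto simp: t_def K_def field_simps power2_eq_square)
  define C where "C = id_blinfun - t *\<^sub>R Y"
  have "norm C \<le> sqrt (1 - t * d)"
  proof (rule norm_blinfun_bound)
    fix f
    have "(norm (blinfun_apply Y f))\<^sup>2 \<le> (norm Y)\<^sup>2 * (norm f)\<^sup>2"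
      using power_mono[OF norm_blinfun[of Y f], of 2] by (simp add: power_mult_distrib)
    then have "t * t * (norm (blinfun_apply Y f))\<^sup>2 \<le> t * (t * (norm Y)\<^sup>2) * (norm f)\<^sup>2"
      using t(1) by (simp add: mult.assoc)
    also have "\<dots> \<le> t * d * (norm f)\<^sup>2"
      using t by (intro mult_right_mono mult_left_mono) auto
    finally have 1: "t * t * (norm (blinfun_apply Y f))\<^sup>2 \<le> t * d * (norm f)\<^sup>2" .
    have 2: "t * (d * (norm f)\<^sup>2) \<le> t * Re (cinner (blinfun_apply Y f) f)"
      using t(1) coercive by (intro mult_left_mono) auto
    have "Re (cinner f (blinfun_apply Y f)) = Re (cinner (blinfun_apply Y f) f)"
      by (subst cinner_commute) simp
    then have "(norm (blinfun_apply C f))\<^sup>2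
        = (norm f)\<^sup>2 - 2 * (t * Re (cinner (blinfun_apply Y f) f)) + t * t * (norm (blinfun_apply Y f))\<^sup>2"
      unfolding C_def
      by (simp add: blinfun.bilinear_simps norm_diff_squared cinner_scaleR_right power_mult_distrib)
        (simp add: power2_eq_square)
    also have "\<dots> \<le> (1 - t * d) * (norm f)\<^sup>2"
      using 1 2 by (simp add: algebra_simps)
    finally have "sqrt ((norm (blinfun_apply C f))\<^sup>2) \<le> sqrt ((1 - t * d) * (norm f)\<^sup>2)"
      by (rule real_sqrt_le_mono)
    then show "norm (blinfun_apply C f) \<le> sqrt (1 - t * d) * norm f"
      by (simp add: real_sqrt_mult)
  qed (use t in simp)
  also have "\<dots> < 1"
    using t d by simp
  finally have "norm C < 1" .
  moreover have "C \<in> weighted_operators"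
    unfolding C_def by (intro weighted_operators_diff weighted_operators_id weighted_operators_scaleR Y)
  ultimately obtain Q where Q: "Q \<in> weighted_operators"
    "(id_blinfun - C) o\<^sub>L Q = id_blinfun" "Q o\<^sub>L (id_blinfun - C) = id_blinfun"
    using weighted_operators_neumann by blast
  have "id_blinfun - C = t *\<^sub>R Y"
    by (simp add: C_def)
  then show ?thesis
    using that[of "t *\<^sub>R Q"] Q
    by (simp add: blinfun_compose_scaleR_left blinfun_compose_scaleR_right weighted_operators_scaleR)
qed

lemma cinner_gram:
  assumes "T \<in> weighted_operators"
  shows "cinner (blinfun_apply (cadjoint T o\<^sub>L T) f) f = complex_of_real ((norm (blinfun_apply T f))\<^sup>2)"
  using assms by (simp add: weighted_operators_def cinner_cadjoint_left cinner_self)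

text \<open>The inverse bounds \<open>norm (T f)\<close> below by \<open>norm f / s\<close>, so
  \<open>cadjoint T o\<^sub>L T\<close> is coercive and has an inverse \<open>Q\<close> in the
  class; then \<open>S\<close> equals \<open>Q o\<^sub>L cadjoint T\<close>.\<close>

lemma weighted_operators_inverse:
  fixes T :: "('i, 'h::complex_hilbert) ell2 \<Rightarrow>\<^sub>L ('i, 'h) ell2"
  assumes T: "T \<in> weighted_operators" and S: "S o\<^sub>L T = id_blinfun" "T o\<^sub>L S = id_blinfun"
  shows "S \<in> weighted_operators"
proof -
  \<comment> \<open>The summand 1 avoids a division by zero when \<open>S\<close> is 0.\<close>
  define s where "s = norm S + 1"
  have s: "s > 0"
    unfolding s_def by (simp add: add_nonneg_pos)
  have "(1 / s\<^sup>2) * (norm f)\<^sup>2 \<le> Re (cinner (blinfun_apply (cadjoint T o\<^sub>L T) f) f)" for f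
  proof -
    have "norm f = norm (blinfun_apply S (blinfun_apply T f))"
      using S by (metis blinfun_apply_blinfun_compose blinfun_apply_id_blinfun)
    also have "\<dots> \<le> norm S * norm (blinfun_apply T f)"
      by (rule norm_blinfun)
    also have "\<dots> \<le> s * norm (blinfun_apply T f)"
      unfolding s_def by (intro mult_right_mono) auto
    finally have "(norm f)\<^sup>2 \<le> s\<^sup>2 * (norm (blinfun_apply T f))\<^sup>2"
      using power_mono[of "norm f" "s * norm (blinfun_apply T f)" 2] by (simp add: power_mult_distrib)
    then show ?thesis
      using s by (simp add: cinner_gram[OF T] field_simps del: blinfun_apply_blinfun_compose)
  qed
  moreover have "cadjoint T o\<^sub>L T \<in> weighted_operators"
    by (intro weighted_operators_compose weighted_operators_cadjoint T)
  ultimately obtain Q where Q: "Q \<in> weighted_operators" "Q o\<^sub>L (cadjoint T o\<^sub>L T) = id_blinfun"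
    using weighted_operators_coercive[of "cadjoint T o\<^sub>L T" "1 / s\<^sup>2"] s by auto
  have "Q o\<^sub>L cadjoint T = (Q o\<^sub>L cadjoint T) o\<^sub>L (T o\<^sub>L S)"
    by (simp add: S blinfun_compose_id_right)
  also have "\<dots> = S"
    using Q(2) by (metis blinfun_compose_assoc blinfun_compose_id_left)
  finally show ?thesis
    using weighted_operators_compose[OF Q(1) weighted_operators_cadjoint[OF T]] by simp
qed

text \<open>Multiplication by a suitable \<open>z\<close> moves the numerical range of
  \<open>X\<close> into a right half-plane away from 0, which makes \<open>X\<close> coercive; the
  factor is then absorbed into the inverse.\<close>

lemma weighted_operators_gram_resolvent:
  fixes T :: "('i, 'h::complex_hilbert) ell2 \<Rightarrow>\<^sub>L ('i, 'h) ell2"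
  assumes T: "T \<in> weighted_operators" and c: "c \<notin> \<real>\<^sub>\<ge>\<^sub>0"
  defines "X \<equiv> scaleC_op c id_blinfun - (cadjoint T o\<^sub>L T)"
  obtains Q where "Q \<in> weighted_operators" "X o\<^sub>L Q = id_blinfun" "Q o\<^sub>L X = id_blinfun"
proof -
  have X: "X \<in> weighted_operators"
    unfolding X_def by (intro weighted_operators_diff weighted_operators_compose
        weighted_operators_scaleC weighted_operators_cadjoint weighted_operators_id T)
  \<comment> \<open>A negative \<open>c\<close> takes \<open>z = -1\<close>; a non-real
    \<open>c\<close> takes \<open>- \<i>\<close> times \<open>Im c\<close>, which gives
    \<open>Re (z * c) = (Im c)\<^sup>2\<close>. The condition \<open>Re z \<le> 0\<close> gives the
    term with \<open>norm (T f)\<close> the favourable sign.\<close>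
  obtain z where z: "Re (z * c) > 0" "Re z \<le> 0"
  proof (cases "Im c = 0")
    case True
    then show ?thesis
      using c that[of "-1"] by (auto simp: complex_nonneg_Reals_iff)
  next
    case False
    then have "0 < Im c \<or> Im c < 0"
      by linarith
    then show ?thesis
      using that[of "- \<i> * of_real (Im c)"] by (auto simp: zero_less_mult_iff)
  qed
  have "Re (z * c) * (norm f)\<^sup>2 \<le> Re (cinner (blinfun_apply (scaleC_op z X) f) f)" for f
  proof -
    have "cinner (blinfun_apply (scaleC_op z X) f) f
        = z * (c * of_real ((norm f)\<^sup>2) - of_real ((norm (blinfun_apply T f))\<^sup>2))"
      using cinner_gram[OF T, of f]
      by (simp add: X_def scaleC_op_apply cinner_scaleC_left blinfun.bilinear_simps cinner_diff_left cinner_self)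
    then have "Re (cinner (blinfun_apply (scaleC_op z X) f) f)
        = Re (z * (c * of_real ((norm f)\<^sup>2) - of_real ((norm (blinfun_apply T f))\<^sup>2)))"
      by (rule arg_cong)
    also have "\<dots> = Re (z * c) * (norm f)\<^sup>2 - Re z * (norm (blinfun_apply T f))\<^sup>2"
      by (simp add: algebra_simps flip: of_real_power)
    finally have "Re (cinner (blinfun_apply (scaleC_op z X) f) f)
        = Re (z * c) * (norm f)\<^sup>2 - Re z * (norm (blinfun_apply T f))\<^sup>2" .
    moreover have "Re z * (norm (blinfun_apply T f))\<^sup>2 \<le> 0"
      using z by (simp add: mult_nonpos_nonneg)
    ultimately show ?thesis by linarith
  qed
  then obtain Q where Q: "Q \<in> weighted_operators"
    "scaleC_op z X o\<^sub>L Q = id_blinfun" "Q o\<^sub>L scaleC_op z X = id_blinfun"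
    using weighted_operators_coercive[OF weighted_operators_scaleC[OF X], of "Re (z * c)" z] z by blast
  show ?thesis
  proof (rule that)
    show "scaleC_op z Q \<in> weighted_operators"
      by (rule weighted_operators_scaleC[OF Q(1)])
    show "X o\<^sub>L scaleC_op z Q = id_blinfun" "scaleC_op z Q o\<^sub>L X = id_blinfun"
      using Q X by (simp_all add: weighted_operators_def scaleC_op_compose_left scaleC_op_compose_right)
  qed
qed

end

section \<open>The Banach star-algebra of weighted matrices\<close>

context lattice_weight
begin

text \<open>The operations are those of \<open>matrix_algebra\<close>, over any index group; the
  carrier is an image of operators, so that each element unfolds to some
  \<open>opmat T\<close>.\<close>

definition weighted_algebra :: "('i \<Rightarrow> 'i \<Rightarrow> 'h::complex_hilbert \<Rightarrow>\<^sub>L 'h) star_algebra" where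
  "weighted_algebra = \<lparr>carrier = opmat ` weighted_operators,
    monoid.mult = (\<lambda>A B k l. \<Sum>\<^sub>\<infinity>n. A k n o\<^sub>L B n l),
    one = (\<lambda>k l. if k = l then id_blinfun else 0),
    ring.zero = (\<lambda>k l. 0),
    add = (\<lambda>A B k l. A k l + B k l),
    module.smult = (\<lambda>c A k l. scaleC_op c (A k l)),
    involution = (\<lambda>A k l. cadjoint (A l k))\<rparr>"

lemma carrier_weighted_algebra: "carrier weighted_algebra = opmat ` weighted_operators"
  by (simp add: weighted_algebra_def)

text \<open>Within the class the product series converges absolutely in operator norm, so
  \<open>infsum\<close> is a genuine sum and not the default 0; evaluation at \<open>x\<close>
  identifies it through \<open>has_sum_opmat_compose\<close>.\<close>

lemma infsum_opmat_compose:
  fixes S T :: "('i, 'h::complex_hilbert) ell2 \<Rightarrow>\<^sub>L ('i, 'h) ell2"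
  assumes "S \<in> weighted_operators" "T \<in> weighted_operators"
  shows "(\<Sum>\<^sub>\<infinity>n. opmat S k n o\<^sub>L opmat T n l) = opmat (S o\<^sub>L T) k l"
proof -
  let ?p = "\<lambda>n. opmat S k n o\<^sub>L opmat T n l"
  have "(\<integral>\<^sup>+n. ennreal (norm (?p n)) \<partial>count_space UNIV)
      \<le> (\<integral>\<^sup>+n. diag_sup (opmat S) (k - n) * wsum v (opmat T) \<partial>count_space UNIV)"
  proof (rule nn_integral_mono)
    fix n
    have "ennreal (norm (?p n)) \<le> ennreal (norm (opmat S k n)) * ennreal (norm (opmat T n l))"
      by (simp flip: ennreal_mult add: ennreal_leI norm_blinfun_compose)
    also have "\<dots> \<le> diag_sup (opmat S) (k - n) * wsum v (opmat T)"
      by (intro mult_mono norm_le_diag_sup norm_le_wsum) auto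
    finally show "ennreal (norm (?p n)) \<le> diag_sup (opmat S) (k - n) * wsum v (opmat T)" .
  qed
  also have "\<dots> = (\<integral>\<^sup>+n. diag_sup (opmat S) n \<partial>count_space UNIV) * wsum v (opmat T)"
    by (simp add: nn_integral_multc nn_integral_count_space_translate(2)[of "diag_sup (opmat S)"])
  also have "\<dots> \<le> wsum v (opmat S) * wsum v (opmat T)"
    unfolding wsum_def[of v "opmat S"] by (intro mult_right_mono nn_integral_mono diag_sup_le) simp
  also have "\<dots> < \<infinity>"
    using assms by (simp add: weighted_operators_def ennreal_mult_less_top)
  finally have "(\<lambda>n. norm (?p n)) summable_on UNIV"
    by (subst summable_on_iff_nn_integral_count_space) auto
  then have "?p summable_on UNIV"
    by (rule Infinite_Sum.abs_summable_summable)
  then have "((\<lambda>n. blinfun_apply (?p n) x) has_sum blinfun_apply (infsum ?p UNIV) x) UNIV" for x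
    by (intro has_sum_bounded_linear[OF blinfun.bounded_linear_left] has_sum_infsum)
  then show ?thesis
    using has_sum_opmat_compose[of S k T l] by (intro blinfun_eqI) (meson has_sum_unique)
qed

lemma weighted_algebra_opmat:
  shows mult_opmat: "\<lbrakk>S \<in> weighted_operators; T \<in> weighted_operators\<rbrakk> \<Longrightarrow>
      opmat S \<otimes>\<^bsub>weighted_algebra\<^esub> opmat T = opmat (S o\<^sub>L T)"
    and one_opmat: "\<one>\<^bsub>weighted_algebra\<^esub> = opmat id_blinfun"
    and zero_opmat: "\<zero>\<^bsub>weighted_algebra\<^esub> = opmat 0"
    and add_opmat: "opmat S \<oplus>\<^bsub>weighted_algebra\<^esub> opmat T = opmat (S + T)"
    and smult_opmat: "c \<odot>\<^bsub>weighted_algebra\<^esub> opmat T = opmat (scaleC_op c T)"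
    and involution_opmat: "T \<in> weighted_operators \<Longrightarrow>
      involution weighted_algebra (opmat T) = opmat (cadjoint T)"
  by (auto simp: weighted_algebra_def infsum_opmat_compose opmat_id opmat_linear opmat_scaleC
      opmat_cadjoint weighted_operators_def intro!: ext)

lemma weighted_operators_zero: "0 \<in> weighted_operators"
  using weighted_operators_scaleR[OF weighted_operators_id, of 0] by simp

lemma weighted_operators_minus: "T \<in> weighted_operators \<Longrightarrow> - T \<in> weighted_operators"
  using weighted_operators_scaleR[of T "-1"] by simp

lemmas weighted_operators_closed = weighted_operators_id weighted_operators_zero weighted_operators_add
  weighted_operators_diff weighted_operators_minus weighted_operators_scaleC
  weighted_operators_compose weighted_operators_cadjoint

lemmas weighted_algebra_simps = carrier_weighted_algebra weighted_algebra_opmat weighted_operators_closed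

lemma ring_weighted_algebra: "Ring.ring (weighted_algebra :: ('i \<Rightarrow> 'i \<Rightarrow> 'h::complex_hilbert \<Rightarrow>\<^sub>L 'h) star_algebra)"
proof (intro ringI abelian_groupI monoidI)
  fix x :: "'i \<Rightarrow> 'i \<Rightarrow> 'h \<Rightarrow>\<^sub>L 'h"
  assume "x \<in> carrier weighted_algebra"
  then obtain T where T: "x = opmat T" "T \<in> weighted_operators"
    by (auto simp: carrier_weighted_algebra)
  then show "\<exists>y\<in>carrier weighted_algebra. y \<oplus>\<^bsub>weighted_algebra\<^esub> x = \<zero>\<^bsub>weighted_algebra\<^esub>"
    by (intro bexI[of _ "opmat (- T)"]) (auto simp: weighted_algebra_simps)
qed (auto simp: weighted_algebra_simps opmat_inject blinfun_compose_algebra add_ac)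

lemma star_algebra_weighted_algebra:
  "star_algebra (weighted_algebra :: ('i \<Rightarrow> 'i \<Rightarrow> 'h::complex_hilbert \<Rightarrow>\<^sub>L 'h) star_algebra)"
proof -
  interpret R: Ring.ring "weighted_algebra :: ('i \<Rightarrow> 'i \<Rightarrow> 'h \<Rightarrow>\<^sub>L 'h) star_algebra"
    by (rule ring_weighted_algebra)
  have C: "cring complex_field"
    by (intro cringI abelian_groupI comm_monoidI)
      (auto simp: complex_field_def algebra_simps intro: exI[of _ "- _"])
  have bd: "T \<in> weighted_operators \<Longrightarrow> T \<in> bounded_operators" for T :: "('i, 'h) ell2 \<Rightarrow>\<^sub>L ('i, 'h) ell2"
    by (simp add: weighted_operators_def)
  have "Module.module complex_field (weighted_algebra :: ('i \<Rightarrow> 'i \<Rightarrow> 'h \<Rightarrow>\<^sub>L 'h) star_algebra)"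
    by (intro moduleI C R.abelian_group_axioms)
      (auto simp: weighted_algebra_simps opmat_inject complex_field_def scaleC_op_linear)
  then show ?thesis
    by (intro star_algebra.intro star_algebra_axioms.intro R.ring_axioms)
      (auto simp: weighted_algebra_simps opmat_inject scaleC_op_linear bd
        cadjoint_cadjoint cadjoint_add cadjoint_scaleC cadjoint_compose)
qed

text \<open>Fatou for the counting measure: the norm is lower semicontinuous under entrywise
  convergence.\<close>

lemma wsum_le_of_tendsto:
  assumes "\<And>k l. (\<lambda>n. X n k l) \<longlonglongrightarrow> A k l" and "\<forall>\<^sub>F n in sequentially. wsum v (X n) \<le> e"
  shows "wsum v A \<le> e"
proof -
  have "ennreal (v l) * diag_sup A l \<le> liminf (\<lambda>n. ennreal (v l) * diag_sup (X n) l)" for l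
    unfolding diag_sup_def[of A] SUP_mult_left_ennreal
  proof (rule SUP_least)
    fix k
    have "(\<lambda>n. ennreal (v l * norm (X n k (k - l)))) \<longlonglongrightarrow> ennreal (v l * norm (A k (k - l)))"
      by (intro tendsto_intros assms)
    then have "ennreal (v l * norm (A k (k - l))) = liminf (\<lambda>n. ennreal (v l * norm (X n k (k - l))))"
      by (rule lim_imp_Liminf[symmetric, rotated]) simp
    also have "\<dots> \<le> liminf (\<lambda>n. ennreal (v l) * diag_sup (X n) l)"
      using norm_le_diag_sup[of "X _" k "k - l"]
      by (intro Liminf_mono always_eventually allI) (simp add: ennreal_mult v_nonneg mult_left_mono)
    finally show "ennreal (v l) * ennreal (norm (A k (k - l))) \<le> liminf (\<lambda>n. ennreal (v l) * diag_sup (X n) l)"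
      by (simp add: ennreal_mult v_nonneg)
  qed
  then have "wsum v A \<le> (\<integral>\<^sup>+l. liminf (\<lambda>n. ennreal (v l) * diag_sup (X n) l) \<partial>count_space UNIV)"
    unfolding wsum_def by (intro nn_integral_mono)
  also have "\<dots> \<le> liminf (\<lambda>n. wsum v (X n))"
    unfolding wsum_def by (rule nn_integral_liminf) simp
  also have "\<dots> \<le> limsup (\<lambda>n. wsum v (X n))"
    by (rule Liminf_le_Limsup) simp
  also have "\<dots> \<le> e"
    by (rule Limsup_bounded[OF assms(2)])
  finally show ?thesis .
qed

lemma minus_opmat:
  fixes S T :: "('i, 'h::complex_hilbert) ell2 \<Rightarrow>\<^sub>L ('i, 'h) ell2"
  assumes "S \<in> weighted_operators" "T \<in> weighted_operators"
  shows "opmat S \<ominus>\<^bsub>weighted_algebra\<^esub> opmat T = opmat (S - T)"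
proof -
  interpret R: Ring.ring "weighted_algebra :: ('i \<Rightarrow> 'i \<Rightarrow> 'h \<Rightarrow>\<^sub>L 'h) star_algebra"
    by (rule ring_weighted_algebra)
  have "\<ominus>\<^bsub>weighted_algebra\<^esub> opmat T = opmat (- T)"
    using assms by (intro R.minus_equality) (auto simp: weighted_algebra_simps)
  then show ?thesis
    by (simp add: a_minus_def weighted_algebra_simps)
qed

abbreviation wnorm :: "('i \<Rightarrow> 'i \<Rightarrow> 'h::complex_hilbert \<Rightarrow>\<^sub>L 'h) \<Rightarrow> real" where
  "wnorm A \<equiv> enn2real (wsum v A)"

lemma ennreal_wnorm: "T \<in> weighted_operators \<Longrightarrow> ennreal (wnorm (opmat T)) = wsum v (opmat T)"
  by (simp add: weighted_operators_def)

lemma wnorm_leI: "0 \<le> c \<Longrightarrow> wsum v A \<le> ennreal c \<Longrightarrow> wnorm A \<le> c"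
  by (simp add: enn2real_leI)

lemma norm_opmat_le_wnorm: "T \<in> weighted_operators \<Longrightarrow> norm (opmat T k l) \<le> wnorm (opmat T)"
  by (metis ennreal_le_iff ennreal_wnorm enn2real_nonneg norm_le_wsum)

lemma weighted_operators_of_matrix:
  assumes "\<And>k l. A k l \<in> bounded_operators" "wsum v A < \<infinity>"
  obtains T where "A = opmat T" "T \<in> weighted_operators"
proof -
  obtain T where T: "opmat T = A"
    by (rule obtain_operator[OF assms(2)])
  show ?thesis
    using assms T by (intro that[of T]) (auto simp: weighted_operators_def bounded_operators_iff_opmat)
qed

text \<open>The norm dominates the entries, so a Cauchy sequence has an entrywise limit
  \<open>A\<close>. Semicontinuity shows that the convergence holds in norm and that
  \<open>A\<close> has finite norm, hence is the matrix of an operator in the class.\<close>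

lemma wnorm_complete:
  fixes T :: "nat \<Rightarrow> ('i, 'h::complex_hilbert) ell2 \<Rightarrow>\<^sub>L ('i, 'h) ell2"
  assumes T: "\<And>n. T n \<in> weighted_operators"
    and Cauchy: "\<And>e. e > 0 \<Longrightarrow> \<exists>M. \<forall>m\<ge>M. \<forall>n\<ge>M. wnorm (opmat (T m - T n)) < e"
  obtains S where "S \<in> weighted_operators" "(\<lambda>n. wnorm (opmat (T n - S))) \<longlonglongrightarrow> 0"
proof -
  have D: "T m - T n \<in> weighted_operators" for m n
    by (intro weighted_operators_diff T)
  have "Cauchy (\<lambda>n. opmat (T n) k l)" for k l
  proof (rule CauchyI)
    fix e :: real assume "e > 0"
    then obtain M where "\<forall>m\<ge>M. \<forall>n\<ge>M. wnorm (opmat (T m - T n)) < e"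
      using Cauchy by blast
    then have "\<forall>m\<ge>M. \<forall>n\<ge>M. norm (opmat (T m - T n) k l) < e"
      by (meson norm_opmat_le_wnorm[OF D] order_le_less_trans)
    then have "\<forall>m\<ge>M. \<forall>n\<ge>M. norm (opmat (T m) k l - opmat (T n) k l) < e"
      by (simp only: opmat_linear)
    then show "\<exists>M. \<forall>m\<ge>M. \<forall>n\<ge>M. norm (opmat (T m) k l - opmat (T n) k l) < e" ..
  qed
  then have "\<exists>B. (\<lambda>n. opmat (T n) k l) \<longlonglongrightarrow> B" for k l
    using Cauchy_convergent convergent_def by blast
  then obtain A where A: "\<And>k l. (\<lambda>n. opmat (T n) k l) \<longlonglongrightarrow> A k l"
    by metis
  have Abd: "A k l \<in> bounded_operators" for k l
  proof -
    have "blinfun_apply (A k l) (c *\<^sub>C x) = c *\<^sub>C blinfun_apply (A k l) x" for c x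
    proof (rule LIMSEQ_unique)
      show "(\<lambda>n. blinfun_apply (opmat (T n) k l) (c *\<^sub>C x)) \<longlonglongrightarrow> blinfun_apply (A k l) (c *\<^sub>C x)"
        by (intro tendsto_intros A)
      have "(\<lambda>n. c *\<^sub>C blinfun_apply (opmat (T n) k l) x) \<longlonglongrightarrow> c *\<^sub>C blinfun_apply (A k l) x"
        by (intro bounded_linear.tendsto[OF bounded_linear_scaleC] tendsto_intros A)
      then show "(\<lambda>n. blinfun_apply (opmat (T n) k l) (c *\<^sub>C x)) \<longlonglongrightarrow> c *\<^sub>C blinfun_apply (A k l) x"
        using T by (simp add: weighted_operators_def bounded_operatorsD opmat_bounded_operators)
    qed
    then show ?thesis
      by (simp add: bounded_operators_def)
  qed
  \<comment> \<open>In the Cauchy estimate \<open>m\<close> stays fixed while \<open>n\<close> tends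
    to infinity.\<close>
  have lim: "\<exists>M. \<forall>m\<ge>M. wsum v (\<lambda>k l. opmat (T m) k l - A k l) \<le> ennreal e" if e: "e > 0" for e
  proof -
    obtain M where M: "\<forall>m\<ge>M. \<forall>n\<ge>M. wnorm (opmat (T m - T n)) < e"
      using Cauchy[OF e] by blast
    have "wsum v (\<lambda>k l. opmat (T m) k l - A k l) \<le> ennreal e" if m: "m \<ge> M" for m
    proof (rule wsum_le_of_tendsto[of "\<lambda>n. opmat (T m - T n)"])
      show "(\<lambda>n. opmat (T m - T n) k l) \<longlonglongrightarrow> opmat (T m) k l - A k l" for k l
        unfolding opmat_linear by (rule tendsto_diff[OF tendsto_const A])
      have "wsum v (opmat (T m - T n)) \<le> ennreal e" if "n \<ge> M" for n
        using M m that ennreal_leI[of "wnorm (opmat (T m - T n))" e] by (simp add: ennreal_wnorm[OF D] less_imp_le)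
      then show "\<forall>\<^sub>F n in sequentially. wsum v (opmat (T m - T n)) \<le> ennreal e"
        by (auto simp: eventually_sequentially)
    qed
    then show ?thesis by blast
  qed
  obtain M where M: "wsum v (\<lambda>k l. opmat (T M) k l - A k l) \<le> ennreal 1"
    using lim[of 1] by auto
  have "wsum v A \<le> wsum v (opmat (T M)) + wsum v (\<lambda>k l. opmat (T M) k l - A k l)"
  proof (rule wsum_add_le)
    show "norm (A k l) \<le> norm (opmat (T M) k l) + norm (opmat (T M) k l - A k l)" for k l
      using norm_triangle_ineq4[of "opmat (T M) k l" "opmat (T M) k l - A k l"] by simp
  qed
  also have "\<dots> < \<infinity>"
    using M T[of M] by (auto simp: weighted_operators_def intro: order_le_less_trans)
  finally obtain S where S: "A = opmat S" "S \<in> weighted_operators"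
    using weighted_operators_of_matrix[of A] Abd by blast
  have "(\<lambda>n. wnorm (opmat (T n - S))) \<longlonglongrightarrow> 0"
  proof (rule LIMSEQ_I)
    fix e :: real assume e: "e > 0"
    then obtain M where M: "\<forall>m\<ge>M. wsum v (\<lambda>k l. opmat (T m) k l - A k l) \<le> ennreal (e / 2)"
      using lim[of "e / 2"] by auto
    have "wnorm (opmat (T m - S)) < e" if "m \<ge> M" for m
    proof -
      have "wsum v (opmat (T m - S)) \<le> ennreal (e / 2)"
        using M that by (simp add: S opmat_linear(2)[abs_def])
      then have "wnorm (opmat (T m - S)) \<le> e / 2"
        using e by (intro wnorm_leI) auto
      then show ?thesis
        using e by simp
    qed
    then show "\<exists>M. \<forall>m\<ge>M. norm (wnorm (opmat (T m - S)) - 0) < e"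
      by auto
  qed
  then show ?thesis
    using that S by blast
qed

theorem banach_star_algebra_weighted_algebra:
  "banach_star_algebra (weighted_algebra :: ('i \<Rightarrow> 'i \<Rightarrow> 'h::complex_hilbert \<Rightarrow>\<^sub>L 'h) star_algebra) wnorm"
proof (intro banach_star_algebra.intro banach_star_algebra_axioms.intro star_algebra_weighted_algebra)
  let ?A = "weighted_algebra :: ('i \<Rightarrow> 'i \<Rightarrow> 'h \<Rightarrow>\<^sub>L 'h) star_algebra"
  fix x y :: "'i \<Rightarrow> 'i \<Rightarrow> 'h \<Rightarrow>\<^sub>L 'h" and c :: complex
  assume "x \<in> carrier ?A"
  then obtain T where T: "x = opmat T" "T \<in> weighted_operators"
    by (auto simp: carrier_weighted_algebra)
  show "0 \<le> wnorm x" by simp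
  show "(wnorm x = 0) = (x = \<zero>\<^bsub>?A\<^esub>)"
  proof
    assume "wnorm x = 0"
    then have "opmat T k l = 0" for k l
      using norm_opmat_le_wnorm[OF T(2), of k l] T by simp
    then show "x = \<zero>\<^bsub>?A\<^esub>"
      by (auto simp: T weighted_algebra_simps opmat_linear intro!: ext)
  next
    assume "x = \<zero>\<^bsub>?A\<^esub>"
    then show "wnorm x = 0"
      \<comment> \<open>The zero matrix is entrywise 0 times itself, so its norm is 0 times its
        norm.\<close>
      using wsum_cmult[of 0 x x v] by (simp add: weighted_algebra_simps opmat_linear)
  qed
  show "wnorm (c \<odot>\<^bsub>?A\<^esub> x) = cmod c * wnorm x"
    using wsum_cmult[of "cmod c" "opmat (scaleC_op c T)" x v]
    by (simp add: T weighted_algebra_simps opmat_scaleC norm_scaleC_op enn2real_mult)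
  show "wnorm (involution ?A x) = wnorm x"
    using T wsum_transpose[of "opmat (cadjoint T)" x]
    by (simp add: weighted_algebra_simps opmat_cadjoint norm_cadjoint opmat_bounded_operators
        weighted_operators_def)
  assume "y \<in> carrier ?A"
  then obtain S where S: "y = opmat S" "S \<in> weighted_operators"
    by (auto simp: carrier_weighted_algebra)
  have "wsum v (x \<oplus>\<^bsub>?A\<^esub> y) \<le> wsum v x + wsum v y"
    by (intro wsum_add_le) (simp add: S T weighted_algebra_simps opmat_linear norm_triangle_ineq)
  then show "wnorm (x \<oplus>\<^bsub>?A\<^esub> y) \<le> wnorm x + wnorm y"
    using S T by (intro wnorm_leI) (simp_all add: ennreal_plus ennreal_wnorm)
  have "wsum v (x \<otimes>\<^bsub>?A\<^esub> y) \<le> wsum v x * wsum v y"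
    using S T wsum_mult_le[of "opmat (T o\<^sub>L S)" "opmat T" "opmat S", OF norm_opmat_compose_le]
    by (simp add: weighted_algebra_simps)
  then show "wnorm (x \<otimes>\<^bsub>?A\<^esub> y) \<le> wnorm x * wnorm y"
    using S T by (intro wnorm_leI) (simp_all add: ennreal_mult ennreal_wnorm)
next
  let ?A = "weighted_algebra :: ('i \<Rightarrow> 'i \<Rightarrow> 'h \<Rightarrow>\<^sub>L 'h) star_algebra"
  fix X :: "nat \<Rightarrow> 'i \<Rightarrow> 'i \<Rightarrow> 'h \<Rightarrow>\<^sub>L 'h"
  assume X: "range X \<subseteq> carrier ?A"
    and Cauchy: "\<forall>e>0. \<exists>M. \<forall>m\<ge>M. \<forall>n\<ge>M. wnorm (X m \<ominus>\<^bsub>?A\<^esub> X n) < e"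
  have "\<exists>T. X n = opmat T \<and> T \<in> weighted_operators" for n
    using X by (auto simp: carrier_weighted_algebra)
  then obtain T where T: "\<And>n. X n = opmat (T n)" "\<And>n. T n \<in> weighted_operators"
    by metis
  obtain S where S: "S \<in> weighted_operators" "(\<lambda>n. wnorm (opmat (T n - S))) \<longlonglongrightarrow> 0"
    using wnorm_complete[of T] Cauchy T by (auto simp: minus_opmat)
  then show "\<exists>x\<in>carrier ?A. (\<lambda>n. wnorm (X n \<ominus>\<^bsub>?A\<^esub> x)) \<longlonglongrightarrow> 0"
    by (intro bexI[of _ "opmat S"]) (auto simp: T minus_opmat carrier_weighted_algebra)
qed

end


section \<open>Weights on the lattice\<close>

lemma le_power_of_root_tendsto_1:
  fixes f :: "nat \<Rightarrow> real"
  assumes pos: "\<And>n. 0 < f n" and lim: "(\<lambda>n. f n powr (1 / real n)) \<longlonglongrightarrow> 1" and q: "1 < q"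
  shows "\<exists>K>0. \<forall>n. f n \<le> K * q ^ n"
proof -
  obtain N where N: "\<And>n. n \<ge> N \<Longrightarrow> f n powr (1 / real n) < q"
    using order_tendstoD(2)[OF lim q] by (auto simp: eventually_sequentially)
  \<comment> \<open>\<open>K\<close> absorbs the finitely many \<open>n \<le> N\<close>, among them
    \<open>n = 0\<close>, where \<open>1 / real n\<close> is 0 by convention and the root carries no
    information.\<close>
  define K where "K = 1 + (\<Sum>n\<le>N. f n)"
  have K: "1 \<le> K"
    unfolding K_def using pos by (simp add: sum_nonneg less_imp_le)
  have "f n \<le> K * q ^ n" for n
  proof (cases "n \<le> N")
    case True
    have "f n \<le> (\<Sum>n\<le>N. f n)"
      using True pos by (intro member_le_sum) (auto simp: less_imp_le)
    then have "f n \<le> K * 1"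
      by (simp add: K_def)
    also have "\<dots> \<le> K * q ^ n"
      using K q by (intro mult_left_mono one_le_power) auto
    finally show ?thesis .
  next
    case False
    then have "f n = (f n powr (1 / real n)) powr real n"
      using pos by (simp add: powr_powr less_imp_le)
    also have "\<dots> \<le> q powr real n"
      using False N[of n] by (intro powr_mono2) auto
    also have "\<dots> = 1 * q ^ n"
      using q by (simp add: powr_realpow)
    also have "\<dots> \<le> K * q ^ n"
      using K q by (intro mult_right_mono) auto
    finally show ?thesis .
  qed
  then show ?thesis
    using K by (intro exI[of _ K]) auto
qed

lemma polynomial_le_power:
  fixes q :: real
  assumes "1 < q"
  shows "\<exists>K>0. \<forall>n. (1 + real n) ^ a \<le> K * q ^ n"
proof (rule le_power_of_root_tendsto_1[OF _ _ assms])
  have "(\<lambda>n. (1 + real n) powr (real a / real n)) \<longlonglongrightarrow> 1"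
    by real_asymp
  then show "(\<lambda>n. ((1 + real n) ^ a) powr (1 / real n)) \<longlonglongrightarrow> 1"
    by (simp add: powr_realpow[symmetric] powr_powr)
qed simp

text \<open>A length that is a sum over the coordinates makes \<open>r ^ l1_length l\<close> a
  product of one-dimensional powers.\<close>

definition l1_length :: "int^'d::finite \<Rightarrow> nat" where
  "l1_length l = (\<Sum>j\<in>UNIV. nat \<bar>l $ j\<bar>)"

text \<open>The ball lies in the cube with edges \<open>{- int s..int s}\<close>. A cardinality
  bound polynomial in \<open>s\<close> is enough, because polynomials are dominated by every
  \<open>q ^ s\<close> with \<open>q > 1\<close>.\<close>

lemma l1_ball:
  fixes s :: nat
  shows finite_l1_ball: "finite {l :: int^'d::finite. l1_length l \<le> s}"
    and card_l1_ball: "card {l :: int^'d::finite. l1_length l \<le> s} \<le> (2 * s + 1) ^ CARD('d)"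
proof -
  let ?B = "{l :: int^'d. l1_length l \<le> s}"
  let ?P = "PiE (UNIV :: 'd set) (\<lambda>_. {- int s..int s})"
  have sub: "vec_nth ` ?B \<subseteq> ?P"
  proof clarify
    fix l :: "int^'d" assume l: "l1_length l \<le> s"
    have "nat \<bar>l $ j\<bar> \<le> s" for j
      using member_le_sum[of j UNIV "\<lambda>j. nat \<bar>l $ j\<bar>"] l by (simp add: l1_length_def)
    then have "l $ j \<in> {- int s..int s}" for j
      by (simp add: nat_le_iff abs_le_iff minus_le_iff)
    then show "vec_nth l \<in> ?P"
      by (simp add: PiE_UNIV_domain)
  qed
  have inj: "inj_on vec_nth ?B"
    by (auto simp: inj_on_def vec_nth_inject)
  have fin: "finite ?P"
    by (intro finite_PiE) auto
  show "finite ?B"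
    using finite_imageD[OF finite_subset[OF sub fin] inj] .
  have "card ?B \<le> card ?P"
    by (rule card_inj_on_le[OF inj sub fin])
  also have "\<dots> = (2 * s + 1) ^ CARD('d)"
    by (simp add: card_PiE nat_add_distrib nat_mult_distrib)
  finally show "card ?B \<le> (2 * s + 1) ^ CARD('d)" .
qed

lemma subexponential_weightI:
  fixes v :: "int^'d::finite \<Rightarrow> real"
  assumes "lattice_weight v" and sub: "\<And>q. 1 < q \<Longrightarrow> \<exists>K>0. \<forall>l. v l \<le> K * q ^ l1_length l"
  shows "subexponential_weight v l1_length"
proof (intro subexponential_weight.intro subexponential_weight_axioms.intro assms(1))
  show "l1_length (0 :: int^'d) = 0"
    by (simp add: l1_length_def)
  show "l1_length (k + l) \<le> l1_length k + l1_length l" for k l :: "int^'d"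
    unfolding l1_length_def sum.distrib[symmetric] by (intro sum_mono) simp
  show "finite {l :: int^'d. l1_length l \<le> s}" for s
    by (rule finite_l1_ball)
  fix c :: real and m :: nat
  assume c: "0 \<le> c" "c < 1"
  \<comment> \<open>\<open>b\<close> lies strictly between \<open>c\<close> and 1 and is positive
    even when \<open>c\<close> is 0. The root of order \<open>2 * m + 1\<close> gives
    \<open>q ^ (2 * m) \<le> 1 / b\<close>, also for \<open>m = 0\<close>, and hence
    \<open>q ^ (2 * m) * c < 1\<close>.\<close>
  define b where "b = (1 + c) / 2"
  have b: "0 < b" "c < b" "b < 1"
    using c by (auto simp: b_def)
  define q where "q = root (Suc (2 * m)) (1 / b)"
  have q: "1 < q"
    unfolding q_def using b by (simp add: real_root_gt_1_iff)
  have "q ^ (2 * m) * 1 \<le> q ^ (2 * m) * q"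
    using q by (intro mult_left_mono) auto
  also have "\<dots> = 1 / b"
    using real_root_pow_pos2[of "Suc (2 * m)" "1 / b"] b unfolding q_def by (simp add: mult.commute)
  finally have "q ^ (2 * m) * c \<le> 1 / b * c"
    using c by (intro mult_right_mono) auto
  also have "\<dots> < 1"
    using b by simp
  finally have qc: "q ^ (2 * m) * c < 1" .
  obtain K where K: "K > 0" "\<And>l. v l \<le> K * q ^ l1_length l"
    using sub[OF q] by blast
  obtain P where P: "P > 0" "\<And>n. (1 + real n) ^ CARD('d) \<le> P * q ^ n"
    using polynomial_le_power[OF q] by blast
  \<comment> \<open>One factor \<open>q ^ s\<close> pays for the number of lattice points and
    another for the largest weight in the ball, hence the exponent \<open>2 * s\<close>.\<close>
  have V: "(\<Sum>l | l1_length l \<le> s. v l) \<le> (2 ^ CARD('d) * P * K) * q ^ (2 * s)" for s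
  proof -
    have "(\<Sum>l | l1_length l \<le> s. v l) \<le> (\<Sum>l::int^'d | l1_length l \<le> s. K * q ^ s)"
    proof (rule sum_mono)
      fix l :: "int^'d" assume "l \<in> {l. l1_length l \<le> s}"
      then have "K * q ^ l1_length l \<le> K * q ^ s"
        using K q by (intro mult_left_mono power_increasing) auto
      then show "v l \<le> K * q ^ s"
        using K(2)[of l] by linarith
    qed
    also have "\<dots> = real (card {l::int^'d. l1_length l \<le> s}) * (K * q ^ s)"
      by simp
    also have "\<dots> \<le> (2 ^ CARD('d) * (P * q ^ s)) * (K * q ^ s)"
    proof (rule mult_right_mono)
      have "real (card {l::int^'d. l1_length l \<le> s}) \<le> real ((2 * s + 1) ^ CARD('d))"
        using card_l1_ball[of s, where 'd='d] by (simp only: of_nat_le_iff)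
      also have "\<dots> \<le> (2 * (1 + real s)) ^ CARD('d)"
        unfolding of_nat_power by (intro power_mono) auto
      also have "\<dots> \<le> 2 ^ CARD('d) * (P * q ^ s)"
        unfolding power_mult_distrib by (intro mult_left_mono P) auto
      finally show "real (card {l::int^'d. l1_length l \<le> s}) \<le> 2 ^ CARD('d) * (P * q ^ s)" .
    qed (use K q in auto)
    also have "\<dots> = (2 ^ CARD('d) * P * K) * q ^ (2 * s)"
      by (simp add: power_mult power2_eq_square power_mult_distrib mult_ac)
    finally show ?thesis .
  qed
  show "summable (\<lambda>n. (\<Sum>l | l1_length l \<le> n * m. v l) * c ^ n)"
  proof (rule summable_comparison_test)
    show "summable (\<lambda>n. (2 ^ CARD('d) * P * K) * (q ^ (2 * m) * c) ^ n)"
      using qc q c by (intro summable_mult summable_geometric) simp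
    have "norm ((\<Sum>l | l1_length l \<le> n * m. v l) * c ^ n)
        \<le> (2 ^ CARD('d) * P * K) * (q ^ (2 * m) * c) ^ n" for n
    proof -
      have "norm ((\<Sum>l | l1_length l \<le> n * m. v l) * c ^ n) = (\<Sum>l | l1_length l \<le> n * m. v l) * c ^ n"
        using c by (simp add: sum_nonneg lattice_weight.v_nonneg[OF assms(1)])
      also have "\<dots> \<le> ((2 ^ CARD('d) * P * K) * q ^ (2 * (n * m))) * c ^ n"
        using c by (intro mult_right_mono V) simp
      also have "\<dots> = (2 ^ CARD('d) * P * K) * (q ^ (2 * m) * c) ^ n"
        by (simp add: power_mult_distrib power_mult[symmetric] mult_ac)
      finally show ?thesis .
    qed
    then show "\<exists>N. \<forall>n\<ge>N. norm ((\<Sum>l | l1_length l \<le> n * m. v l) * c ^ n)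
        \<le> (2 ^ CARD('d) * P * K) * (q ^ (2 * m) * c) ^ n"
      by blast
  qed
qed

section \<open>The weight of the matrix class\<close>

definition polynomial_weight :: "nat^'d \<Rightarrow> (real^'d \<Rightarrow> real) \<Rightarrow> int^'d::finite \<Rightarrow> real" where
  "polynomial_weight \<alpha> \<nu> l =
    (\<Prod>j\<in>UNIV. (1 + real_of_int \<bar>l $ j\<bar>) ^ (\<alpha> $ j)) * \<nu> (\<chi> j. real_of_int (l $ j))"

context
  fixes \<nu> :: "real^'d::finite \<Rightarrow> real" and \<alpha> :: "nat^'d"
  assumes \<nu>: "weight \<nu>" "submultiplicative \<nu>" "symmetric_weight \<nu>" "GRS_condition \<nu>"
begin

lemma weight_pos: "0 < \<nu> x"
  using \<nu>(1) by (simp add: weight_def)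

lemma weight_add_le: "\<nu> (x + y) \<le> \<nu> x * \<nu> y"
  using \<nu>(2) by (simp add: submultiplicative_def)

lemma weight_minus: "\<nu> (- x) = \<nu> x"
  using \<nu>(3) by (simp add: symmetric_weight_def)

text \<open>Submultiplicativity at 0 gives \<open>1 \<le> \<nu> 0\<close>, and at \<open>x\<close>
  and \<open>- x\<close>, with symmetry, \<open>\<nu> 0 \<le> (\<nu> x)\<^sup>2\<close>.\<close>

lemma weight_ge_1: "1 \<le> \<nu> x"
proof -
  have "1 \<le> \<nu> 0"
    using weight_add_le[of 0 0] weight_pos[of 0] by simp
  also have "\<nu> 0 \<le> \<nu> x * \<nu> x"
    using weight_add_le[of x "-x"] weight_minus[of x] by simp
  finally have "1\<^sup>2 \<le> (\<nu> x)\<^sup>2"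
    by (simp add: power2_eq_square)
  then show ?thesis
    by (rule power2_le_imp_le) (use weight_pos[of x] in simp)
qed

lemma weight_sum_le: "finite F \<Longrightarrow> \<nu> (\<Sum>j\<in>F. x j) \<le> \<nu> 0 * (\<Prod>j\<in>F. \<nu> (x j))"
proof (induction F rule: finite_induct)
  case (insert j F)
  have "\<nu> (x j + (\<Sum>j\<in>F. x j)) \<le> \<nu> (x j) * \<nu> (\<Sum>j\<in>F. x j)"
    by (rule weight_add_le)
  also have "\<dots> \<le> \<nu> (x j) * (\<nu> 0 * (\<Prod>j\<in>F. \<nu> (x j)))"
    using insert weight_pos[of "x j"] by (intro mult_left_mono) auto
  finally show ?case
    using insert by (simp add: mult_ac)
qed simp

lemma lattice_weight_polynomial_weight: "lattice_weight (polynomial_weight \<alpha> \<nu>)"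
proof
  fix k l :: "int^'d"
  have "1 \<le> (\<Prod>j\<in>UNIV. (1 + real_of_int \<bar>l $ j\<bar>) ^ (\<alpha> $ j))"
    by (intro prod_ge_1 one_le_power) auto
  then have "1 * 1 \<le> polynomial_weight \<alpha> \<nu> l"
    unfolding polynomial_weight_def by (intro mult_mono weight_ge_1) auto
  then show "1 \<le> polynomial_weight \<alpha> \<nu> l"
    by simp
  have "(\<Prod>j\<in>UNIV. (1 + real_of_int \<bar>(k + l) $ j\<bar>) ^ (\<alpha> $ j))
      \<le> (\<Prod>j\<in>UNIV. ((1 + real_of_int \<bar>k $ j\<bar>) * (1 + real_of_int \<bar>l $ j\<bar>)) ^ (\<alpha> $ j))"
  proof (intro prod_mono conjI power_mono)
    fix j
    have "\<bar>(k + l) $ j\<bar> \<le> \<bar>k $ j\<bar> + \<bar>l $ j\<bar> + \<bar>k $ j\<bar> * \<bar>l $ j\<bar>"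
      by (rule order_trans[of _ "\<bar>k $ j\<bar> + \<bar>l $ j\<bar>"]) auto
    then have "real_of_int \<bar>(k + l) $ j\<bar> \<le> real_of_int (\<bar>k $ j\<bar> + \<bar>l $ j\<bar> + \<bar>k $ j\<bar> * \<bar>l $ j\<bar>)"
      by (simp only: of_int_le_iff)
    then show "1 + real_of_int \<bar>(k + l) $ j\<bar> \<le> (1 + real_of_int \<bar>k $ j\<bar>) * (1 + real_of_int \<bar>l $ j\<bar>)"
      by (simp add: algebra_simps)
  qed auto
  also have "\<dots> = (\<Prod>j\<in>UNIV. (1 + real_of_int \<bar>k $ j\<bar>) ^ (\<alpha> $ j)) * (\<Prod>j\<in>UNIV. (1 + real_of_int \<bar>l $ j\<bar>) ^ (\<alpha> $ j))"
    by (simp add: power_mult_distrib prod.distrib)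
  finally have 1: "(\<Prod>j\<in>UNIV. (1 + real_of_int \<bar>(k + l) $ j\<bar>) ^ (\<alpha> $ j))
      \<le> (\<Prod>j\<in>UNIV. (1 + real_of_int \<bar>k $ j\<bar>) ^ (\<alpha> $ j)) * (\<Prod>j\<in>UNIV. (1 + real_of_int \<bar>l $ j\<bar>) ^ (\<alpha> $ j))" .
  have "(\<chi> j. real_of_int ((k + l) $ j)) = (\<chi> j. real_of_int (k $ j)) + (\<chi> j. real_of_int (l $ j))"
    by (simp add: vec_eq_iff)
  then have 2: "\<nu> (\<chi> j. real_of_int ((k + l) $ j)) \<le> \<nu> (\<chi> j. real_of_int (k $ j)) * \<nu> (\<chi> j. real_of_int (l $ j))"
    using weight_add_le by metis
  show "polynomial_weight \<alpha> \<nu> (k + l) \<le> polynomial_weight \<alpha> \<nu> k * polynomial_weight \<alpha> \<nu> l"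
    using mult_mono[OF 1 2] weight_pos by (simp add: polynomial_weight_def less_imp_le prod_nonneg mult_ac)
  have "(\<chi> j. real_of_int ((- l) $ j)) = - (\<chi> j. real_of_int (l $ j))"
    by (simp add: vec_eq_iff)
  then show "polynomial_weight \<alpha> \<nu> (- l) = polynomial_weight \<alpha> \<nu> l"
    by (simp add: polynomial_weight_def weight_minus)
qed

text \<open>Submultiplicativity bounds \<open>\<nu>\<close> at a lattice point by its values at
  multiples of the coordinate vectors. Along each axis the GRS-condition gives an exponential bound
  with base close to 1, and the product over the axes involves \<open>l1_length\<close>.\<close>

lemma polynomial_weight_le_power:
  assumes "1 < r"
  shows "\<exists>K>0. \<forall>l. polynomial_weight \<alpha> \<nu> l \<le> K * r ^ l1_length l"
proof -
  \<comment> \<open>One factor \<open>q ^ n\<close> serves the polynomial part and the other the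
    weight.\<close>
  define q where "q = sqrt r"
  have q: "1 < q" "q * q = r"
    using assms by (auto simp: q_def)
  have "\<exists>K>0. \<forall>n. (1 + real n) ^ (\<alpha> $ j) * \<nu> (real n *\<^sub>R axis j 1) \<le> K * r ^ n" for j
  proof -
    obtain P where P: "P > 0" "\<And>n. (1 + real n) ^ (\<alpha> $ j) \<le> P * q ^ n"
      using polynomial_le_power[OF q(1)] by blast
    obtain K where K: "K > 0" "\<And>n. \<nu> (real n *\<^sub>R axis j 1) \<le> K * q ^ n"
      using le_power_of_root_tendsto_1[of "\<lambda>n. \<nu> (real n *\<^sub>R axis j 1)" q] \<nu>(4) q(1) weight_pos
      by (auto simp: GRS_condition_def)
    have "(1 + real n) ^ (\<alpha> $ j) * \<nu> (real n *\<^sub>R axis j 1) \<le> (P * q ^ n) * (K * q ^ n)" for n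
      using P K q weight_pos by (intro mult_mono) (auto simp: less_imp_le)
    then have "(1 + real n) ^ (\<alpha> $ j) * \<nu> (real n *\<^sub>R axis j 1) \<le> (P * K) * r ^ n" for n
      unfolding q(2)[symmetric] power_mult_distrib by (simp add: mult_ac)
    then show ?thesis
      using P K by (intro exI[of _ "P * K"]) auto
  qed
  then obtain K where K: "\<And>j. K j > 0"
    "\<And>j n. (1 + real n) ^ (\<alpha> $ j) * \<nu> (real n *\<^sub>R axis j 1) \<le> K j * r ^ n"
    by metis
  have "polynomial_weight \<alpha> \<nu> l \<le> (\<nu> 0 * (\<Prod>j\<in>UNIV. K j)) * r ^ l1_length l" for l
  proof -
    \<comment> \<open>The GRS-condition concerns natural multiples; symmetry reduces negative
      coordinates to these.\<close>
    have ax: "\<nu> (real_of_int (l $ j) *\<^sub>R axis j 1) = \<nu> (real (nat \<bar>l $ j\<bar>) *\<^sub>R axis j 1)" for j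
    proof (cases "l $ j \<ge> 0")
      case False
      then have "real_of_int (l $ j) = - real (nat \<bar>l $ j\<bar>)"
        by simp
      then have "real_of_int (l $ j) *\<^sub>R axis j 1 = - (real (nat \<bar>l $ j\<bar>) *\<^sub>R axis j 1 :: real^'d)"
        by (simp only: scaleR_minus_left)
      then show ?thesis
        by (simp only: weight_minus)
    qed simp
    have "(\<chi> j. real_of_int (l $ j)) = (\<Sum>j\<in>UNIV. real_of_int (l $ j) *\<^sub>R axis j 1)"
      by (simp add: vec_eq_iff axis_def if_distrib sum.delta cong: if_cong)
    then have "polynomial_weight \<alpha> \<nu> l \<le> (\<Prod>j\<in>UNIV. (1 + real_of_int \<bar>l $ j\<bar>) ^ (\<alpha> $ j)) *
        (\<nu> 0 * (\<Prod>j\<in>UNIV. \<nu> (real_of_int (l $ j) *\<^sub>R axis j 1)))"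
      unfolding polynomial_weight_def using weight_sum_le[of UNIV "\<lambda>j. real_of_int (l $ j) *\<^sub>R axis j 1"]
      by (simp add: mult_left_mono prod_nonneg)
    also have "\<dots> = \<nu> 0 * (\<Prod>j\<in>UNIV. (1 + real (nat \<bar>l $ j\<bar>)) ^ (\<alpha> $ j) * \<nu> (real (nat \<bar>l $ j\<bar>) *\<^sub>R axis j 1))"
      by (simp add: ax prod.distrib mult_ac)
    also have "\<dots> \<le> \<nu> 0 * (\<Prod>j\<in>UNIV. K j * r ^ nat \<bar>l $ j\<bar>)"
    proof (intro mult_left_mono prod_mono conjI)
      show "0 \<le> (1 + real (nat \<bar>l $ j\<bar>)) ^ (\<alpha> $ j) * \<nu> (real (nat \<bar>l $ j\<bar>) *\<^sub>R axis j 1)" for j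
        using weight_pos[of "real (nat \<bar>l $ j\<bar>) *\<^sub>R axis j 1"] by (simp add: less_imp_le)
      show "(1 + real (nat \<bar>l $ j\<bar>)) ^ (\<alpha> $ j) * \<nu> (real (nat \<bar>l $ j\<bar>) *\<^sub>R axis j 1) \<le> K j * r ^ nat \<bar>l $ j\<bar>" for j
        by (rule K(2))
    qed (use weight_pos[of 0] in simp)
    also have "\<dots> = (\<nu> 0 * (\<Prod>j\<in>UNIV. K j)) * r ^ l1_length l"
      by (simp add: prod.distrib l1_length_def power_sum)
    finally show ?thesis .
  qed
  then show ?thesis
    using K weight_pos by (intro exI[of _ "\<nu> 0 * (\<Prod>j\<in>UNIV. K j)"]) (auto intro!: mult_pos_pos prod_pos)
qed

lemma subexponential_weight_polynomial_weight:
  "subexponential_weight (polynomial_weight \<alpha> \<nu>) l1_length"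
  by (intro subexponential_weightI lattice_weight_polynomial_weight polynomial_weight_le_power)

text \<open>Countability of the lattice lets the series in \<open>matrix_class\<close> be read as an
  integral for the counting measure.\<close>

lemma matrix_class_iff_wsum:
  "A \<in> matrix_class \<alpha> \<nu> \<longleftrightarrow> (\<forall>k l. A k l \<in> bounded_operators) \<and> wsum (polynomial_weight \<alpha> \<nu>) A < \<infinity>"
proof -
  have "ennreal (\<Prod>j\<in>UNIV. (1 + real_of_int \<bar>l $ j\<bar>) ^ (\<alpha> $ j)) * (SUP k. ennreal (norm (A k (k - l)))) *
      ennreal (\<nu> (\<chi> j. real_of_int (l $ j))) = ennreal (polynomial_weight \<alpha> \<nu> l) * diag_sup A l" for l
    unfolding polynomial_weight_def diag_sup_def
    using weight_pos by (simp add: ennreal_mult prod_nonneg less_imp_le mult_ac)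
  then show ?thesis
    by (simp add: matrix_class_def wsum_def infsum_eq_nn_integral_count_space)
qed

text \<open>The operations agree by definition. For the carriers, a matrix of the class is realised
  by an operator through its diagonal decomposition.\<close>

lemma matrix_algebra_eq:
  "(matrix_algebra \<alpha> \<nu> :: ('d, 'h::complex_hilbert) op_matrix star_algebra)
    = lattice_weight.weighted_algebra (polynomial_weight \<alpha> \<nu>)"
proof -
  interpret lattice_weight "polynomial_weight \<alpha> \<nu>"
    by (rule lattice_weight_polynomial_weight)
  have "(matrix_class \<alpha> \<nu> :: ('d, 'h) op_matrix set) = opmat ` weighted_operators"
  proof (intro equalityI subsetI)
    fix A :: "('d, 'h) op_matrix" assume "A \<in> matrix_class \<alpha> \<nu>"
    then obtain T where "A = opmat T" "T \<in> weighted_operators"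
      using weighted_operators_of_matrix[of A] unfolding matrix_class_iff_wsum by blast
    then show "A \<in> opmat ` weighted_operators"
      by blast
  qed (auto simp: matrix_class_iff_wsum weighted_operators_def opmat_bounded_operators)
  then show ?thesis
    by (simp add: matrix_algebra_def weighted_algebra_def)
qed

end

section \<open>Matrices acting as operators, and the conclusion\<close>

lemma acts_as_opmat: "acts_as (opmat T) T"
  by (simp add: acts_as_def has_sum_opmat)

lemma matrix_operator_opmat: "matrix_operator (opmat T) = T"
  by (rule matrix_operator_eq[OF acts_as_opmat])

lemma monoid_operator_algebra: "monoid (operator_algebra :: ('h::complex_hilbert \<Rightarrow>\<^sub>L 'h) star_algebra)"
  by (rule monoidI) (auto simp: operator_algebra_def bounded_operators_compose bounded_operators_id
      blinfun_compose_algebra)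

theorem corollary6p6:
  fixes \<nu> :: "real^'d::finite \<Rightarrow> real" and \<alpha> :: "nat^'d"
  assumes "separable_space (euclidean :: 'h::complex_hilbert topology)"
    and "weight \<nu>" and "submultiplicative \<nu>" and "symmetric_weight \<nu>" and "GRS_condition \<nu>"
  shows "let \<A> = (matrix_algebra \<alpha> \<nu> :: ('d, 'h) op_matrix star_algebra) in
    (\<exists>N. banach_star_algebra \<A> N \<and> solid (carrier \<A>) N) \<and>
    (\<forall>A\<in>carrier \<A>. acts_as A (matrix_operator A)) \<and>
    star_embedding matrix_operator \<A> operator_algebra \<and>
    inverse_closed (matrix_operator ` carrier \<A>) operator_algebra \<and>
    symmetric_algebra \<A>"
proof -
  interpret subexponential_weight "polynomial_weight \<alpha> \<nu>" l1_length
    by (rule subexponential_weight_polynomial_weight[OF assms(2-5)])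
  let ?A = "weighted_algebra :: ('d, 'h) op_matrix star_algebra"
  let ?B = "operator_algebra :: ((int^'d, 'h) ell2 \<Rightarrow>\<^sub>L (int^'d, 'h) ell2) star_algebra"
  have bd: "T \<in> weighted_operators \<Longrightarrow> T \<in> bounded_operators" for T :: "(int^'d, 'h) ell2 \<Rightarrow>\<^sub>L (int^'d, 'h) ell2"
    by (simp add: weighted_operators_def)
  have "solid (carrier ?A) wnorm"
    unfolding solid_def
  proof (intro ballI allI impI)
    fix A B :: "('d, 'h) op_matrix"
    assume A: "A \<in> carrier ?A" and B: "\<forall>k l. B k l \<in> bounded_operators"
      and "\<forall>k l. norm (B k l) \<le> norm (A k l)"
    then have le: "wsum (polynomial_weight \<alpha> \<nu>) B \<le> wsum (polynomial_weight \<alpha> \<nu>) A"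
      by (intro wsum_mono) simp
    \<comment> \<open>\<open>enn2real\<close> sends infinity to 0, so its monotonicity requires the
      larger value to be finite.\<close>
    have fin: "wsum (polynomial_weight \<alpha> \<nu>) A < \<infinity>"
      using A by (auto simp: carrier_weighted_algebra weighted_operators_def)
    with le have "wsum (polynomial_weight \<alpha> \<nu>) B < \<infinity>"
      by (rule order_le_less_trans)
    then obtain T where "B = opmat T" "T \<in> weighted_operators"
      using weighted_operators_of_matrix B by blast
    then show "B \<in> carrier ?A \<and> wnorm B \<le> wnorm A"
      using le fin by (simp add: carrier_weighted_algebra enn2real_mono)
  qed
  then have 1: "\<exists>N. banach_star_algebra ?A N \<and> solid (carrier ?A) N"
    using banach_star_algebra_weighted_algebra by blast
  have 2: "\<forall>A\<in>carrier ?A. acts_as A (matrix_operator A)"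
    by (auto simp: carrier_weighted_algebra matrix_operator_opmat acts_as_opmat)
  \<comment> \<open>On the carrier \<open>matrix_operator\<close> undoes \<open>opmat\<close>, so
    the rules for \<open>weighted_algebra\<close> become the homomorphism properties.\<close>
  have 3: "star_embedding matrix_operator ?A ?B"
    by (auto simp: star_embedding_def ring_hom_def inj_on_def weighted_algebra_simps
        matrix_operator_opmat operator_algebra_def bd)
  have im: "matrix_operator ` carrier ?A = weighted_operators"
    by (simp add: carrier_weighted_algebra image_image matrix_operator_opmat)
  have 4: "inverse_closed (matrix_operator ` carrier ?A) ?B"
    unfolding inverse_closed_def im
  proof (intro conjI ballI impI)
    show "weighted_operators \<subseteq> carrier ?B" "\<one>\<^bsub>?B\<^esub> \<in> weighted_operators"
      using bd weighted_operators_id by (auto simp: operator_algebra_def)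
    fix T assume T: "T \<in> weighted_operators" "T \<in> Units ?B"
    interpret B: monoid ?B
      by (rule monoid_operator_algebra)
    show "inv\<^bsub>?B\<^esub> T \<in> weighted_operators"
      using B.Units_l_inv[OF T(2)] B.Units_r_inv[OF T(2)]
      by (intro weighted_operators_inverse[OF T(1)]) (simp_all add: operator_algebra_def)
  qed
  have 5: "symmetric_algebra ?A"
    unfolding symmetric_algebra_def
  proof (intro ballI subsetI)
    fix x c assume "x \<in> carrier ?A"
      and c: "c \<in> algebra_spectrum ?A (involution ?A x \<otimes>\<^bsub>?A\<^esub> x)"
    then obtain T where T: "x = opmat T" "T \<in> weighted_operators"
      by (auto simp: carrier_weighted_algebra)
    let ?X = "scaleC_op c id_blinfun - (cadjoint T o\<^sub>L T)"
    have X: "?X \<in> weighted_operators"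
      using T by (intro weighted_operators_closed)
    show "c \<in> \<real>\<^sub>\<ge>\<^sub>0"
    proof (rule ccontr)
      assume "c \<notin> \<real>\<^sub>\<ge>\<^sub>0"
      then obtain Q where Q: "Q \<in> weighted_operators" "?X o\<^sub>L Q = id_blinfun" "Q o\<^sub>L ?X = id_blinfun"
        using weighted_operators_gram_resolvent[OF T(2)] by blast
      \<comment> \<open>The inverse \<open>Q\<close> lies in the class, so \<open>c\<close> is
        excluded from the spectrum relative to \<open>?A\<close> itself and not just from the
        operator spectrum.\<close>
      have "opmat ?X \<in> Units ?A"
        unfolding Units_def using Q X
        by (auto simp: weighted_algebra_simps intro!: bexI[of _ Q])
      then show False
        using c T by (simp add: algebra_spectrum_def weighted_algebra_simps minus_opmat)
    qed
  qed
  show ?thesis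
    unfolding matrix_algebra_eq[OF assms(2-5)] Let_def using 1 2 3 4 5 by blast
qed

end
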